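(* Let $(M^m,\mathcal{E},\langle\ ,\ \rangle,D,\varphi,\psi)$ be a front bundle over an oriented $m$-manifold $M^m$, and let $p\in M^m$ be an $A_2$-point of $\varphi$. Then the following hold: (1) Suppose that $K^{\mathrm{ext}}$ is bounded except on the singular set near $p$ (i.e. bounded on $V\setminus\Sigma_\varphi$ for some neighbourhood $V$ of $p$). Then $\mathit{II}(X,Y)=0$ holds for all $X,Y\in T_pM^m$. (2) If $K^{\mathrm{ext}}$ does not change sign on a neighbourhood of $p$ with the singular set $\Sigma_\varphi$ removed, then $K^{\mathrm{ext}}$ is bounded on that neighbourhood of $p$ with the singular set $\Sigma_\varphi$ removed. (3) If $K^{\mathrm{ext}}$ is non-negative except on the singular set near $p$, then the $\varphi$-singular principal curvatures at $p$ are all non-positive. Furthermore, if there exist a $C^\infty$ vector field $\tilde\eta$ defined on a neighbourhood $U$ of $p$ and a constant $\delta>0$ such that the restriction of $\tilde\eta$ to $U\cap\Sigma_\varphi$ gives a null vector field, and $K^{\mathrm{ext}}(X\wedge\tilde\eta)\ge\delta$ holds on $U\setminus\Sigma_\varphi$ for each $C^\infty$ vector field $X$ on $U$ satisfying $X\wedge\tilde\eta\neq0$, then the $\varphi$-singular principal curvatures are all negative at $p$.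
   Context: Everything is $C^\infty$. A coherent tangent bundle over an oriented $m$-manifold $M^m$ is a tuple $(M^m,\mathcal{E},\langle\ ,\ \rangle,D,\varphi)$ where $\mathcal{E}$ is a rank $m$ real vector bundle over $M^m$ with an inner product $\langle\ ,\ \rangle$, $D$ is a metric connection on $\mathcal{E}$, and $\varphi:TM^m\to\mathcal{E}$ is a bundle homomorphism with $D_X\varphi(Y)-D_Y\varphi(X)-\varphi([X,Y])=0$ for all vector fields $X,Y$. It is assumed co-orientable: $\mathcal{E}$ is oriented, and $\mu$ denotes the section of $\det\mathcal{E}^*$ equal to $1$ on positive orthonormal frames. A frontal bundle $(M^m,\mathcal{E},\langle\ ,\ \rangle,D,\varphi,\psi)$ consists of co-orientable coherent tangent bundles $(M^m,\mathcal{E},\langle\ ,\ \rangle,D,\varphi)$ and $(M^m,\mathcal{E},\langle\ ,\ \rangle,D,\psi)$ with $\langle\varphi(X),\psi(Y)\rangle=\langle\varphi(Y),\psi(X)\rangle$; it is a front bundle if $\ker\varphi_q\cap\ker\psi_q=\{0\}$ for all $q\in M^m$. Put $\mathit{I}(X,Y)=ds^2_\varphi(X,Y)=\langle\varphi(X),\varphi(Y)\rangle$ and $\mathit{II}(X,Y)=-\langle\varphi(X),\psi(Y)\rangle$. The singular set $\Sigma_\varphi$ is the set of points $q$ where $\varphi_q:T_qM^m\to\mathcal{E}_q$ is not bijective. For $q\notin\Sigma_\varphi$ and linearly independent $X,Y\in T_qM^m$, the extrinsic curvature is $$K^{\mathrm{ext}}(X\wedge Y)=\frac{\mathit{II}(X,X)\mathit{II}(Y,Y)-\mathit{II}(X,Y)^2}{\mathit{I}(X,X)\mathit{I}(Y,Y)-\mathit{I}(X,Y)^2}.$$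 It is regarded as a function on 2-planes tangent to $M^m\setminus\Sigma_\varphi$; statements such as bounded, non-negative, not changing sign refer to all such 2-planes over the indicated set. In positively oriented local coordinates $(u_1,\dots,u_m)$ put $\lambda_\varphi=\mu(\varphi(\partial_{u_1}),\dots,\varphi(\partial_{u_m}))$, so $\Sigma_\varphi=\{\lambda_\varphi=0\}$ locally. A point $p\in\Sigma_\varphi$ is non-degenerate if $d\lambda_\varphi(p)\ne0$; then near $p$ the set $\Sigma_\varphi$ is a hypersurface of $M^m$ and $\ker\varphi$ is one-dimensional along it; a nowhere vanishing section $\eta$ of $\ker\varphi$ along $\Sigma_\varphi$ is called a null vector field. A non-degenerate $p$ is an $A_2$-point of $\varphi$ if $\eta(p)$ is transversal to $\Sigma_\varphi$. Near an $A_2$-point, $\varphi|_{T\Sigma_\varphi}$ is injective, so $ds^2_\varphi$ is a Riemannian metric on $\Sigma_\varphi$. Let $e_1,\dots,e_{m-1}$ be a local orthonormal frame of $T\Sigma_\varphi$, let $\boldsymbol{n}$ be the section of $\mathcal{E}$ along $\Sigma_\varphi$ such that $(\varphi(e_1),\dots,\varphi(e_{m-1}),\boldsymbol{n})$ is a positive orthonormal frame, and choose $\eta$ so that $(e_1,\dots,e_{m-1},\eta)$ is positively oriented in $M^m$. The singular shape operator is $$S_\varphi(X)=-\operatorname{sgn}\bigl(d\lambda_\varphi(\eta)\bigr)\,(\varphi|_{T\Sigma_\varphi})^{-1}(D_X\boldsymbol{n}),\qquad X\in T\Sigma_\varphi.$$ It is a $ds^2_\varphi$-symmetric endomorphism of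 $T\Sigma_\varphi$ independent of the choices made. Its eigenvalues are the $\varphi$-singular principal curvatures.
   Formalization: In (2) boundedness is proved on some smaller neighbourhood of p, since on the given neighbourhood it can fail far from p; in (3) the bound K^ext(X∧η̃) ≥ δ is required at each point of U∖Σ where X∧η̃ ≠ 0, for every smooth X on U, as otherwise it may be vacuous. *)

theory Defs
  imports "HOL-Analysis.Analysis"
begin

text \<open>
  The manifold \<open>M\<close> is the whole type \<open>'a\<close> (Hausdorff, second countable, not assumed connected)
  with an oriented smooth atlas of dimension \<open>m = CARD('m)\<close>.  The index type \<open>'m\<close> carries no
  order; only families indexed by the same type (coordinates, frames) are compared, so
  determinants and orientations do not depend on one.
\<close>


section \<open>Smooth maps between open subsets of Euclidean spaces\<close>

fun Ck_on :: "nat \<Rightarrow> 'v::euclidean_space set \<Rightarrow> ('v \<Rightarrow> 'w::real_normed_vector) \<Rightarrow> bool" where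
  "Ck_on 0 S f = continuous_on S f"
| "Ck_on (Suc k) S f =
    ((\<forall>x\<in>S. f differentiable (at x)) \<and> (\<forall>v. Ck_on k S (\<lambda>x. frechet_derivative f (at x) v)))"

text \<open>Only meaningful for open \<open>S\<close>.\<close>

definition smooth_on :: "'v::euclidean_space set \<Rightarrow> ('v \<Rightarrow> 'w::real_normed_vector) \<Rightarrow> bool" where
  "smooth_on S f \<longleftrightarrow> (\<forall>k. Ck_on k S f)"


section \<open>Oriented manifolds\<close>

type_synonym ('a, 'm) chart = "'a set \<times> ('a \<Rightarrow> real ^ 'm)"

abbreviation chart_inv :: "('a, 'm::finite) chart \<Rightarrow> real ^ 'm \<Rightarrow> 'a" where
  "chart_inv c \<equiv> inv_into (fst c) (snd c)"

definition oriented_atlas ::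
  "('a::{t2_space,second_countable_topology}, 'm::finite) chart set \<Rightarrow> bool" where
  "oriented_atlas A \<longleftrightarrow>
     \<Union> (fst ` A) = UNIV \<and>
     (\<forall>c\<in>A. open (fst c) \<and> open (snd c ` fst c) \<and>
        homeomorphism (fst c) (snd c ` fst c) (snd c) (chart_inv c)) \<and>
     (\<forall>c\<in>A. \<forall>d\<in>A.
        smooth_on (snd c ` (fst c \<inter> fst d)) (snd d \<circ> chart_inv c) \<and>
        (\<forall>x \<in> snd c ` (fst c \<inter> fst d).
           det (matrix (frechet_derivative (snd d \<circ> chart_inv c) (at x))) > 0))"

definition smooth_fun ::
  "('a::topological_space, 'm::finite) chart set \<Rightarrow> 'a set \<Rightarrow> ('a \<Rightarrow> 'w::real_normed_vector) \<Rightarrow> bool"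
  where
  "smooth_fun A U f \<longleftrightarrow> (\<forall>c\<in>A. smooth_on (snd c ` (U \<inter> fst c)) (f \<circ> chart_inv c))"

text \<open>
  The tangent space \<open>T\<^sub>qM\<close> is modelled by \<^typ>\<open>real ^ 'm\<close>: a tangent vector at \<open>q\<close> is given by its
  components with respect to one preferred chart \<open>chart_at A q\<close> around \<open>q\<close>.  Its components
  in another chart \<open>c\<close> around \<open>q\<close> are obtained by applying the differential of the coordinate
  change (\<open>tangent_comp\<close>).  The preferred chart may jump with \<open>q\<close>, so smoothness of a vector
  field is always expressed through \<open>tangent_comp\<close>.
\<close>

definition chart_at :: "('a, 'm::finite) chart set \<Rightarrow> 'a \<Rightarrow> ('a, 'm) chart" where
  "chart_at A q = (SOME c. c \<in> A \<and> q \<in> fst c)"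

definition tangent_comp ::
  "('a, 'm::finite) chart set \<Rightarrow> ('a, 'm) chart \<Rightarrow> 'a \<Rightarrow> real ^ 'm \<Rightarrow> real ^ 'm" where
  "tangent_comp A c q v =
     frechet_derivative (snd c \<circ> chart_inv (chart_at A q)) (at (snd (chart_at A q) q)) v"

text \<open>The coordinate vector \<open>\<partial>/\<partial>u\<^sub>i\<close> of the chart \<open>c\<close> at \<open>q\<close>.\<close>

definition coord_vec ::
  "('a, 'm::finite) chart set \<Rightarrow> ('a, 'm) chart \<Rightarrow> 'm \<Rightarrow> 'a \<Rightarrow> real ^ 'm" where
  "coord_vec A c i q =
     frechet_derivative (snd (chart_at A q) \<circ> chart_inv c) (at (snd c q)) (axis i 1)"

definition smooth_vf ::
  "('a::topological_space, 'm::finite) chart set \<Rightarrow> 'a set \<Rightarrow> ('a \<Rightarrow> real ^ 'm) \<Rightarrow> bool" where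
  "smooth_vf A U X \<longleftrightarrow> (\<forall>c\<in>A. smooth_on (snd c ` (U \<inter> fst c))
     (\<lambda>x. tangent_comp A c (chart_inv c x) (X (chart_inv c x))))"

text \<open>The differential \<open>df\<^sub>q(v)\<close>.\<close>

definition dfun ::
  "('a, 'm::finite) chart set \<Rightarrow> ('a \<Rightarrow> 'w::real_normed_vector) \<Rightarrow> 'a \<Rightarrow> real ^ 'm \<Rightarrow> 'w" where
  "dfun A f q v =
     frechet_derivative (f \<circ> chart_inv (chart_at A q)) (at (snd (chart_at A q) q)) v"

text \<open>
  \<open>[X,Y]\<^sub>q\<close>, computed in the preferred chart \<open>c\<close> at \<open>q\<close> as \<open>DY\<^sup>c(X\<^sup>c) - DX\<^sup>c(Y\<^sup>c)\<close>, where \<open>X\<^sup>c\<close> are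
  the components of \<open>X\<close> in the fixed chart \<open>c\<close>; at \<open>q\<close> itself these are \<open>X q\<close>.
\<close>

definition lie_bracket ::
  "('a, 'm::finite) chart set \<Rightarrow> ('a \<Rightarrow> real ^ 'm) \<Rightarrow> ('a \<Rightarrow> real ^ 'm) \<Rightarrow> 'a \<Rightarrow> real ^ 'm" where
  "lie_bracket A X Y q =
     (let c = chart_at A q in
        dfun A (\<lambda>r. tangent_comp A c r (Y r)) q (X q)
      - dfun A (\<lambda>r. tangent_comp A c r (X r)) q (Y q))"

text \<open>
  Vectors at \<open>q\<close> tangent to a subset \<open>S\<close>: the velocities of curves through \<open>q\<close> that stay in \<open>S\<close>.
  For a hypersurface \<open>S\<close> this is the usual tangent space \<open>T\<^sub>qS\<close>.
\<close>

definition tangent_to ::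
  "('a::topological_space, 'm::finite) chart set \<Rightarrow> 'a set \<Rightarrow> 'a \<Rightarrow> (real ^ 'm) set" where
  "tangent_to A S q = {v. \<exists>\<gamma>::real \<Rightarrow> 'a. \<gamma> 0 = q \<and> isCont \<gamma> 0 \<and> (\<forall>\<^sub>F t in nhds 0. \<gamma> t \<in> S) \<and>
     ((\<lambda>t. snd (chart_at A q) (\<gamma> t)) has_vector_derivative v) (at 0)}"


section \<open>Oriented vector bundles with metric and connection\<close>

text \<open>
  \<open>(W, s)\<close> with \<open>s i\<close> (\<open>i :: 'm\<close>) the sections of a local frame over \<open>W\<close>; it is the same datum
  as a local trivialisation over \<open>W\<close>.
\<close>

type_synonym ('a, 'e, 'm) local_frame = "'a set \<times> ('m \<Rightarrow> 'a \<Rightarrow> 'e)"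

text \<open>
  The data \<open>(M, E, \<langle>,\<rangle>, D)\<close>.  The fibres of \<open>E\<close> are subspaces of a real vector space \<open>'e\<close>, which
  has no further role; the smooth structure and the orientation of \<open>E\<close> are given by \<open>Frames\<close>.
  \<open>Conn q v s\<close> is \<open>D\<^sub>v s\<close> for \<open>v \<in> T\<^sub>qM\<close> and \<open>s\<close> a section defined near \<open>q\<close>.
\<close>

record ('a, 'e, 'm) bundle_data =
  Atlas :: "('a, 'm) chart set"
  Fibre :: "'a \<Rightarrow> 'e set"
  Frames :: "('a, 'e, 'm) local_frame set"
  Inner :: "'a \<Rightarrow> 'e \<Rightarrow> 'e \<Rightarrow> real"
  Conn :: "'a \<Rightarrow> real ^ 'm \<Rightarrow> ('a \<Rightarrow> 'e) \<Rightarrow> 'e"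

definition frame_comp ::
  "('a, 'e::real_vector, 'm::finite) local_frame \<Rightarrow> 'a \<Rightarrow> 'e \<Rightarrow> real ^ 'm" where
  "frame_comp F q v = (THE a. (\<Sum>i\<in>UNIV. (a $ i) *\<^sub>R snd F i q) = v)"

definition oriented_bundle ::
  "('a::{t2_space,second_countable_topology}, 'e::real_vector, 'm::finite) bundle_data \<Rightarrow> bool"
  where
  "oriented_bundle B \<longleftrightarrow>
     oriented_atlas (Atlas B) \<and>
     (\<forall>q. subspace (Fibre B q) \<and> dim (Fibre B q) = CARD('m)) \<and>
     \<Union> (fst ` Frames B) = UNIV \<and>
     (\<forall>F\<in>Frames B. open (fst F) \<and>
        (\<forall>q\<in>fst F. inj (\<lambda>i. snd F i q) \<and> independent (range (\<lambda>i. snd F i q)) \<and>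
                   span (range (\<lambda>i. snd F i q)) = Fibre B q)) \<and>
     (\<forall>F\<in>Frames B. \<forall>G\<in>Frames B.
        (\<forall>i. smooth_fun (Atlas B) (fst F \<inter> fst G) (\<lambda>q. frame_comp G q (snd F i q))) \<and>
        (\<forall>q \<in> fst F \<inter> fst G. det (\<chi> i. frame_comp G q (snd F i q)) > 0))"

definition smooth_sec ::
  "('a::topological_space, 'e::real_vector, 'm::finite) bundle_data \<Rightarrow> 'a set \<Rightarrow> ('a \<Rightarrow> 'e) \<Rightarrow> bool"
  where
  "smooth_sec B U s \<longleftrightarrow>
     (\<forall>q\<in>U. s q \<in> Fibre B q) \<and>
     (\<forall>F\<in>Frames B. smooth_fun (Atlas B) (U \<inter> fst F) (\<lambda>q. frame_comp F q (s q)))"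

definition bundle_metric ::
  "('a::topological_space, 'e::real_vector, 'm::finite) bundle_data \<Rightarrow> bool" where
  "bundle_metric B \<longleftrightarrow>
     (\<forall>q. \<forall>u\<in>Fibre B q. \<forall>v\<in>Fibre B q. \<forall>w\<in>Fibre B q. \<forall>a b.
        Inner B q (a *\<^sub>R u + b *\<^sub>R v) w = a * Inner B q u w + b * Inner B q v w) \<and>
     (\<forall>q. \<forall>u\<in>Fibre B q. \<forall>v\<in>Fibre B q. Inner B q u v = Inner B q v u) \<and>
     (\<forall>q. \<forall>u\<in>Fibre B q. u \<noteq> 0 \<longrightarrow> Inner B q u u > 0) \<and>
     (\<forall>U s t. open U \<longrightarrow> smooth_sec B U s \<longrightarrow> smooth_sec B U t \<longrightarrow>
        smooth_fun (Atlas B) U (\<lambda>q. Inner B q (s q) (t q)))"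

text \<open>
  A connection, as a differential operator acting on local sections: the second clause says
  that \<open>D\<^sub>v s\<close> only depends on the germ of \<open>s\<close>.
\<close>

definition connection ::
  "('a::topological_space, 'e::real_vector, 'm::finite) bundle_data \<Rightarrow> bool" where
  "connection B \<longleftrightarrow>
     (\<forall>U s X. open U \<longrightarrow> smooth_sec B U s \<longrightarrow> smooth_vf (Atlas B) U X \<longrightarrow>
        smooth_sec B U (\<lambda>q. Conn B q (X q) s)) \<and>
     (\<forall>U s t. open U \<longrightarrow> smooth_sec B U s \<longrightarrow> (\<forall>q\<in>U. t q = s q) \<longrightarrow>
        (\<forall>q\<in>U. \<forall>v. Conn B q v t = Conn B q v s)) \<and>
     (\<forall>U s. open U \<longrightarrow> smooth_sec B U s \<longrightarrow> (\<forall>q\<in>U. linear (\<lambda>v. Conn B q v s))) \<and>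
     (\<forall>U s t. open U \<longrightarrow> smooth_sec B U s \<longrightarrow> smooth_sec B U t \<longrightarrow>
        (\<forall>q\<in>U. \<forall>v. Conn B q v (\<lambda>r. s r + t r) = Conn B q v s + Conn B q v t)) \<and>
     (\<forall>U f s. open U \<longrightarrow> smooth_fun (Atlas B) U f \<longrightarrow> smooth_sec B U s \<longrightarrow>
        (\<forall>q\<in>U. \<forall>v. Conn B q v (\<lambda>r. f r *\<^sub>R s r)
                     = dfun (Atlas B) f q v *\<^sub>R s q + f q *\<^sub>R Conn B q v s))"

definition metric_connection ::
  "('a::topological_space, 'e::real_vector, 'm::finite) bundle_data \<Rightarrow> bool" where
  "metric_connection B \<longleftrightarrow>
     connection B \<and>
     (\<forall>U s t. open U \<longrightarrow> smooth_sec B U s \<longrightarrow> smooth_sec B U t \<longrightarrow>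
        (\<forall>q\<in>U. \<forall>v. dfun (Atlas B) (\<lambda>r. Inner B r (s r) (t r)) q v
                     = Inner B q (Conn B q v s) (t q) + Inner B q (s q) (Conn B q v t)))"

definition positive_orthonormal ::
  "('a, 'e::real_vector, 'm::finite) bundle_data \<Rightarrow> 'a \<Rightarrow> ('m \<Rightarrow> 'e) \<Rightarrow> bool" where
  "positive_orthonormal B q b \<longleftrightarrow>
     (\<forall>i. b i \<in> Fibre B q) \<and>
     (\<forall>i j. Inner B q (b i) (b j) = (if i = j then 1 else 0)) \<and>
     (\<exists>F\<in>Frames B. q \<in> fst F \<and> det (\<chi> i. frame_comp F q (b i)) > 0)"

text \<open>
  \<open>\<mu>\<close>: the alternating form with value \<open>1\<close> on positive orthonormal bases of the fibre.  The
  chosen basis \<open>u\<close> is irrelevant, two of them differing by a matrix of determinant \<open>1\<close>.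
\<close>

definition vol ::
  "('a, 'e::real_vector, 'm::finite) bundle_data \<Rightarrow> 'a \<Rightarrow> ('m \<Rightarrow> 'e) \<Rightarrow> real" where
  "vol B q b =
     (let u = (SOME u. positive_orthonormal B q u) in det (\<chi> i j. Inner B q (b i) (u j)))"


section \<open>Coherent tangent bundles, frontal bundles, front bundles\<close>

definition bundle_hom ::
  "('a::topological_space, 'e::real_vector, 'm::finite) bundle_data \<Rightarrow> ('a \<Rightarrow> real ^ 'm \<Rightarrow> 'e) \<Rightarrow> bool"
  where
  "bundle_hom B \<phi> \<longleftrightarrow>
     (\<forall>q. linear (\<phi> q) \<and> range (\<phi> q) \<subseteq> Fibre B q) \<and>
     (\<forall>U X. open U \<longrightarrow> smooth_vf (Atlas B) U X \<longrightarrow> smooth_sec B U (\<lambda>q. \<phi> q (X q)))"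

definition coherent_tangent_bundle ::
  "('a::{t2_space,second_countable_topology}, 'e::real_vector, 'm::finite) bundle_data
     \<Rightarrow> ('a \<Rightarrow> real ^ 'm \<Rightarrow> 'e) \<Rightarrow> bool" where
  "coherent_tangent_bundle B \<phi> \<longleftrightarrow>
     oriented_bundle B \<and> bundle_metric B \<and> metric_connection B \<and> bundle_hom B \<phi> \<and>
     (\<forall>U X Y. open U \<longrightarrow> smooth_vf (Atlas B) U X \<longrightarrow> smooth_vf (Atlas B) U Y \<longrightarrow>
        (\<forall>q\<in>U. Conn B q (X q) (\<lambda>r. \<phi> r (Y r)) - Conn B q (Y q) (\<lambda>r. \<phi> r (X r))
                - \<phi> q (lie_bracket (Atlas B) X Y q) = 0))"

definition frontal_bundle ::
  "('a::{t2_space,second_countable_topology}, 'e::real_vector, 'm::finite) bundle_data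
     \<Rightarrow> ('a \<Rightarrow> real ^ 'm \<Rightarrow> 'e) \<Rightarrow> ('a \<Rightarrow> real ^ 'm \<Rightarrow> 'e) \<Rightarrow> bool" where
  "frontal_bundle B \<phi> \<psi> \<longleftrightarrow>
     coherent_tangent_bundle B \<phi> \<and> coherent_tangent_bundle B \<psi> \<and>
     (\<forall>q X Y. Inner B q (\<phi> q X) (\<psi> q Y) = Inner B q (\<phi> q Y) (\<psi> q X))"

definition front_bundle ::
  "('a::{t2_space,second_countable_topology}, 'e::real_vector, 'm::finite) bundle_data
     \<Rightarrow> ('a \<Rightarrow> real ^ 'm \<Rightarrow> 'e) \<Rightarrow> ('a \<Rightarrow> real ^ 'm \<Rightarrow> 'e) \<Rightarrow> bool" where
  "front_bundle B \<phi> \<psi> \<longleftrightarrow>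
     frontal_bundle B \<phi> \<psi> \<and> (\<forall>q. {v. \<phi> q v = 0} \<inter> {v. \<psi> q v = 0} = {0})"

definition first_form ::
  "('a, 'e, 'm::finite) bundle_data \<Rightarrow> ('a \<Rightarrow> real ^ 'm \<Rightarrow> 'e) \<Rightarrow> 'a \<Rightarrow> real ^ 'm \<Rightarrow> real ^ 'm \<Rightarrow> real"
  where
  "first_form B \<phi> q X Y = Inner B q (\<phi> q X) (\<phi> q Y)"

definition second_form ::
  "('a, 'e, 'm::finite) bundle_data \<Rightarrow> ('a \<Rightarrow> real ^ 'm \<Rightarrow> 'e) \<Rightarrow> ('a \<Rightarrow> real ^ 'm \<Rightarrow> 'e)
     \<Rightarrow> 'a \<Rightarrow> real ^ 'm \<Rightarrow> real ^ 'm \<Rightarrow> real" where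
  "second_form B \<phi> \<psi> q X Y = - Inner B q (\<phi> q X) (\<psi> q Y)"

definition singular_set ::
  "('a, 'e, 'm::finite) bundle_data \<Rightarrow> ('a \<Rightarrow> real ^ 'm \<Rightarrow> 'e) \<Rightarrow> 'a set" where
  "singular_set B \<phi> = {q. \<not> bij_betw (\<phi> q) UNIV (Fibre B q)}"

definition K_ext ::
  "('a, 'e, 'm::finite) bundle_data \<Rightarrow> ('a \<Rightarrow> real ^ 'm \<Rightarrow> 'e) \<Rightarrow> ('a \<Rightarrow> real ^ 'm \<Rightarrow> 'e)
     \<Rightarrow> 'a \<Rightarrow> real ^ 'm \<Rightarrow> real ^ 'm \<Rightarrow> real" where
  "K_ext B \<phi> \<psi> q X Y =
     (second_form B \<phi> \<psi> q X X * second_form B \<phi> \<psi> q Y Y - (second_form B \<phi> \<psi> q X Y)\<^sup>2) /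
     (first_form B \<phi> q X X * first_form B \<phi> q Y Y - (first_form B \<phi> q X Y)\<^sup>2)"

definition lin_indep2 :: "'v::real_vector \<Rightarrow> 'v \<Rightarrow> bool" where
  "lin_indep2 X Y \<longleftrightarrow> X \<noteq> Y \<and> independent {X, Y}"

text \<open>The values of \<open>K\<^sup>e\<^sup>x\<^sup>t\<close> on all 2-planes tangent to \<open>M\<close> at points of \<open>V - \<Sigma>\<^sub>\<phi>\<close>.\<close>

definition K_values ::
  "('a, 'e, 'm::finite) bundle_data \<Rightarrow> ('a \<Rightarrow> real ^ 'm \<Rightarrow> 'e) \<Rightarrow> ('a \<Rightarrow> real ^ 'm \<Rightarrow> 'e)
     \<Rightarrow> 'a set \<Rightarrow> real set" where
  "K_values B \<phi> \<psi> V = {K_ext B \<phi> \<psi> q X Y | q X Y. q \<in> V - singular_set B \<phi> \<and> lin_indep2 X Y}"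


section \<open>Singular points\<close>

definition lam ::
  "('a, 'e::real_vector, 'm::finite) bundle_data \<Rightarrow> ('a \<Rightarrow> real ^ 'm \<Rightarrow> 'e) \<Rightarrow> ('a, 'm) chart
     \<Rightarrow> 'a \<Rightarrow> real" where
  "lam B \<phi> c q = vol B q (\<lambda>i. \<phi> q (coord_vec (Atlas B) c i q))"

text \<open>
  \<open>d\<lambda>\<^sub>\<phi>\<close> at \<open>q\<close> for the coordinates of the preferred chart at \<open>q\<close>.  At points of \<open>\<Sigma>\<^sub>\<phi>\<close> other positively
  oriented coordinates change it by a positive factor only.
\<close>

definition dlam ::
  "('a, 'e::real_vector, 'm::finite) bundle_data \<Rightarrow> ('a \<Rightarrow> real ^ 'm \<Rightarrow> 'e) \<Rightarrow> 'a \<Rightarrow> real ^ 'm \<Rightarrow> real"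
  where
  "dlam B \<phi> q v = dfun (Atlas B) (lam B \<phi> (chart_at (Atlas B) q)) q v"

definition nondegenerate ::
  "('a, 'e::real_vector, 'm::finite) bundle_data \<Rightarrow> ('a \<Rightarrow> real ^ 'm \<Rightarrow> 'e) \<Rightarrow> 'a \<Rightarrow> bool" where
  "nondegenerate B \<phi> q \<longleftrightarrow> q \<in> singular_set B \<phi> \<and> (\<exists>v. dlam B \<phi> q v \<noteq> 0)"

abbreviation sing_tangent ::
  "('a::topological_space, 'e, 'm::finite) bundle_data \<Rightarrow> ('a \<Rightarrow> real ^ 'm \<Rightarrow> 'e) \<Rightarrow> 'a \<Rightarrow> (real ^ 'm) set"
  where
  "sing_tangent B \<phi> q \<equiv> tangent_to (Atlas B) (singular_set B \<phi>) q"

text \<open>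
  Objects along \<open>\<Sigma>\<^sub>\<phi>\<close> (null vector fields, and below the frame \<open>e\<close> and the normal \<open>n\<close>) are given by
  smooth objects on an open subset \<open>U\<close> of \<open>M\<close>, of which only the restriction to \<open>U \<inter> \<Sigma>\<^sub>\<phi>\<close> matters.
\<close>

definition null_vf ::
  "('a::topological_space, 'e::real_vector, 'm::finite) bundle_data \<Rightarrow> ('a \<Rightarrow> real ^ 'm \<Rightarrow> 'e)
     \<Rightarrow> 'a set \<Rightarrow> ('a \<Rightarrow> real ^ 'm) \<Rightarrow> bool" where
  "null_vf B \<phi> U \<eta> \<longleftrightarrow>
     smooth_vf (Atlas B) U \<eta> \<and> (\<forall>q \<in> U \<inter> singular_set B \<phi>. \<eta> q \<noteq> 0 \<and> \<phi> q (\<eta> q) = 0)"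

definition A2_point ::
  "('a::topological_space, 'e::real_vector, 'm::finite) bundle_data \<Rightarrow> ('a \<Rightarrow> real ^ 'm \<Rightarrow> 'e)
     \<Rightarrow> 'a \<Rightarrow> bool" where
  "A2_point B \<phi> p \<longleftrightarrow>
     nondegenerate B \<phi> p \<and>
     (\<exists>U \<eta>. open U \<and> p \<in> U \<and> null_vf B \<phi> U \<eta> \<and> \<eta> p \<notin> sing_tangent B \<phi> p)"

text \<open>
  The local data in the definition of the singular shape operator.  The frame of \<open>T\<Sigma>\<^sub>\<phi>\<close> is
  \<open>(e i)\<close> for \<open>i \<noteq> k\<close>, and \<open>k\<close> is the slot of the families \<open>(\<phi>(e\<^sub>1), \<dots>, \<phi>(e\<^sub>m\<^sub>-\<^sub>1), n)\<close> and
  \<open>(e\<^sub>1, \<dots>, e\<^sub>m\<^sub>-\<^sub>1, \<eta>)\<close> that holds \<open>n\<close> and \<open>\<eta>\<close> respectively.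
\<close>

definition adapted_frame ::
  "('a::topological_space, 'e::real_vector, 'm::finite) bundle_data \<Rightarrow> ('a \<Rightarrow> real ^ 'm \<Rightarrow> 'e)
     \<Rightarrow> 'a set \<Rightarrow> 'm \<Rightarrow> ('m \<Rightarrow> 'a \<Rightarrow> real ^ 'm) \<Rightarrow> ('a \<Rightarrow> 'e) \<Rightarrow> ('a \<Rightarrow> real ^ 'm) \<Rightarrow> bool" where
  "adapted_frame B \<phi> U k e n \<eta> \<longleftrightarrow>
     open U \<and> (\<forall>i. i \<noteq> k \<longrightarrow> smooth_vf (Atlas B) U (e i)) \<and> smooth_sec B U n \<and> null_vf B \<phi> U \<eta> \<and>
     (\<forall>q \<in> U \<inter> singular_set B \<phi>.
        nondegenerate B \<phi> q \<and>
        (\<forall>i. i \<noteq> k \<longrightarrow> e i q \<in> sing_tangent B \<phi> q) \<and>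
        (\<forall>i j. i \<noteq> k \<longrightarrow> j \<noteq> k \<longrightarrow> first_form B \<phi> q (e i q) (e j q) = (if i = j then 1 else 0)) \<and>
        positive_orthonormal B q (\<lambda>i. if i = k then n q else \<phi> q (e i q)) \<and>
        det (\<chi> i. if i = k then \<eta> q else e i q) > 0)"

definition singular_shape ::
  "('a::topological_space, 'e::real_vector, 'm::finite) bundle_data \<Rightarrow> ('a \<Rightarrow> real ^ 'm \<Rightarrow> 'e)
     \<Rightarrow> 'a \<Rightarrow> ('a \<Rightarrow> 'e) \<Rightarrow> ('a \<Rightarrow> real ^ 'm) \<Rightarrow> real ^ 'm \<Rightarrow> real ^ 'm" where
  "singular_shape B \<phi> p n \<eta> X =
     - (sgn (dlam B \<phi> p (\<eta> p)) *\<^sub>R inv_into (sing_tangent B \<phi> p) (\<phi> p) (Conn B p X n))"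

definition singular_principal_curvature ::
  "('a::topological_space, 'e::real_vector, 'm::finite) bundle_data \<Rightarrow> ('a \<Rightarrow> real ^ 'm \<Rightarrow> 'e)
     \<Rightarrow> 'a \<Rightarrow> real \<Rightarrow> bool" where
  "singular_principal_curvature B \<phi> p \<kappa> \<longleftrightarrow>
     (\<exists>U k e n \<eta>. p \<in> U \<and> adapted_frame B \<phi> U k e n \<eta> \<and>
        (\<exists>X \<in> sing_tangent B \<phi> p. X \<noteq> 0 \<and> singular_shape B \<phi> p n \<eta> X = \<kappa> *\<^sub>R X))"

end

theory Submission
  imports Defs "HOL-Computational_Algebra.Polynomial"
begin

text \<open>
  Everything takes place in a chart around \<open>p\<close> and a local frame of the bundle.  There \<open>\<phi>\<close> and \<open>\<psi>\<close>
  become families \<open>P\<close>, \<open>Q\<close> of linear maps, and up to a positive factor \<open>\<lambda>\<close> is the determinant \<open>Lam\<close> of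
  \<open>P\<close>.  Let \<open>\<eta>\<close> be a null vector field, \<open>h\<close> its value at \<open>p\<close>, and \<open>\<alpha>\<close> the derivative of \<open>\<phi>(\<eta>)\<close> in the
  direction \<open>h\<close>.  The whole argument is the expansion of the sectional curvature of \<open>v \<and> \<eta>\<close> along the
  line \<open>t \<mapsto> p + t h\<close>, which crosses the singular set at \<open>t = 0\<close>.

  Differentiating the determinant shows that transversality of \<open>h\<close> means \<open>\<alpha> \<notin> im \<phi>\<^sub>p\<close>.  Therefore the
  denominator of the curvature is \<open>t\<^sup>2 D0 + o(t\<^sup>2)\<close> with \<open>D0 > 0\<close>.  By the symmetry of \<open>\<langle>\<phi>(X), \<psi>(Y)\<rangle>\<close> the
  vector \<open>\<psi>(h)\<close> is orthogonal to \<open>im \<phi>\<^sub>p\<close>, and it is nonzero by the front condition; so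
  \<open>\<langle>\<alpha>, \<psi>(h)\<rangle> \<noteq> 0\<close>, and the numerator is \<open>- t II(v, v) \<langle>\<alpha>, \<psi>(h)\<rangle> + O(t\<^sup>2)\<close>.  Its leading term changes sign
  with \<open>t\<close>.  Any one-sided bound on the curvature, on both sides of the singular set, thus forces
  \<open>II(v, v) = 0\<close> and hence \<open>II = 0\<close> at \<open>p\<close> (\<open>II_vanishes\<close>).  This is the first claim.

  For the second claim the same reasoning applies at all singular points near \<open>p\<close>, so that \<open>II\<close>
  vanishes along the singular set, and therefore \<open>II = O(\<lambda>)\<close>: the numerator is \<open>O(\<lambda>\<^sup>2)\<close>.  On the other
  hand \<open>\<phi>\<close> degenerates in one direction only, and there at the rate \<open>\<lambda>\<close>, so the denominator is at
  least a multiple of \<open>\<lambda>\<^sup>2\<close> on unit area elements (\<open>curvature_bounded\<close>).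

  For the third claim, once \<open>II\<close> vanishes at \<open>p\<close>, the coefficients of \<open>t\<^sup>2\<close> in \<open>K \<ge> \<delta>\<close> yield
  \<open>- b \<langle>\<alpha>, \<psi>(h)\<rangle> \<ge> \<langle>\<alpha>, \<psi>(v)\<rangle>\<^sup>2 + \<delta> D0\<close>, where \<open>b\<close> is the derivative of \<open>II(v, v)\<close> along \<open>h\<close>
  (\<open>second_order_bound\<close>).  For \<open>v\<close> tangent to the singular set, the two torsion-free conditions and the
  metric property of the connection turn \<open>b\<close> into \<open>\<langle>D\<^sub>v \<phi>(v), \<psi>(h)\<rangle>\<close> (\<open>derivative_II_along_null\<close>).  As
  \<open>\<psi>(h)\<close> is a multiple of the unit normal \<open>n\<close>, and a principal curvature with eigenvector \<open>v\<close> satisfies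
  \<open>\<kappa> I(v, v) = sgn \<langle>\<alpha>, n\<rangle> \<langle>n, D\<^sub>v \<phi>(v)\<rangle>\<close>, the inequality determines its sign
  (\<open>principal_curvature_sign\<close>).
\<close>

section \<open>Calculus of smooth maps\<close>

lemma Ck_on_cong:
  assumes "open S" "\<And>x. x \<in> S \<Longrightarrow> f x = g x" "Ck_on k S f"
  shows "Ck_on k S g"
  using assms(2,3)
proof (induction k arbitrary: f g)
  case 0
  then show ?case by (simp cong: continuous_on_cong)
next
  case (Suc k)
  have der: "(g has_derivative frechet_derivative f (at x)) (at x)" if "x \<in> S" for x
  proof -
    have "(f has_derivative frechet_derivative f (at x)) (at x)"
      using Suc.prems(2) that frechet_derivative_works by auto
    then show ?thesis
      by (rule has_derivative_transform_within_open[OF _ assms(1) that]) (use Suc.prems(1) in auto)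
  qed
  then have "frechet_derivative g (at x) = frechet_derivative f (at x)" if "x \<in> S" for x
    using that frechet_derivative_at by metis
  with Suc.IH[of "\<lambda>x. frechet_derivative f (at x) v" "\<lambda>x. frechet_derivative g (at x) v" for v] Suc.prems(2) der
  show ?case by (auto simp: differentiable_def)
qed

lemma Ck_on_Suc_I:
  assumes "open S" "\<And>x. x \<in> S \<Longrightarrow> (f has_derivative f' x) (at x)"
    and "\<And>v. Ck_on k S (\<lambda>x. f' x v)"
  shows "Ck_on (Suc k) S f"
proof -
  have "frechet_derivative f (at x) = f' x" if "x \<in> S" for x
    using assms(2)[OF that] frechet_derivative_at by metis
  then have "Ck_on k S (\<lambda>x. frechet_derivative f (at x) v)" for v
    by (intro Ck_on_cong[OF assms(1) _ assms(3)]) simp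
  then show ?thesis using assms(2) by (auto simp: differentiable_def)
qed

lemma Ck_on_Suc_has_derivative:
  "Ck_on (Suc k) S f \<Longrightarrow> x \<in> S \<Longrightarrow> (f has_derivative frechet_derivative f (at x)) (at x)"
  using frechet_derivative_works by auto

lemma Ck_on_Suc_D: "Ck_on (Suc k) S f \<Longrightarrow> Ck_on k S f"
proof (induction k arbitrary: f)
  case 0
  then show ?case
    by (auto intro!: continuous_at_imp_continuous_on differentiable_imp_continuous_within)
next
  case (Suc k)
  have "Ck_on k S (\<lambda>x. frechet_derivative f (at x) v)" for v
    by (rule Suc.IH) (use Suc.prems in \<open>simp only: Ck_on.simps(2)[of "Suc k"]\<close>)
  then show ?case using Suc.prems unfolding Ck_on.simps(2) by simp
qed

lemma Ck_on_subset: "Ck_on k S f \<Longrightarrow> T \<subseteq> S \<Longrightarrow> Ck_on k T f"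
  by (induction k arbitrary: f) (auto intro: continuous_on_subset)

lemma Ck_on_local:
  assumes "\<And>x. x \<in> S \<Longrightarrow> \<exists>N. open N \<and> x \<in> N \<and> Ck_on k N f"
  shows "Ck_on k S f"
  using assms
proof (induction k arbitrary: f)
  case 0
  then show ?case
    by (metis Ck_on.simps(1) continuous_at_imp_continuous_on continuous_on_eq_continuous_at)
next
  case (Suc k)
  have "Ck_on k S (\<lambda>x. frechet_derivative f (at x) v)" for v
  proof (rule Suc.IH)
    show "\<exists>N. open N \<and> x \<in> N \<and> Ck_on k N (\<lambda>x. frechet_derivative f (at x) v)" if "x \<in> S" for x
      using Suc.prems[OF that] by (auto simp del: Ck_on.simps(1))
  qed
  moreover have "f differentiable (at x)" if "x \<in> S" for x
    using Suc.prems[OF that] by auto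
  ultimately show ?case by simp
qed

lemma Ck_on_const: "Ck_on k S (\<lambda>x. c)"
proof (induction k arbitrary: c)
  case (Suc k)
  then show ?case by (simp add: frechet_derivative_const)
qed simp

lemma Ck_on_linear:
  assumes "open S" "bounded_linear L"
  shows "Ck_on k S L"
proof (cases k)
  case 0
  then show ?thesis using assms linear_continuous_on by auto
next
  case (Suc n)
  show ?thesis unfolding Suc
    by (rule Ck_on_Suc_I[OF assms(1) bounded_linear_imp_has_derivative[OF assms(2)] Ck_on_const])
qed

lemma Ck_on_add:
  assumes "open S" "Ck_on k S f" "Ck_on k S g"
  shows "Ck_on k S (\<lambda>x. f x + g x)"
  using assms(2,3)
proof (induction k arbitrary: f g)
  case 0 then show ?case by (simp add: continuous_on_add)
next
  case (Suc k)
  show ?case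
    by (rule Ck_on_Suc_I[OF assms(1) has_derivative_add])
      (use Suc in \<open>auto intro: Ck_on_Suc_has_derivative[OF Suc.prems(1)] Ck_on_Suc_has_derivative[OF Suc.prems(2)]\<close>)
qed

lemma Ck_on_bounded_linear:
  assumes "open S" "bounded_linear L" "Ck_on k S f"
  shows "Ck_on k S (\<lambda>x. L (f x))"
  using assms(3)
proof (induction k arbitrary: f)
  case 0 then show ?case
    using assms(2) by (simp add: bounded_linear.continuous_on)
next
  case (Suc k)
  show ?case
    by (rule Ck_on_Suc_I[OF assms(1) bounded_linear.has_derivative[OF assms(2)]])
      (use Suc in \<open>auto intro: Ck_on_Suc_has_derivative[OF Suc.prems(1)]\<close>)
qed

lemma Ck_on_scaleR:
  fixes f :: "'v::euclidean_space \<Rightarrow> real"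
  assumes "open S" "Ck_on k S f" "Ck_on k S g"
  shows "Ck_on k S (\<lambda>x. f x *\<^sub>R g x)"
  using assms(2,3)
proof (induction k arbitrary: f g)
  case 0 then show ?case by (simp add: continuous_on_scaleR)
next
  case (Suc k)
  show ?case
  proof (rule Ck_on_Suc_I[OF assms(1)])
    show "((\<lambda>x. f x *\<^sub>R g x) has_derivative
        (\<lambda>v. f x *\<^sub>R frechet_derivative g (at x) v + frechet_derivative f (at x) v *\<^sub>R g x)) (at x)"
      if "x \<in> S" for x
      using Ck_on_Suc_has_derivative[OF Suc.prems(1) that] Ck_on_Suc_has_derivative[OF Suc.prems(2) that]
      by (rule has_derivative_scaleR)
    show "Ck_on k S (\<lambda>x. f x *\<^sub>R frechet_derivative g (at x) v + frechet_derivative f (at x) v *\<^sub>R g x)" for v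
      using Suc Ck_on_Suc_D[OF Suc.prems(1)] Ck_on_Suc_D[OF Suc.prems(2)]
      by (intro Ck_on_add[OF assms(1)] Suc.IH) auto
  qed
qed

lemma Ck_on_sum:
  assumes "open S" "\<And>i. i \<in> I \<Longrightarrow> Ck_on k S (f i)"
  shows "Ck_on k S (\<lambda>x. \<Sum>i\<in>I. f i x)"
  using assms(2)
  by (induction I rule: infinite_finite_induct) (auto intro: Ck_on_const Ck_on_add[OF assms(1)])

text \<open>
  The chain rule expresses a derivative of the composition as a sum of products of components of the
  derivative of the inner map with directional derivatives of the outer map composed with the inner
  map; these are covered by the induction hypothesis and the closure under products.
\<close>

lemma Ck_on_compose:
  fixes g :: "'v::euclidean_space \<Rightarrow> 'u::euclidean_space" and f :: "'u \<Rightarrow> 'w::real_normed_vector"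
  assumes "open S" "open T" "g ` S \<subseteq> T" "Ck_on k S g" "Ck_on k T f"
  shows "Ck_on k S (\<lambda>x. f (g x))"
  using assms(4,5)
proof (induction k arbitrary: f)
  case 0
  then show ?case using assms(3) by (auto intro: continuous_on_compose2)
next
  case (Suc k)
  note dg = Ck_on_Suc_has_derivative[OF Suc.prems(1)] and df = Ck_on_Suc_has_derivative[OF Suc.prems(2)]
  let ?D = "\<lambda>x v. \<Sum>b\<in>Basis. (frechet_derivative g (at x) v \<bullet> b) *\<^sub>R frechet_derivative f (at (g x)) b"
  have eq: "frechet_derivative f (at (g x)) (frechet_derivative g (at x) v) = ?D x v" if "x \<in> S" for x v
  proof -
    have "linear (frechet_derivative f (at (g x)))"
      using df[of "g x"] that assms(3) has_derivative_linear by blast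
    then show ?thesis
      by (subst euclidean_representation[symmetric, of "frechet_derivative g (at x) v"])
        (simp add: linear_sum linear_scale)
  qed
  show ?case
  proof (rule Ck_on_Suc_I[OF assms(1)])
    show "((\<lambda>x. f (g x)) has_derivative (\<lambda>v. frechet_derivative f (at (g x)) (frechet_derivative g (at x) v))) (at x)"
      if "x \<in> S" for x
      by (rule has_derivative_compose[OF dg df]) (use that assms(3) in auto)
    fix v
    have "Ck_on k S (\<lambda>x. ?D x v)"
    proof (intro Ck_on_sum[OF assms(1)] Ck_on_scaleR[OF assms(1)])
      fix b :: 'u assume "b \<in> Basis"
      show "Ck_on k S (\<lambda>x. frechet_derivative g (at x) v \<bullet> b)"
        using Suc.prems(1) by (auto intro!: Ck_on_bounded_linear[OF assms(1) bounded_linear_inner_left])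
      show "Ck_on k S (\<lambda>x. frechet_derivative f (at (g x)) b)"
        using Suc.prems Ck_on_Suc_D[OF Suc.prems(1)] by (intro Suc.IH) auto
    qed
    then show "Ck_on k S (\<lambda>x. frechet_derivative f (at (g x)) (frechet_derivative g (at x) v))"
      by (rule Ck_on_cong[OF assms(1), rotated]) (simp add: eq)
  qed
qed

lemma smooth_on_cong:
  "open S \<Longrightarrow> (\<And>x. x \<in> S \<Longrightarrow> f x = g x) \<Longrightarrow> smooth_on S f \<Longrightarrow> smooth_on S g"
  unfolding smooth_on_def using Ck_on_cong by blast

lemma smooth_on_subset: "smooth_on S f \<Longrightarrow> T \<subseteq> S \<Longrightarrow> smooth_on T f"
  unfolding smooth_on_def using Ck_on_subset by blast

lemma smooth_on_local:
  "(\<And>x. x \<in> S \<Longrightarrow> \<exists>N. open N \<and> x \<in> N \<and> smooth_on N f) \<Longrightarrow> smooth_on S f"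
  unfolding smooth_on_def by (meson Ck_on_local)

lemma smooth_on_const: "smooth_on S (\<lambda>x. c)"
  unfolding smooth_on_def using Ck_on_const by blast

lemma smooth_on_linear: "open S \<Longrightarrow> bounded_linear L \<Longrightarrow> smooth_on S L"
  unfolding smooth_on_def using Ck_on_linear by blast

lemma smooth_on_add:
  "open S \<Longrightarrow> smooth_on S f \<Longrightarrow> smooth_on S g \<Longrightarrow> smooth_on S (\<lambda>x. f x + g x)"
  unfolding smooth_on_def using Ck_on_add by blast

lemma smooth_on_bounded_linear:
  "open S \<Longrightarrow> bounded_linear L \<Longrightarrow> smooth_on S f \<Longrightarrow> smooth_on S (\<lambda>x. L (f x))"
  unfolding smooth_on_def using Ck_on_bounded_linear by blast

lemma smooth_on_scaleR:
  fixes f :: "'v::euclidean_space \<Rightarrow> real"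
  shows "open S \<Longrightarrow> smooth_on S f \<Longrightarrow> smooth_on S g \<Longrightarrow> smooth_on S (\<lambda>x. f x *\<^sub>R g x)"
  unfolding smooth_on_def using Ck_on_scaleR by blast

lemma smooth_on_mult:
  fixes f g :: "'v::euclidean_space \<Rightarrow> real"
  shows "open S \<Longrightarrow> smooth_on S f \<Longrightarrow> smooth_on S g \<Longrightarrow> smooth_on S (\<lambda>x. f x * g x)"
  using smooth_on_scaleR[of S f g] by simp

lemma smooth_on_uminus:
  "open S \<Longrightarrow> smooth_on S f \<Longrightarrow> smooth_on S (\<lambda>x. - f x)"
  by (rule smooth_on_bounded_linear[OF _ bounded_linear_minus[OF bounded_linear_ident]])

lemma smooth_on_sum:
  "open S \<Longrightarrow> (\<And>i. i \<in> I \<Longrightarrow> smooth_on S (f i)) \<Longrightarrow> smooth_on S (\<lambda>x. \<Sum>i\<in>I. f i x)"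
  unfolding smooth_on_def using Ck_on_sum[of S I] by blast

lemma smooth_on_prod:
  fixes f :: "'i \<Rightarrow> 'v::euclidean_space \<Rightarrow> real"
  assumes "open S" "\<And>i. i \<in> I \<Longrightarrow> smooth_on S (f i)"
  shows "smooth_on S (\<lambda>x. \<Prod>i\<in>I. f i x)"
  using assms(2)
  by (induction I rule: infinite_finite_induct) (auto intro: smooth_on_const smooth_on_mult[OF assms(1)])

lemma smooth_on_vec_nth: "open S \<Longrightarrow> smooth_on S f \<Longrightarrow> smooth_on S (\<lambda>x. f x $ i)"
  by (rule smooth_on_bounded_linear[OF _ bounded_linear_vec_nth])

lemma smooth_on_det:
  fixes f :: "'m::finite \<Rightarrow> 'v::euclidean_space \<Rightarrow> real ^ 'm"
  assumes "open S" "\<And>i. smooth_on S (f i)"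
  shows "smooth_on S (\<lambda>x. det (\<chi> i. f i x))"
  unfolding det_def
  by (intro smooth_on_sum smooth_on_mult smooth_on_const smooth_on_prod assms(1))
    (simp add: smooth_on_vec_nth assms)

lemma smooth_on_compose:
  fixes g :: "'v::euclidean_space \<Rightarrow> 'u::euclidean_space" and f :: "'u \<Rightarrow> 'w::real_normed_vector"
  shows "open S \<Longrightarrow> open T \<Longrightarrow> g ` S \<subseteq> T \<Longrightarrow> smooth_on S g \<Longrightarrow> smooth_on T f
    \<Longrightarrow> smooth_on S (\<lambda>x. f (g x))"
  unfolding smooth_on_def using Ck_on_compose by blast

lemma smooth_on_has_derivative:
  "smooth_on S f \<Longrightarrow> x \<in> S \<Longrightarrow> (f has_derivative frechet_derivative f (at x)) (at x)"
  unfolding smooth_on_def using Ck_on_Suc_has_derivative by blast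

lemma smooth_on_frechet_derivative:
  "smooth_on S f \<Longrightarrow> smooth_on S (\<lambda>x. frechet_derivative f (at x) v)"
  unfolding smooth_on_def by (metis Ck_on.simps(2))

lemma smooth_on_imp_continuous_on: "smooth_on S f \<Longrightarrow> continuous_on S f"
  unfolding smooth_on_def by (metis Ck_on.simps(1))

lemma smooth_on_imp_isCont: "smooth_on S f \<Longrightarrow> x \<in> S \<Longrightarrow> isCont f x"
  using smooth_on_has_derivative has_derivative_continuous by blast

text \<open>
  The functions \<open>p(1/x) exp(-1/x)\<close>, extended by zero.  Admitting a polynomial factor makes the family
  closed under differentiation, so that smoothness at the origin follows by induction.
\<close>

definition flat_exp :: "real poly \<Rightarrow> real \<Rightarrow> real" where
  "flat_exp p x = (if 0 < x then poly p (1 / x) * exp (- (1 / x)) else 0)"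

lemma poly_exp_tendsto_0: "((\<lambda>y. poly p y * exp (- y)) \<longlongrightarrow> 0) (at_top :: real filter)"
proof -
  have "((\<lambda>y::real. \<Sum>i\<le>degree p. coeff p i * (y ^ i / exp y)) \<longlongrightarrow> (\<Sum>i\<le>degree p. coeff p i * 0)) at_top"
    by (intro tendsto_sum tendsto_mult tendsto_const tendsto_power_div_exp_0)
  then show ?thesis
    by (simp add: poly_altdef sum_distrib_right exp_minus divide_inverse mult.assoc)
qed

lemma flat_exp_has_derivative:
  "(flat_exp p has_real_derivative flat_exp (monom 1 2 * (p - pderiv p)) x) (at x)"
proof (cases x "0::real" rule: linorder_cases)
  case less
  have "(flat_exp p has_real_derivative 0) (at x)"
    by (rule has_field_derivative_transform_within_open[of "\<lambda>_. 0" 0 x "{..<0}"])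
      (use less in \<open>auto simp: flat_exp_def\<close>)
  then show ?thesis using less by (simp add: flat_exp_def)
next
  case greater
  have "((\<lambda>x. poly p (1 / x) * exp (- (1 / x))) has_real_derivative
      poly (monom 1 2 * (p - pderiv p)) (1 / x) * exp (- (1 / x))) (at x)"
    using greater
    by (auto intro!: derivative_eq_intros DERIV_chain2[OF poly_DERIV]
        simp: poly_monom power2_eq_square field_simps)
  then have "(flat_exp p has_real_derivative
      poly (monom 1 2 * (p - pderiv p)) (1 / x) * exp (- (1 / x))) (at x)"
    by (rule has_field_derivative_transform_within_open[of _ _ x "{0<..}"])
      (use greater in \<open>auto simp: flat_exp_def\<close>)
  then show ?thesis using greater by (simp add: flat_exp_def)
next
  case equal
  have "((\<lambda>h. flat_exp p h / h) \<longlongrightarrow> 0) (at_right 0)"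
  proof (rule Lim_transform_eventually)
    show "((\<lambda>h. poly (pCons 0 p) (inverse h) * exp (- inverse h)) \<longlongrightarrow> 0) (at_right 0)"
      by (rule filterlim_compose[OF poly_exp_tendsto_0 filterlim_inverse_at_top_right])
    show "\<forall>\<^sub>F h in at_right 0. poly (pCons 0 p) (inverse h) * exp (- inverse h) = flat_exp p h / h"
      unfolding eventually_at_filter
      by (rule always_eventually) (simp add: flat_exp_def field_simps)
  qed
  moreover have "((\<lambda>h. flat_exp p h / h) \<longlongrightarrow> 0) (at_left 0)"
    by (rule Lim_transform_eventually[OF tendsto_const])
      (auto simp: flat_exp_def eventually_at_filter)
  ultimately have "((\<lambda>h. flat_exp p h / h) \<longlongrightarrow> 0) (at 0)"
    by (simp add: filterlim_at_split)
  then show ?thesis using equal by (simp add: DERIV_def flat_exp_def)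
qed

lemma smooth_on_flat_exp: "smooth_on UNIV (flat_exp p)"
proof -
  have "Ck_on k UNIV (flat_exp p)" for k
  proof (induction k arbitrary: p)
    case 0
    show ?case
      using DERIV_isCont[OF flat_exp_has_derivative] by (simp add: continuous_at_imp_continuous_on)
  next
    case (Suc k)
    show ?case
    proof (rule Ck_on_Suc_I[OF open_UNIV])
      show "(flat_exp p has_derivative (\<lambda>v. v * flat_exp (monom 1 2 * (p - pderiv p)) x)) (at x)" for x
        using flat_exp_has_derivative[of p x]
        by (simp add: has_field_derivative_def mult.commute[of _ "flat_exp _ x"] lambda_zero)
      show "Ck_on k UNIV (\<lambda>x. v * flat_exp (monom 1 2 * (p - pderiv p)) x)" for v
        by (rule Ck_on_bounded_linear[OF open_UNIV bounded_linear_mult_right Suc])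
    qed
  qed
  then show ?thesis by (simp add: smooth_on_def)
qed

text \<open>
  Used to extend constant coordinate fields from a chart to all of the manifold.
\<close>

lemma smooth_bump:
  fixes x0 :: "'v::euclidean_space"
  assumes "r > 0"
  obtains \<beta> :: "'v \<Rightarrow> real" where "smooth_on UNIV \<beta>" "\<And>x. x \<in> ball x0 r \<Longrightarrow> 0 < \<beta> x"
    "\<And>x. x \<notin> ball x0 r \<Longrightarrow> \<beta> x = 0"
proof -
  let ?d = "\<lambda>x. r\<^sup>2 + - (\<Sum>b\<in>Basis. ((x - x0) \<bullet> b) * ((x - x0) \<bullet> b))"
  define \<beta> where "\<beta> = (\<lambda>x. flat_exp 1 (?d x))"
  have lin: "smooth_on UNIV (\<lambda>x. (x - x0) \<bullet> b)" for b
    using smooth_on_add[OF open_UNIV smooth_on_linear[OF open_UNIV bounded_linear_inner_left] smooth_on_const,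
        of b "- (x0 \<bullet> b)"]
    by (simp add: inner_diff_left)
  have "smooth_on UNIV ?d"
    by (intro smooth_on_add smooth_on_const smooth_on_uminus smooth_on_sum smooth_on_mult lin open_UNIV)
  then have "smooth_on UNIV (\<lambda>x. flat_exp 1 (?d x))"
    by (rule smooth_on_compose[where f = "flat_exp 1", OF open_UNIV open_UNIV subset_UNIV _ smooth_on_flat_exp])
  then have "smooth_on UNIV \<beta>" by (simp only: \<beta>_def)
  moreover have d: "?d x = r\<^sup>2 - (dist x0 x)\<^sup>2" for x
    by (simp add: dist_norm norm_minus_commute[of x0] power2_norm_eq_inner euclidean_inner[of "x - x0" "x - x0"])
  moreover have "0 < \<beta> x" if "x \<in> ball x0 r" for x
    using that assms unfolding \<beta>_def d flat_exp_def by (simp add: power_strict_mono)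
  moreover have "\<beta> x = 0" if "x \<notin> ball x0 r" for x
    using that assms unfolding \<beta>_def d flat_exp_def by (simp add: power_mono not_less)
  ultimately show ?thesis using that by blast
qed

section \<open>Linear algebra\<close>

lemma vec_expansion: "(x :: real ^ 'm) = (\<Sum>i\<in>UNIV. (x $ i) *\<^sub>R axis i 1)"
  using basis_expansion[of x] by (simp add: scalar_mult_eq_scaleR)

lemma linear_expansion:
  fixes x :: "real ^ 'm"
  assumes "linear f"
  shows "f x = (\<Sum>i\<in>UNIV. (x $ i) *\<^sub>R f (axis i 1))"
  by (subst (1) vec_expansion[of x]) (simp add: linear_sum[OF assms] linear_scale[OF assms])

lemma bilinear_expansion:
  fixes a b :: "real ^ 'm" and q :: "real ^ 'm \<Rightarrow> real ^ 'm \<Rightarrow> real"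
  assumes "bilinear q"
  shows "q a b = (\<Sum>i\<in>UNIV. \<Sum>j\<in>UNIV. a $ i * b $ j * q (axis i 1) (axis j 1))"
proof -
  have "q a b = (\<Sum>i\<in>UNIV. (a $ i) *\<^sub>R q (axis i 1) b)"
    by (rule linear_expansion[of "\<lambda>a. q a b"]) (use assms in \<open>simp add: bilinear_def\<close>)
  also have "\<dots> = (\<Sum>i\<in>UNIV. (a $ i) *\<^sub>R (\<Sum>j\<in>UNIV. (b $ j) *\<^sub>R q (axis i 1) (axis j 1)))"
  proof (rule sum.cong[OF refl])
    fix i
    have "linear (q (axis i 1))" using assms by (simp add: bilinear_def)
    from linear_expansion[OF this, of b]
    show "(a $ i) *\<^sub>R q (axis i 1) b = (a $ i) *\<^sub>R (\<Sum>j\<in>UNIV. (b $ j) *\<^sub>R q (axis i 1) (axis j 1))"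
      by (simp only:)
  qed
  finally show ?thesis by (simp add: sum_distrib_left mult.assoc)
qed

lemma rows_independent:
  fixes r :: "'m::finite \<Rightarrow> real ^ 'm"
  assumes "det (\<chi> i. r i) \<noteq> 0" "(\<Sum>i\<in>UNIV. (c $ i) *\<^sub>R r i) = 0"
  shows "c = 0"
proof -
  have "transpose (\<chi> i. r i) *v c = 0"
    using assms(2) by (simp add: vec_eq_iff vector_matrix_mult_def mult.commute)
  moreover have "\<exists>B. B ** transpose (\<chi> i. r i) = mat 1"
    using assms(1) by (metis det_transpose invertible_def invertible_det_nz)
  ultimately show ?thesis using matrix_left_invertible_ker by blast
qed

lemma rows_span:
  fixes r :: "'m::finite \<Rightarrow> real ^ 'm"
  assumes "det (\<chi> i. r i) \<noteq> 0"
  obtains c where "y = (\<Sum>i\<in>UNIV. (c $ i) *\<^sub>R r i)"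
proof -
  obtain B where B: "transpose (\<chi> i. r i) ** B = mat 1"
    using assms by (metis det_transpose invertible_def invertible_det_nz)
  have "y = (transpose (\<chi> i. r i) ** B) *v y" by (simp add: B)
  also have "\<dots> = transpose (\<chi> i. r i) *v (B *v y)"
    by (simp only: matrix_vector_mul_assoc)
  also have "\<dots> = (\<Sum>i\<in>UNIV. ((B *v y) $ i) *\<^sub>R r i)"
    by (simp add: vec_eq_iff vector_matrix_mult_def mult.commute)
  finally show ?thesis by (rule that)
qed

lemma rows_dependent:
  fixes r :: "'m::finite \<Rightarrow> real ^ 'm"
  assumes "det (\<chi> i. r i) = 0"
  obtains c where "c \<noteq> 0" "(\<Sum>i\<in>UNIV. (c $ i) *\<^sub>R r i) = 0"
proof -
  have "\<not> (\<exists>B. B ** transpose (\<chi> i. r i) = mat 1)"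
    using assms by (metis det_transpose invertible_det_nz invertible_left_inverse)
  then obtain c where "transpose (\<chi> i. r i) *v c = 0" "c \<noteq> 0"
    unfolding matrix_left_invertible_ker by blast
  then show ?thesis
    using that[of c] by (simp add: vec_eq_iff vector_matrix_mult_def mult.commute)
qed

lemma det_rows_linear_image:
  fixes e :: "'m::finite \<Rightarrow> real ^ 'm" and f :: "real ^ 'm \<Rightarrow> real ^ 'm"
  assumes "linear f"
  shows "det (\<chi> i. f (e i)) = det (\<chi> i. e i) * det (\<chi> i. f (axis i 1))"
proof -
  have "(\<chi> i. f (e i)) = (\<chi> i. e i) ** (\<chi> i. f (axis i 1))"
  proof -
    have "f (e i) $ j = (\<Sum>k\<in>UNIV. e i $ k * f (axis k 1) $ j)" for i j
      by (subst linear_expansion[OF assms, of "e i"]) simp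
    then show ?thesis by (simp add: vec_eq_iff matrix_matrix_mult_def)
  qed
  then show ?thesis by (simp add: det_mul)
qed

lemma det_replace_row_axis:
  "det (\<chi> i. if i = k then h else axis i 1) = (h :: real ^ 'm::finite) $ k"
proof -
  have "det (\<chi> i. if i = k then \<Sum>j\<in>UNIV. h $ j *s row j (mat 1 :: real^'m^'m) else row i (mat 1)) = h $ k * det (mat 1 :: real^'m^'m)"
    by (rule cramer_lemma_transpose)
  moreover have "row i (mat 1 :: real^'m^'m) = axis i 1" for i
    by (simp add: vec_eq_iff row_def mat_def axis_def eq_commute)
  ultimately show ?thesis by (simp add: basis_expansion cong: if_cong)
qed

lemma tendsto_det:
  fixes f :: "'m::finite \<Rightarrow> 'b \<Rightarrow> real ^ 'm"
  assumes "\<And>i. (f i \<longlongrightarrow> l i) F"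
  shows "((\<lambda>x. det (\<chi> i. f i x)) \<longlongrightarrow> det (\<chi> i. l i)) F"
  unfolding det_def
  by (intro tendsto_sum tendsto_mult tendsto_const tendsto_prod)
    (simp add: tendsto_vec_nth assms)

lemma tendsto_bilinear:
  fixes q :: "'b \<Rightarrow> real ^ 'm \<Rightarrow> real ^ 'm \<Rightarrow> real"
  assumes "\<forall>\<^sub>F t in F. bilinear (q t)" "bilinear q0"
    and "\<And>v w. ((\<lambda>t. q t v w) \<longlongrightarrow> q0 v w) F"
    and "(a \<longlongrightarrow> a0) F" "(b \<longlongrightarrow> b0) F"
  shows "((\<lambda>t. q t (a t) (b t)) \<longlongrightarrow> q0 a0 b0) F"
proof (rule Lim_transform_eventually)
  show "((\<lambda>t. \<Sum>i\<in>UNIV. \<Sum>j\<in>UNIV. a t $ i * b t $ j * q t (axis i 1) (axis j 1)) \<longlongrightarrow> q0 a0 b0) F"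
    unfolding bilinear_expansion[OF assms(2), of a0 b0]
    by (intro tendsto_sum tendsto_mult tendsto_vec_nth assms)
  show "\<forall>\<^sub>F t in F. (\<Sum>i\<in>UNIV. \<Sum>j\<in>UNIV. a t $ i * b t $ j * q t (axis i 1) (axis j 1)) = q t (a t) (b t)"
    using assms(1) by eventually_elim (rule bilinear_expansion[symmetric])
qed

definition gram_det :: "('v \<Rightarrow> 'v \<Rightarrow> real) \<Rightarrow> 'v \<Rightarrow> 'v \<Rightarrow> real" where
  "gram_det q v w = q v v * q w w - (q v w)\<^sup>2"

text \<open>
  This makes the quotient of two such determinants, a sectional curvature, a function of the plane.
\<close>

lemma gram_det_change_basis:
  assumes "bilinear q" "\<And>x y. q x y = q y x"
  shows "gram_det q (a *\<^sub>R v + b *\<^sub>R w) (c *\<^sub>R v + d *\<^sub>R w) = (a * d - b * c)\<^sup>2 * gram_det q v w"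
  unfolding gram_det_def
  by (simp add: bilinear_ladd[OF assms(1)] bilinear_radd[OF assms(1)] bilinear_lmul[OF assms(1)]
      bilinear_rmul[OF assms(1)] assms(2)[of w v] power2_eq_square algebra_simps)

lemma gram_det_complete_square:
  assumes "bilinear q" "\<And>x y. q x y = q y x" "q v v \<noteq> 0"
  shows "gram_det q v w = q v v * q (w - (q v w / q v v) *\<^sub>R v) (w - (q v w / q v v) *\<^sub>R v)"
  unfolding gram_det_def
  using assms(3)
  by (simp add: bilinear_lsub[OF assms(1)] bilinear_rsub[OF assms(1)] bilinear_lmul[OF assms(1)]
      bilinear_rmul[OF assms(1)] assms(2)[of w v] power2_eq_square field_simps)

lemma lin_indep2_iff:
  "lin_indep2 X Y \<longleftrightarrow> (\<forall>a b. a *\<^sub>R X + b *\<^sub>R Y = 0 \<longrightarrow> a = 0 \<and> b = 0)"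
proof
  assume L: "lin_indep2 X Y"
  show "\<forall>a b. a *\<^sub>R X + b *\<^sub>R Y = 0 \<longrightarrow> a = 0 \<and> b = 0"
  proof (intro allI impI)
    fix a b assume ab: "a *\<^sub>R X + b *\<^sub>R Y = 0"
    let ?u = "\<lambda>x. if x = X then a else b"
    have "(\<Sum>x\<in>{X, Y}. ?u x *\<^sub>R x) = 0" using ab L by (auto simp: lin_indep2_def)
    then have "?u x = 0" if "x \<in> {X, Y}" for x
      using L independentD[of "{X, Y}" "{X, Y}" ?u x] that by (simp add: lin_indep2_def)
    from this[of X] this[of Y] show "a = 0 \<and> b = 0" using L by (auto simp: lin_indep2_def)
  qed
next
  assume R: "\<forall>a b. a *\<^sub>R X + b *\<^sub>R Y = 0 \<longrightarrow> a = 0 \<and> b = 0"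
  have "X \<noteq> Y" using R[rule_format, of 1 "-1"] by fastforce
  moreover have "independent {X, Y}"
  proof (rule independent_if_scalars_zero)
    fix f x assume s: "(\<Sum>x\<in>{X, Y}. f x *\<^sub>R x) = 0" and x: "x \<in> {X, Y}"
    then have "f X *\<^sub>R X + f Y *\<^sub>R Y = 0" using \<open>X \<noteq> Y\<close> by simp
    then show "f x = 0" using R x by blast
  qed simp
  ultimately show "lin_indep2 X Y" by (simp add: lin_indep2_def)
qed

lemma lin_indep2_iff_not_multiple:
  "Y \<noteq> 0 \<Longrightarrow> lin_indep2 X Y \<longleftrightarrow> (\<forall>c. X \<noteq> c *\<^sub>R Y)"
proof
  assume "Y \<noteq> 0" "lin_indep2 X Y"
  then show "\<forall>c. X \<noteq> c *\<^sub>R Y" unfolding lin_indep2_iff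
    by (metis add.right_inverse one_neq_zero scaleR_minus_left scaleR_one)
next
  assume Y: "Y \<noteq> 0" and R: "\<forall>c. X \<noteq> c *\<^sub>R Y"
  show "lin_indep2 X Y" unfolding lin_indep2_iff
  proof (intro allI impI)
    fix a b assume ab: "a *\<^sub>R X + b *\<^sub>R Y = 0"
    have "a = 0"
    proof (rule ccontr)
      assume "a \<noteq> 0"
      moreover have "a *\<^sub>R X = (- b) *\<^sub>R Y"
        using ab by (simp add: eq_neg_iff_add_eq_0)
      ultimately have "X = (- b / a) *\<^sub>R Y"
        by (metis (no_types) divide_inverse_commute scaleR_scaleR scaleR_one left_inverse)
      then show False using R by blast
    qed
    then show "a = 0 \<and> b = 0" using ab Y by simp
  qed
qed

lemma gram_det_inner_eq_0_iff:
  fixes X Y :: "'v::real_inner"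
  shows "gram_det inner X Y \<noteq> 0 \<longleftrightarrow> lin_indep2 X Y"
proof (cases "X = 0")
  case True
  then show ?thesis unfolding lin_indep2_iff gram_det_def
    by (auto intro: exI[of _ 1])
next
  case False
  have "gram_det inner X Y = 0 \<longleftrightarrow> (\<bar>X \<bullet> Y\<bar> = norm X * norm Y)"
  proof -
    have "gram_det inner X Y = (norm X * norm Y)\<^sup>2 - \<bar>X \<bullet> Y\<bar>\<^sup>2"
      by (simp add: gram_det_def power_mult_distrib power2_norm_eq_inner)
    then show ?thesis by (metis abs_ge_zero eq_iff_diff_eq_0 mult_nonneg_nonneg norm_ge_zero power2_eq_imp_eq)
  qed
  also have "\<dots> \<longleftrightarrow> \<not> lin_indep2 X Y"
  proof -
    have "lin_indep2 X Y \<longleftrightarrow> lin_indep2 Y X"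
      unfolding lin_indep2_iff by (metis add.commute)
    moreover have "lin_indep2 Y X \<Longrightarrow> Y \<noteq> 0"
      using lin_indep2_iff_not_multiple[OF False, of Y] by (metis scaleR_zero_left)
    ultimately show ?thesis
      unfolding norm_cauchy_schwarz_equal collinear_lemma
      using False lin_indep2_iff_not_multiple[OF False, of Y] by blast
  qed
  finally show ?thesis by blast
qed

lemma abs_bilinear_le:
  fixes q :: "real ^ 'm::finite \<Rightarrow> real ^ 'm \<Rightarrow> real"
  assumes "bilinear q"
  shows "\<bar>q v w\<bar> \<le> (\<Sum>i\<in>UNIV. \<Sum>j\<in>UNIV. \<bar>q (axis i 1) (axis j 1)\<bar>) * (norm v * norm w)"
proof -
  have "\<bar>q v w\<bar> \<le> (\<Sum>i\<in>UNIV. \<Sum>j\<in>UNIV. \<bar>v $ i * w $ j * q (axis i 1) (axis j 1)\<bar>)"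
    unfolding bilinear_expansion[OF assms, of v w] by (intro order_trans[OF sum_abs] sum_mono) simp
  also have "\<dots> \<le> (\<Sum>i\<in>UNIV. \<Sum>j\<in>UNIV. \<bar>q (axis i 1) (axis j 1)\<bar> * (norm v * norm w))"
  proof (intro sum_mono)
    fix i j
    have "\<bar>v $ i\<bar> * \<bar>w $ j\<bar> \<le> norm v * norm w"
      by (intro mult_mono component_le_norm_cart) auto
    from mult_left_mono[OF this, of "\<bar>q (axis i 1) (axis j 1)\<bar>"]
    show "\<bar>v $ i * w $ j * q (axis i 1) (axis j 1)\<bar> \<le> \<bar>q (axis i 1) (axis j 1)\<bar> * (norm v * norm w)"
      by (simp add: abs_mult mult_ac)
  qed
  finally show ?thesis by (simp add: sum_distrib_right)
qed

text \<open>
  A bound below on the unit sphere of \<open>W\<close> at \<open>x0\<close> comes from compactness; it persists nearby because the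
  forms converge uniformly on bounded sets, their coefficients being finitely many.
\<close>

lemma positive_definite_nearby:
  fixes q :: "'b::topological_space \<Rightarrow> real ^ 'm::finite \<Rightarrow> real ^ 'm \<Rightarrow> real"
  assumes bil: "\<forall>\<^sub>F x in nhds x0. bilinear (q x)"
    and cont: "\<And>v w. ((\<lambda>x. q x v w) \<longlongrightarrow> q x0 v w) (nhds x0)"
    and W: "subspace W" and pos: "\<And>v. v \<in> W \<Longrightarrow> v \<noteq> 0 \<Longrightarrow> 0 < q x0 v v"
  shows "\<exists>c>0. \<forall>\<^sub>F x in nhds x0. \<forall>v\<in>W. c * (norm v)\<^sup>2 \<le> q x v v"
proof -
  have b0: "bilinear (q x0)" using bil by (rule eventually_nhds_x_imp_x)
  have "\<exists>c>0. \<forall>v\<in>W \<inter> sphere 0 1. c \<le> q x0 v v"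
  proof (cases "W \<inter> sphere 0 1 = {}")
    case False
    have "compact (W \<inter> sphere 0 1)"
      using closed_subspace[OF W] by (metis compact_Int_closed compact_sphere inf_commute)
    moreover have "continuous_on (W \<inter> sphere 0 1) (\<lambda>v. q x0 v v)"
    proof -
      have "q x0 v v = (\<Sum>i\<in>UNIV. \<Sum>j\<in>UNIV. v $ i * v $ j * q x0 (axis i 1) (axis j 1))" for v
        by (rule bilinear_expansion[OF b0])
      then show ?thesis by (simp only:) (intro continuous_intros)
    qed
    ultimately obtain v0 where v0: "v0 \<in> W \<inter> sphere 0 1" "\<forall>v\<in>W \<inter> sphere 0 1. q x0 v0 v0 \<le> q x0 v v"
      using continuous_attains_inf[OF _ False] by blast
    moreover have "0 < q x0 v0 v0" using v0(1) by (intro pos) auto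
    ultimately show ?thesis by blast
  qed (auto intro: exI[of _ 1])
  then obtain c0 where c0: "c0 > 0" "\<And>v. v \<in> W \<Longrightarrow> norm v = 1 \<Longrightarrow> c0 \<le> q x0 v v" by auto
  have base: "c0 * (norm v)\<^sup>2 \<le> q x0 v v" if "v \<in> W" for v
  proof (cases "v = 0")
    case True then show ?thesis by (simp add: bilinear_lzero[OF b0])
  next
    case False
    have "c0 \<le> q x0 ((1 / norm v) *\<^sub>R v) ((1 / norm v) *\<^sub>R v)"
      using that False W by (intro c0(2)) (auto simp: subspace_scale)
    then show ?thesis using False
      by (simp add: bilinear_lmul[OF b0] bilinear_rmul[OF b0] field_simps power2_eq_square)
  qed
  let ?e = "\<lambda>x. \<Sum>i\<in>UNIV. \<Sum>j\<in>UNIV. \<bar>q x (axis i 1) (axis j 1) - q x0 (axis i 1) (axis j 1)\<bar>"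
  have "(?e \<longlongrightarrow> (\<Sum>i\<in>UNIV. \<Sum>j\<in>UNIV. \<bar>q x0 (axis i 1) (axis j 1) - q x0 (axis i 1) (axis j 1)\<bar>)) (nhds x0)"
    by (intro tendsto_intros cont)
  then have "\<forall>\<^sub>F x in nhds x0. ?e x < c0 / 2" using c0(1) by (intro order_tendstoD(2)[of _ 0]) auto
  with bil have "\<forall>\<^sub>F x in nhds x0. \<forall>v\<in>W. (c0 / 2) * (norm v)\<^sup>2 \<le> q x v v"
  proof eventually_elim
    fix x assume b: "bilinear (q x)" and e: "?e x < c0 / 2"
    have bd: "bilinear (\<lambda>v w. q x v w - q x0 v w)"
      using b b0 by (auto simp: bilinear_def intro: linear_compose_sub)
    show "\<forall>v\<in>W. (c0 / 2) * (norm v)\<^sup>2 \<le> q x v v"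
    proof
      fix v assume "v \<in> W"
      have "\<bar>q x v v - q x0 v v\<bar> \<le> ?e x * (norm v * norm v)" by (rule abs_bilinear_le[OF bd])
      also have "\<dots> \<le> (c0 / 2) * (norm v * norm v)" using e by (intro mult_right_mono) auto
      finally show "(c0 / 2) * (norm v)\<^sup>2 \<le> q x v v"
        using base[OF \<open>v \<in> W\<close>] unfolding power2_eq_square by linarith
    qed
  qed
  then show ?thesis using c0(1) by (intro exI[of _ "c0 / 2"]) auto
qed

section \<open>Zero sets of functions with nonvanishing derivative\<close>

lemma line_derivative:
  fixes f :: "'v::real_normed_vector \<Rightarrow> 'w::real_normed_vector"
  assumes "(f has_derivative f') (at x)"
  shows "((\<lambda>t. (f (x + t *\<^sub>R h) - f x) /\<^sub>R t) \<longlongrightarrow> f' h) (at 0)"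
proof -
  have "((\<lambda>t. f (x + t *\<^sub>R h)) has_derivative (\<lambda>t. f' (t *\<^sub>R h))) (at 0)"
    by (rule has_derivative_compose[where g = f, of "\<lambda>t. x + t *\<^sub>R h"])
      (auto intro!: derivative_eq_intros simp: assms)
  then have lim: "((\<lambda>t. norm ((f (x + t *\<^sub>R h) - f x) - f' (t *\<^sub>R h)) / norm t) \<longlongrightarrow> 0) (at 0)"
    by (simp add: has_derivative_at)
  have eq: "norm ((f (x + t *\<^sub>R h) - f x) - f' (t *\<^sub>R h)) / norm t
      = norm ((f (x + t *\<^sub>R h) - f x) /\<^sub>R t - f' h)" if "t \<noteq> 0" for t
  proof -
    have "(f (x + t *\<^sub>R h) - f x) /\<^sub>R t - f' h = ((f (x + t *\<^sub>R h) - f x) - f' (t *\<^sub>R h)) /\<^sub>R t"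
      using that by (simp add: scaleR_diff_right linear_scale[OF has_derivative_linear[OF assms]])
    then show ?thesis by (simp add: divide_inverse mult.commute)
  qed
  have "((\<lambda>t. norm ((f (x + t *\<^sub>R h) - f x) /\<^sub>R t - f' h)) \<longlongrightarrow> 0) (at 0)"
    by (rule Lim_transform_eventually[OF lim], unfold eventually_at_filter, rule always_eventually)
      (use eq in blast)
  then show ?thesis using LIM_zero_iff tendsto_norm_zero_iff by blast
qed

lemma DERIV_along_line:
  fixes f :: "'v::real_normed_vector \<Rightarrow> real"
  assumes "(f has_derivative f') (at (x + s *\<^sub>R k))"
  shows "((\<lambda>s. f (x + s *\<^sub>R k)) has_real_derivative f' k) (at s)"
proof -
  have "((\<lambda>s. f (x + s *\<^sub>R k)) has_derivative (\<lambda>t. f' (t *\<^sub>R k))) (at s)"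
    by (rule has_derivative_compose[where g = f, of "\<lambda>s. x + s *\<^sub>R k"])
      (auto intro!: derivative_eq_intros simp: assms)
  then show ?thesis
    by (simp add: has_field_derivative_def linear_scale[OF has_derivative_linear[OF assms]] mult_commute_abs)
qed

text \<open>
  Near \<open>x0\<close> the derivative of \<open>L\<close> in a fixed direction is bounded away from zero.  Walking from \<open>x\<close> in
  that direction, one meets the zero set of \<open>L\<close> after a distance of at most a multiple of \<open>|L x|\<close>, and
  on this way \<open>f\<close>, which vanishes at the end, changes by a multiple of the distance at most.
\<close>

lemma transversal_zero_set_bound:
  fixes L f :: "real ^ 'm::finite \<Rightarrow> real"
  assumes "smooth_on \<Omega> L" "smooth_on \<Omega> f"
    and x0: "x0 \<in> V" "L x0 = 0" and der: "frechet_derivative L (at x0) h \<noteq> 0"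
    and V: "open V" "V \<subseteq> \<Omega>" and f0: "\<And>x. x \<in> V \<Longrightarrow> L x = 0 \<Longrightarrow> f x = 0"
  shows "\<exists>C. \<forall>\<^sub>F x in nhds x0. \<bar>f x\<bar> \<le> C * \<bar>L x\<bar>"
proof -
  define k where "k = sgn (frechet_derivative L (at x0) h) *\<^sub>R h"
  define c where "c = frechet_derivative L (at x0) k / 2"
  have "linear (frechet_derivative L (at x0))"
    using smooth_on_has_derivative[OF assms(1)] x0 V has_derivative_linear by blast
  then have "c > 0" using der by (simp add: c_def k_def linear_scale sgn_mult_self_eq sgn_real_def)
  have DL: "smooth_on \<Omega> (\<lambda>x. frechet_derivative L (at x) k)" and Df: "smooth_on \<Omega> (\<lambda>x. frechet_derivative f (at x) k)"
    using assms(1,2) by (auto intro: smooth_on_frechet_derivative)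
  have "\<forall>\<^sub>F x in nhds x0. c < frechet_derivative L (at x) k"
  proof -
    have "((\<lambda>x. frechet_derivative L (at x) k) \<longlongrightarrow> frechet_derivative L (at x0) k) (nhds x0)"
      using smooth_on_imp_isCont[OF DL] x0 V by (meson in_mono isCont_def tendsto_at_iff_tendsto_nhds)
    then show ?thesis using \<open>c > 0\<close> by (intro order_tendstoD(1)) (auto simp: c_def)
  qed
  moreover have "\<forall>\<^sub>F x in nhds x0. x \<in> V" using V(1) x0(1) by (rule eventually_nhds_in_open)
  ultimately have "\<forall>\<^sub>F x in nhds x0. c < frechet_derivative L (at x) k \<and> x \<in> V" by (rule eventually_conj)
  then obtain \<epsilon> where \<epsilon>: "\<epsilon> > 0" "\<And>x. dist x x0 < \<epsilon> \<Longrightarrow> c < frechet_derivative L (at x) k \<and> x \<in> V"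
    unfolding eventually_nhds_metric by blast
  define \<rho>0 where "\<rho>0 = \<epsilon> / 2"
  have \<rho>0: "\<rho>0 > 0" "\<And>x. x \<in> cball x0 \<rho>0 \<Longrightarrow> c < frechet_derivative L (at x) k"
    "cball x0 \<rho>0 \<subseteq> V" using \<epsilon> by (auto simp: \<rho>0_def dist_commute)
  have "compact ((\<lambda>x. frechet_derivative f (at x) k) ` cball x0 \<rho>0)"
    using \<rho>0(3) V(2) by (intro compact_continuous_image compact_cball
        continuous_on_subset[OF smooth_on_imp_continuous_on[OF Df]]) auto
  from compact_imp_bounded[OF this] obtain B where
    "\<forall>y\<in>(\<lambda>x. frechet_derivative f (at x) k) ` cball x0 \<rho>0. norm y \<le> B"
    unfolding bounded_iff by blast
  then have B: "\<bar>frechet_derivative f (at x) k\<bar> \<le> B" if "x \<in> cball x0 \<rho>0" for x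
    using that by simp
  \<comment> \<open>Starting in the ball of half the radius, a walk of parameter length \<open>\<rho>\<close> stays in the ball.  The summand
    \<open>1\<close> spares the case distinction on \<open>k\<close>.\<close>
  define \<rho> where "\<rho> = \<rho>0 / (2 * (norm k + 1))"
  have \<rho>: "\<rho> > 0" unfolding \<rho>_def using \<rho>0(1)
    by (intro divide_pos_pos) (auto simp: add_nonneg_pos)
  have near: "x + s *\<^sub>R k \<in> cball x0 \<rho>0" if "dist x x0 < \<rho>0 / 2" "\<bar>s\<bar> \<le> \<rho>" for x s
  proof -
    have "\<bar>s\<bar> * norm k \<le> \<rho> * (norm k + 1)" using that(2) by (intro mult_mono) auto
    also have "\<dots> = \<rho>0 / 2" unfolding \<rho>_def by (simp add: field_simps add_nonneg_eq_0_iff)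
    finally have "norm (s *\<^sub>R k) \<le> \<rho>0 / 2" by simp
    moreover have "dist x0 (x + s *\<^sub>R k) \<le> dist x0 x + norm (s *\<^sub>R k)"
      by (metis dist_add_cancel dist_norm dist_triangle norm_minus_commute add_diff_cancel_left')
    ultimately show ?thesis using that(1) by (simp add: dist_commute)
  qed
  have "(L \<longlongrightarrow> 0) (nhds x0)"
    using smooth_on_imp_isCont[OF assms(1)] x0 V by (metis in_mono isCont_def tendsto_at_iff_tendsto_nhds)
  then have "\<forall>\<^sub>F x in nhds x0. \<bar>L x\<bar> < c * \<rho>"
    using tendsto_rabs_zero \<open>c > 0\<close> \<rho> by (intro order_tendstoD(2)[of _ 0]) auto
  moreover have "\<forall>\<^sub>F x in nhds x0. dist x x0 < \<rho>0 / 2"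
    using \<rho>0(1) unfolding eventually_nhds_metric by (intro exI[of _ "\<rho>0 / 2"]) auto
  ultimately have "\<forall>\<^sub>F x in nhds x0. \<bar>f x\<bar> \<le> (B / c) * \<bar>L x\<bar>"
  proof eventually_elim
    fix x assume small: "\<bar>L x\<bar> < c * \<rho>" and x: "dist x x0 < \<rho>0 / 2"
    define s0 where "s0 = \<bar>L x\<bar> / c"
    have s0: "0 \<le> s0" "s0 \<le> \<rho>" "\<bar>L x\<bar> = c * s0" using small \<open>c > 0\<close> by (auto simp: s0_def field_simps)
    let ?\<phi> = "\<lambda>s. L (x + s *\<^sub>R k)"
    have in\<Omega>: "x + s *\<^sub>R k \<in> \<Omega>" if "\<bar>s\<bar> \<le> \<rho>" for s using near[OF x that] \<rho>0(3) V(2) by blast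
    have d\<phi>: "(?\<phi> has_real_derivative frechet_derivative L (at (x + s *\<^sub>R k)) k) (at s)" if "\<bar>s\<bar> \<le> \<rho>" for s
      by (rule DERIV_along_line[OF smooth_on_has_derivative[OF assms(1) in\<Omega>[OF that]]])
    have df: "((\<lambda>s. f (x + s *\<^sub>R k)) has_real_derivative frechet_derivative f (at (x + s *\<^sub>R k)) k) (at s)" if "\<bar>s\<bar> \<le> \<rho>" for s
      by (rule DERIV_along_line[OF smooth_on_has_derivative[OF assms(2) in\<Omega>[OF that]]])
    \<comment> \<open>Along the walk \<open>L\<close> increases at least at the rate \<open>c\<close>, so it passes through \<open>0\<close> at some \<open>|s| \<le> s0\<close>.\<close>
    have grow: "c * (b - a) \<le> ?\<phi> b - ?\<phi> a" if "a \<le> b" "- \<rho> \<le> a" "b \<le> \<rho>" for a b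
    proof (cases "a = b")
      case False
      have "\<exists>z. a < z \<and> z < b \<and> ?\<phi> b - ?\<phi> a = (b - a) * frechet_derivative L (at (x + z *\<^sub>R k)) k"
      proof (rule MVT2)
        show "(?\<phi> has_real_derivative frechet_derivative L (at (x + s *\<^sub>R k)) k) (at s)" if "a \<le> s" "s \<le> b" for s
          by (rule d\<phi>) (use that \<open>- \<rho> \<le> a\<close> \<open>b \<le> \<rho>\<close> in auto)
      qed (use False that in auto)
      then obtain z where z: "a < z" "z < b" "?\<phi> b - ?\<phi> a = (b - a) * frechet_derivative L (at (x + z *\<^sub>R k)) k"
        by blast
      have "c < frechet_derivative L (at (x + z *\<^sub>R k)) k"
        using near[OF x, of z] \<rho>0(2) z that by (auto simp: abs_le_iff)
      then show ?thesis using z that by (simp add: mult.commute mult_left_mono)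
    qed simp
    have "?\<phi> (- s0) \<le> 0" using grow[of "- s0" 0] s0 by simp
    moreover have "0 \<le> ?\<phi> s0" using grow[of 0 s0] s0 by simp
    moreover have "continuous_on {- s0..s0} ?\<phi>"
      by (rule DERIV_continuous_on, rule has_field_derivative_at_within, rule d\<phi>) (use s0 in auto)
    ultimately obtain s where s: "- s0 \<le> s" "s \<le> s0" "?\<phi> s = 0"
      using IVT'[of ?\<phi> "- s0" 0 s0] s0 by auto
    have "f (x + s *\<^sub>R k) = 0" using s s0 near[OF x, of s] \<rho>0(3) by (intro f0) (auto simp: abs_le_iff)
    moreover have "norm (f (x + s *\<^sub>R k) - f (x + 0 *\<^sub>R k)) \<le> B * norm (s - 0)"
    proof (rule field_differentiable_bound[where S = "{- \<rho>..\<rho>}" and f = "\<lambda>s. f (x + s *\<^sub>R k)"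
          and f' = "\<lambda>z. frechet_derivative f (at (x + z *\<^sub>R k)) k"])
      show "((\<lambda>s. f (x + s *\<^sub>R k)) has_field_derivative frechet_derivative f (at (x + z *\<^sub>R k)) k) (at z within {- \<rho>..\<rho>})"
        if "z \<in> {- \<rho>..\<rho>}" for z by (rule has_field_derivative_at_within, rule df) (use that in auto)
      show "norm (frechet_derivative f (at (x + z *\<^sub>R k)) k) \<le> B" if "z \<in> {- \<rho>..\<rho>}" for z
        using B near[OF x, of z] that by (auto simp: abs_le_iff)
    qed (use s s0 \<rho> in auto)
    ultimately have "\<bar>f x\<bar> \<le> B * \<bar>s\<bar>" by simp
    also have "\<dots> \<le> B * s0"
      using s B[of x0] \<rho>0(1) by (intro mult_left_mono) (auto simp: abs_le_iff intro: order_trans[OF abs_ge_zero])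
    finally show "\<bar>f x\<bar> \<le> (B / c) * \<bar>L x\<bar>" by (simp add: s0_def)
  qed
  then show ?thesis by blast
qed

lemma zero_between_opposite_signs:
  fixes f :: "real \<Rightarrow> real"
  assumes "continuous_on {a..b} f" "a \<le> b" "f a * f b < 0"
  obtains s where "a \<le> s" "s \<le> b" "f s = 0"
proof (cases "f a \<le> 0")
  case True
  then have "0 \<le> f b" using assms(3) by (auto simp: mult_less_0_iff)
  then show ?thesis using IVT'[of f a 0 b] assms True that by blast
next
  case False
  then have "f b \<le> 0" using assms(3) by (auto simp: mult_less_0_iff)
  then show ?thesis using IVT2'[of f b 0 a] assms False that by auto
qed

text \<open>
  The part of the implicit function theorem that concerns tangent vectors: each \<open>v\<close> in the kernel of the
  differential is the velocity of a curve in the zero set.  For every \<open>\<epsilon>\<close> and small \<open>t\<close>, the function takes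
  opposite signs at \<open>x0 + t (v + \<epsilon> k)\<close> and \<open>x0 + t (v - \<epsilon> k)\<close>, so it has a zero in between.  Choosing zeros
  close to the line makes the curve differentiable at \<open>t = 0\<close>.
\<close>

lemma zero_set_curve:
  fixes L :: "'v::euclidean_space \<Rightarrow> real"
  assumes "open \<Omega>" "x0 \<in> \<Omega>" and cont: "continuous_on \<Omega> L" and der: "(L has_derivative L') (at x0)"
    and "L x0 = 0" "L' k \<noteq> 0" "L' v = 0"
  obtains s where "s 0 = 0" "((\<lambda>t. s t / t) \<longlongrightarrow> 0) (at 0)"
    "\<forall>\<^sub>F t in nhds 0. L (x0 + t *\<^sub>R v + s t *\<^sub>R k) = 0"
proof -
  let ?Z = "\<lambda>t. {s. L (x0 + t *\<^sub>R v + s *\<^sub>R k) = 0}"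
  have lin: "linear L'" using der has_derivative_linear by blast
  obtain r where r: "r > 0" "ball x0 r \<subseteq> \<Omega>" using assms(1,2) open_contains_ball by blast
  have zero: "\<forall>\<^sub>F t in at 0. \<exists>s\<in>?Z t. \<bar>s\<bar> \<le> \<epsilon> * \<bar>t\<bar>" if "\<epsilon> > 0" for \<epsilon>
  proof -
    have lim: "((\<lambda>t. L (x0 + t *\<^sub>R (v + c *\<^sub>R k)) / t) \<longlongrightarrow> c * L' k) (at 0)" for c
      using line_derivative[OF der, of "v + c *\<^sub>R k"] assms
      by (simp add: linear_add[OF lin] linear_scale[OF lin] divide_inverse_commute)
    have "((\<lambda>t. (L (x0 + t *\<^sub>R (v + \<epsilon> *\<^sub>R k)) / t) * (L (x0 + t *\<^sub>R (v + (- \<epsilon>) *\<^sub>R k)) / t))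
        \<longlongrightarrow> (\<epsilon> * L' k) * (- \<epsilon> * L' k)) (at 0)"
      by (intro tendsto_mult lim)
    moreover have "(\<epsilon> * L' k) * (- \<epsilon> * L' k) < 0"
    proof -
      have "\<epsilon> * L' k \<noteq> 0" using that \<open>L' k \<noteq> 0\<close> by simp
      then have "0 < (\<epsilon> * L' k) * (\<epsilon> * L' k)" using not_real_square_gt_zero by blast
      then show ?thesis by simp
    qed
    ultimately have 1: "\<forall>\<^sub>F t in at 0. (L (x0 + t *\<^sub>R (v + \<epsilon> *\<^sub>R k)) / t) * (L (x0 + t *\<^sub>R (v + (- \<epsilon>) *\<^sub>R k)) / t) < 0"
      by (rule order_tendstoD(2))
    have "((\<lambda>t. \<bar>t\<bar> * norm v + \<epsilon> * \<bar>t\<bar> * norm k) \<longlongrightarrow> \<bar>0\<bar> * norm v + \<epsilon> * \<bar>0\<bar> * norm k) (at (0::real))"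
      by (intro tendsto_intros)
    then have 2: "\<forall>\<^sub>F t in at (0::real). \<bar>t\<bar> * norm v + \<epsilon> * \<bar>t\<bar> * norm k < r"
      using r(1) by (intro order_tendstoD(2)[of _ 0]) auto
    from 1 2 show ?thesis
    proof eventually_elim
      fix t assume sgn: "(L (x0 + t *\<^sub>R (v + \<epsilon> *\<^sub>R k)) / t) * (L (x0 + t *\<^sub>R (v + (- \<epsilon>) *\<^sub>R k)) / t) < 0"
        and small: "\<bar>t\<bar> * norm v + \<epsilon> * \<bar>t\<bar> * norm k < r"
      let ?f = "\<lambda>s. L (x0 + t *\<^sub>R v + s *\<^sub>R k)" and ?a = "\<epsilon> * \<bar>t\<bar>"
      have "?f (\<epsilon> * t) * ?f (- (\<epsilon> * t)) < 0"
      proof -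
        have "t \<noteq> 0" using sgn by auto
        then have "0 < t * t" using not_real_square_gt_zero by blast
        have "?f (\<epsilon> * t) * ?f (- (\<epsilon> * t)) / (t * t) < 0"
          using sgn by (simp add: algebra_simps)
        then show ?thesis using \<open>0 < t * t\<close> by (simp add: divide_less_0_iff)
      qed
      then have "?f (- ?a) * ?f ?a < 0" by (cases "t \<ge> 0") (auto simp: mult.commute)
      moreover have "continuous_on {- ?a..?a} ?f"
      proof (rule continuous_on_compose2[OF cont])
        show "(\<lambda>s. x0 + t *\<^sub>R v + s *\<^sub>R k) ` {- ?a..?a} \<subseteq> \<Omega>"
        proof clarify
          fix s assume "s \<in> {- ?a..?a}"
          then have "\<bar>s\<bar> \<le> ?a" by (auto simp: abs_le_iff)
          have "norm (t *\<^sub>R v + s *\<^sub>R k) \<le> \<bar>t\<bar> * norm v + \<bar>s\<bar> * norm k"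
            by (metis norm_scaleR norm_triangle_ineq)
          also have "\<dots> \<le> \<bar>t\<bar> * norm v + ?a * norm k" using \<open>\<bar>s\<bar> \<le> ?a\<close> by (intro add_left_mono mult_right_mono) auto
          also have "norm (t *\<^sub>R v + s *\<^sub>R k) = dist x0 (x0 + (t *\<^sub>R v + s *\<^sub>R k))" 
            by (metis add_diff_cancel_left' dist_commute dist_norm)
          finally have "dist x0 (x0 + (t *\<^sub>R v + s *\<^sub>R k)) < r" using small by linarith
          then show "x0 + t *\<^sub>R v + s *\<^sub>R k \<in> \<Omega>" using r(2) by (auto simp: add.assoc)
        qed
      qed (intro continuous_intros)
      ultimately obtain s where "- ?a \<le> s" "s \<le> ?a" "?f s = 0"
        using zero_between_opposite_signs[of "- ?a" ?a ?f] \<open>\<epsilon> > 0\<close> by auto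
      then show "\<exists>s\<in>?Z t. \<bar>s\<bar> \<le> \<epsilon> * \<bar>t\<bar>" by (intro bexI[of _ s]) (auto simp: abs_le_iff)
    qed
  qed
  \<comment> \<open>The zeros found above depend on \<open>\<epsilon>\<close>.  A zero of almost minimal modulus, with the error \<open>t\<^sup>2\<close>, obeys
    all these bounds at once.\<close>
  have "\<exists>s. s \<in> ?Z t \<and> (\<forall>s'\<in>?Z t. \<bar>s\<bar> \<le> \<bar>s'\<bar> + t\<^sup>2)" if "?Z t \<noteq> {}" "t \<noteq> 0" for t
  proof -
    have "Inf (abs ` ?Z t) < Inf (abs ` ?Z t) + t\<^sup>2" using that(2) by simp
    moreover have "abs ` ?Z t \<noteq> {}" using that(1) by blast
    ultimately have "\<exists>a\<in>abs ` ?Z t. a < Inf (abs ` ?Z t) + t\<^sup>2" by (intro cInf_lessD)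
    then obtain s where "s \<in> ?Z t" "\<bar>s\<bar> < Inf (abs ` ?Z t) + t\<^sup>2" by (elim bexE imageE) auto
    moreover have "Inf (abs ` ?Z t) \<le> \<bar>s'\<bar>" if "s' \<in> ?Z t" for s'
      using that by (intro cInf_lower bdd_belowI[of _ 0]) auto
    ultimately show ?thesis by (intro exI[of _ s]) fastforce
  qed
  then have "\<forall>t. \<exists>s. ?Z t \<noteq> {} \<longrightarrow> t \<noteq> 0 \<longrightarrow> s \<in> ?Z t \<and> (\<forall>s'\<in>?Z t. \<bar>s\<bar> \<le> \<bar>s'\<bar> + t\<^sup>2)" by blast
  from choice[OF this] obtain s1 where
    "\<forall>t. ?Z t \<noteq> {} \<longrightarrow> t \<noteq> 0 \<longrightarrow> s1 t \<in> ?Z t \<and> (\<forall>s'\<in>?Z t. \<bar>s1 t\<bar> \<le> \<bar>s'\<bar> + t\<^sup>2)"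
    by (elim exE)
  then have s1: "s1 t \<in> ?Z t \<and> (\<forall>s'\<in>?Z t. \<bar>s1 t\<bar> \<le> \<bar>s'\<bar> + t\<^sup>2)" if "?Z t \<noteq> {}" "t \<noteq> 0" for t
    using that by simp
  define s where "s t = (if t = 0 then 0 else s1 t)" for t
  have "s 0 = 0" by (simp add: s_def)
  moreover have "((\<lambda>t. s t / t) \<longlongrightarrow> 0) (at 0)"
  proof (rule tendstoI)
    fix e :: real assume "e > 0"
    then have "\<forall>\<^sub>F t in at 0. \<exists>s\<in>?Z t. \<bar>s\<bar> \<le> (e / 2) * \<bar>t\<bar>" by (intro zero) auto
    moreover have "\<forall>\<^sub>F t in at (0::real). \<bar>t\<bar> < e / 2"
      using \<open>e > 0\<close> by (intro order_tendstoD(2)[OF tendsto_rabs_zero[OF tendsto_ident_at]]) auto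
    moreover have "\<forall>\<^sub>F t in at (0::real). t \<noteq> 0" by (simp add: eventually_at_filter)
    ultimately show "\<forall>\<^sub>F t in at 0. dist (s t / t) 0 < e"
    proof eventually_elim
      fix t assume "\<exists>s\<in>?Z t. \<bar>s\<bar> \<le> (e / 2) * \<bar>t\<bar>" "\<bar>t\<bar> < e / 2" "t \<noteq> 0"
      then obtain s' where "s' \<in> ?Z t" "\<bar>s'\<bar> \<le> (e / 2) * \<bar>t\<bar>" by blast
      then have "\<bar>s t\<bar> \<le> (e / 2) * \<bar>t\<bar> + \<bar>t\<bar> * \<bar>t\<bar>"
        using s1[of t] \<open>t \<noteq> 0\<close> by (fastforce simp: s_def power2_eq_square abs_mult_self_eq)
      also have "\<dots> < e * \<bar>t\<bar>"
      proof -
        have "\<bar>t\<bar> * \<bar>t\<bar> < (e / 2) * \<bar>t\<bar>" using \<open>\<bar>t\<bar> < e / 2\<close> \<open>t \<noteq> 0\<close> by (intro mult_strict_right_mono) auto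
        then show ?thesis by (simp add: field_simps)
      qed
      finally show "dist (s t / t) 0 < e" using \<open>t \<noteq> 0\<close> by (simp add: divide_less_eq)
    qed
  qed
  moreover have "\<forall>\<^sub>F t in nhds 0. L (x0 + t *\<^sub>R v + s t *\<^sub>R k) = 0"
  proof -
    have "\<forall>\<^sub>F t in at 0. L (x0 + t *\<^sub>R v + s t *\<^sub>R k) = 0"
      using zero[OF zero_less_one] eventually_neq_at_within[of 0 0 UNIV]
    proof eventually_elim
      case (elim t)
      then show ?case using s1[of t] by (auto simp: s_def)
    qed
    then show ?thesis unfolding eventually_at_filter
    proof (rule eventually_mono)
      fix t assume "t \<noteq> 0 \<longrightarrow> t \<in> UNIV \<longrightarrow> L (x0 + t *\<^sub>R v + s t *\<^sub>R k) = 0"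
      then show "L (x0 + t *\<^sub>R v + s t *\<^sub>R k) = 0"
        using \<open>L x0 = 0\<close> \<open>s 0 = 0\<close> by (cases "t = 0") auto
    qed
  qed
  ultimately show ?thesis by (rule that)
qed

section \<open>Front bundles in coordinates\<close>

text \<open>
  A front bundle over a coordinate domain: \<open>P x v\<close> and \<open>Q x v\<close> are the components of \<open>\<phi>(v)\<close> and \<open>\<psi>(v)\<close> in
  a frame of the bundle, \<open>g x\<close> is the fibre metric in that frame, and \<open>H\<close> extends a null vector field.
\<close>

locale front_coords =
  fixes \<Omega> :: "(real ^ 'm::finite) set"
    and P Q :: "real ^ 'm \<Rightarrow> real ^ 'm \<Rightarrow> real ^ 'm"
    and g :: "real ^ 'm \<Rightarrow> real ^ 'm \<Rightarrow> real ^ 'm \<Rightarrow> real"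
    and H :: "real ^ 'm \<Rightarrow> real ^ 'm"
  assumes open_\<Omega>: "open \<Omega>"
    and linear_P: "x \<in> \<Omega> \<Longrightarrow> linear (P x)" and linear_Q: "x \<in> \<Omega> \<Longrightarrow> linear (Q x)"
    and smooth_P: "smooth_on \<Omega> (\<lambda>x. P x v)" and smooth_Q: "smooth_on \<Omega> (\<lambda>x. Q x v)"
    and bilinear_g: "x \<in> \<Omega> \<Longrightarrow> bilinear (g x)" and g_sym: "x \<in> \<Omega> \<Longrightarrow> g x a b = g x b a"
    and g_pos: "x \<in> \<Omega> \<Longrightarrow> a \<noteq> 0 \<Longrightarrow> 0 < g x a a"
    and smooth_g: "smooth_on \<Omega> (\<lambda>x. g x a b)"
    and compatible: "x \<in> \<Omega> \<Longrightarrow> g x (P x v) (Q x w) = g x (P x w) (Q x v)"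
    and front: "x \<in> \<Omega> \<Longrightarrow> P x v = 0 \<Longrightarrow> Q x v = 0 \<Longrightarrow> v = 0"
    and smooth_H: "smooth_on \<Omega> H"
    and null: "x \<in> \<Omega> \<Longrightarrow> det (\<chi> i. P x (axis i 1)) = 0 \<Longrightarrow> H x \<noteq> 0 \<and> P x (H x) = 0"
begin

text \<open>
  The signed area density \<open>\<lambda>\<close> is \<open>Lam\<close> times the square root of the Gram determinant of the frame.
\<close>

definition Lam :: "real ^ 'm \<Rightarrow> real" where
  "Lam x = det (\<chi> i. P x (axis i 1))"

definition I :: "real ^ 'm \<Rightarrow> real ^ 'm \<Rightarrow> real ^ 'm \<Rightarrow> real" where
  "I x v w = g x (P x v) (P x w)"

definition II :: "real ^ 'm \<Rightarrow> real ^ 'm \<Rightarrow> real ^ 'm \<Rightarrow> real" where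
  "II x v w = - g x (P x v) (Q x w)"

lemma bilinear_I: "x \<in> \<Omega> \<Longrightarrow> bilinear (I x)"
  using bilinear_g[of x] linear_P[of x] unfolding bilinear_def I_def
  by (auto intro: linear_compose[unfolded o_def])

lemma bilinear_II: "x \<in> \<Omega> \<Longrightarrow> bilinear (II x)"
  using bilinear_g[of x] linear_P[of x] linear_Q[of x] unfolding bilinear_def II_def
  by (auto intro!: linear_compose_neg intro: linear_compose[unfolded o_def])

lemma I_sym: "x \<in> \<Omega> \<Longrightarrow> I x v w = I x w v"
  unfolding I_def using g_sym by blast

lemma II_sym: "x \<in> \<Omega> \<Longrightarrow> II x v w = II x w v"
  unfolding II_def using compatible by simp

lemma smooth_linear_family:
  fixes R :: "real ^ 'm \<Rightarrow> real ^ 'm \<Rightarrow> real ^ 'm"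
  assumes "\<And>x. x \<in> \<Omega> \<Longrightarrow> linear (R x)" "\<And>v. smooth_on \<Omega> (\<lambda>x. R x v)" "smooth_on \<Omega> V"
  shows "smooth_on \<Omega> (\<lambda>x. R x (V x))"
proof (rule smooth_on_cong[OF open_\<Omega>])
  show "smooth_on \<Omega> (\<lambda>x. \<Sum>i\<in>UNIV. (V x $ i) *\<^sub>R R x (axis i 1))"
    by (intro smooth_on_sum smooth_on_scaleR smooth_on_vec_nth open_\<Omega> assms)
  show "(\<Sum>i\<in>UNIV. (V x $ i) *\<^sub>R R x (axis i 1)) = R x (V x)" if "x \<in> \<Omega>" for x
    using linear_expansion[OF assms(1)[OF that]] by metis
qed

lemma smooth_inner:
  assumes "smooth_on \<Omega> a" "smooth_on \<Omega> b"
  shows "smooth_on \<Omega> (\<lambda>x. g x (a x) (b x))"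
proof (rule smooth_on_cong[OF open_\<Omega>])
  show "smooth_on \<Omega> (\<lambda>x. \<Sum>i\<in>UNIV. \<Sum>j\<in>UNIV. a x $ i * b x $ j * g x (axis i 1) (axis j 1))"
    by (intro smooth_on_sum smooth_on_mult smooth_on_vec_nth open_\<Omega> assms smooth_g)
  show "(\<Sum>i\<in>UNIV. \<Sum>j\<in>UNIV. a x $ i * b x $ j * g x (axis i 1) (axis j 1)) = g x (a x) (b x)"
    if "x \<in> \<Omega>" for x
    using bilinear_expansion[OF bilinear_g[OF that]] by metis
qed

lemma smooth_I: "smooth_on \<Omega> (\<lambda>x. I x v w)"
  unfolding I_def by (intro smooth_inner smooth_P)

lemma smooth_II: "smooth_on \<Omega> (\<lambda>x. II x v w)"
  unfolding II_def by (intro smooth_on_uminus smooth_inner smooth_P smooth_Q open_\<Omega>)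

lemma smooth_PH: "smooth_on \<Omega> (\<lambda>x. P x (H x))"
  by (rule smooth_linear_family[OF linear_P smooth_P smooth_H])

lemma smooth_Lam: "smooth_on \<Omega> Lam"
  unfolding Lam_def[abs_def] by (intro smooth_on_det open_\<Omega> smooth_P)

lemma linear_dLam: "x \<in> \<Omega> \<Longrightarrow> linear (frechet_derivative Lam (at x))"
  using smooth_on_has_derivative[OF smooth_Lam] has_derivative_linear by blast

lemma P_inj_off_singular:
  assumes "x \<in> \<Omega>" "Lam x \<noteq> 0" "P x v = 0"
  shows "v = 0"
  using rows_independent[of "\<lambda>i. P x (axis i 1)" v] assms linear_expansion[OF linear_P[OF assms(1)], of v]
  by (simp add: Lam_def)

lemma gram_det_I_pos:
  assumes "x \<in> \<Omega>" "Lam x \<noteq> 0" "lin_indep2 v w"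
  shows "0 < gram_det (I x) v w"
proof -
  have pos: "0 < I x u u" if "u \<noteq> 0" for u
    unfolding I_def using g_pos P_inj_off_singular assms(1,2) that by blast
  have "v \<noteq> 0" using assms(3) unfolding lin_indep2_iff by (metis add.right_neutral one_neq_zero scaleR_zero_left scaleR_zero_right)
  moreover have "w - c *\<^sub>R v \<noteq> 0" for c
    using assms(3) unfolding lin_indep2_iff
    by (metis add.commute diff_conv_add_uminus one_neq_zero scaleR_minus_left scaleR_one)
  ultimately show ?thesis
    using gram_det_complete_square[OF bilinear_I[OF assms(1)], of v w] I_sym[OF assms(1)] pos
    by (metis less_numeral_extra(3) mult_pos_pos)
qed

end

text \<open>
  As the singular set is the zero set of \<open>Lam\<close>, the last assumption is the transversality of the null
  direction that defines \<open>A\<^sub>2\<close>-points.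
\<close>

locale A2_coords = front_coords \<Omega> P Q g H
  for \<Omega> :: "(real ^ 'm::finite) set" and P Q g H +
  fixes x0 :: "real ^ 'm"
  assumes x0: "x0 \<in> \<Omega>" and sing: "Lam x0 = 0"
    and trans: "frechet_derivative Lam (at x0) (H x0) \<noteq> 0"
begin

abbreviation h where "h \<equiv> H x0"

abbreviation line where "line t \<equiv> x0 + t *\<^sub>R h"

text \<open>
  Numerator and denominator of the curvature of the plane spanned by \<open>v\<close> and \<open>H\<close> at the point \<open>line t\<close>.
\<close>

abbreviation num where "num v t \<equiv> gram_det (II (line t)) v (H (line t))"

abbreviation den where "den v t \<equiv> gram_det (I (line t)) v (H (line t))"

definition \<alpha> where "\<alpha> = frechet_derivative (\<lambda>x. P x (H x)) (at x0) h"

lemma h_nz: "h \<noteq> 0" and P_h: "P x0 h = 0"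
  using null[OF x0] sing by (auto simp: Lam_def)

lemma line_tendsto: "(line \<longlongrightarrow> x0) (at 0)"
  by (auto intro!: tendsto_eq_intros)

lemma eventually_line: "\<forall>\<^sub>F t in at 0. line t \<in> \<Omega>"
  using topological_tendstoD[OF line_tendsto open_\<Omega> x0] .

lemma smooth_line_tendsto:
  "smooth_on \<Omega> f \<Longrightarrow> ((\<lambda>t. f (line t)) \<longlongrightarrow> f x0) (at 0)"
  using smooth_on_imp_isCont[of \<Omega> f x0] x0 line_tendsto by (auto intro: isCont_tendsto_compose)

lemma smooth_line_derivative:
  assumes "smooth_on \<Omega> f" "f x0 = 0"
  shows "((\<lambda>t. f (line t) /\<^sub>R t) \<longlongrightarrow> frechet_derivative f (at x0) h) (at 0)"
  using line_derivative[OF smooth_on_has_derivative[OF assms(1) x0], of h] assms(2) by simp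

lemma PH_line: "((\<lambda>t. P (line t) (H (line t)) /\<^sub>R t) \<longlongrightarrow> \<alpha>) (at 0)"
  unfolding \<alpha>_def by (rule smooth_line_derivative[OF smooth_PH P_h])

lemma Lam_line: "((\<lambda>t. Lam (line t) / t) \<longlongrightarrow> frechet_derivative Lam (at x0) h) (at 0)"
  using smooth_line_derivative[OF smooth_Lam sing] by (simp add: divide_inverse_commute)

lemma eventually_regular: "\<forall>\<^sub>F t in at 0. Lam (line t) \<noteq> 0"
  using tendsto_imp_eventually_ne[OF Lam_line trans] by eventually_elim auto

lemma inner_line:
  assumes "(a \<longlongrightarrow> a0) (at 0)" "(b \<longlongrightarrow> b0) (at 0)"
  shows "((\<lambda>t. g (line t) (a t) (b t)) \<longlongrightarrow> g x0 a0 b0) (at 0)"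
proof (rule tendsto_bilinear[OF _ bilinear_g[OF x0] _ assms])
  show "\<forall>\<^sub>F t in at 0. bilinear (g (line t))"
    using eventually_line by eventually_elim (rule bilinear_g)
  show "((\<lambda>t. g (line t) v w) \<longlongrightarrow> g x0 v w) (at 0)" for v w
    by (rule smooth_line_tendsto[OF smooth_g])
qed

text \<open>
  The determinant with rows \<open>P (e i)\<close> and \<open>P (H)\<close> vanishes at \<open>x0\<close> because the row \<open>P (H)\<close> does.  Along the
  line only the derivative of this row contributes, and this derivative is \<open>\<alpha>\<close>.
\<close>

lemma derivative_Lam_null:
  "frechet_derivative Lam (at x0) h * det (\<chi> i. if i = k then h else e i)
    = det (\<chi> i. if i = k then \<alpha> else P x0 (e i))"
proof (rule tendsto_unique[of "at 0 :: real filter"])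
  let ?E = "\<lambda>t. det (\<chi> i. if i = k then H (line t) else e i)"
  show "((\<lambda>t. Lam (line t) / t * ?E t) \<longlongrightarrow> frechet_derivative Lam (at x0) h * det (\<chi> i. if i = k then h else e i)) (at 0)"
    by (intro tendsto_mult Lam_line tendsto_det)
      (auto intro: smooth_line_tendsto[OF smooth_H])
  have lim: "((\<lambda>t. det (\<chi> i. if i = k then P (line t) (H (line t)) /\<^sub>R t else P (line t) (e i)))
      \<longlongrightarrow> det (\<chi> i. if i = k then \<alpha> else P x0 (e i))) (at 0)"
    by (rule tendsto_det) (auto intro: PH_line smooth_line_tendsto[OF smooth_P])
  have eq: "Lam x * det (\<chi> i. if i = k then H x else e i) / t = det (\<chi> i. if i = k then P x (H x) /\<^sub>R t else P x (e i))"
    if "x \<in> \<Omega>" for x t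
  proof -
    have "det (\<chi> i. if i = k then P x (H x) /\<^sub>R t else P x (e i))
        = inverse t * det (\<chi> i. if i = k then P x (H x) else P x (e i))"
      using det_row_mul[of k "inverse t" "\<lambda>i. P x (H x)" "\<lambda>i. P x (e i)"] by (simp add: scalar_mult_eq_scaleR cong: if_cong)
    also have "(\<chi> i. if i = k then P x (H x) else P x (e i)) = (\<chi> i. P x (if i = k then H x else e i))"
      by (simp add: if_distrib cong: if_cong)
    also have "det \<dots> = det (\<chi> i. if i = k then H x else e i) * Lam x"
      unfolding Lam_def by (rule det_rows_linear_image[OF linear_P[OF that]])
    finally show ?thesis by (simp add: field_simps)
  qed
  show "((\<lambda>t. Lam (line t) / t * ?E t) \<longlongrightarrow> det (\<chi> i. if i = k then \<alpha> else P x0 (e i))) (at 0)"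
    by (rule Lim_transform_eventually[OF lim])
      (use eventually_line in eventually_elim, simp add: eq[symmetric])
qed simp

lemma null_adapted_rows:
  obtains k where "h $ k \<noteq> 0" "det (\<chi> i. if i = k then \<alpha> else P x0 (axis i 1)) \<noteq> 0"
proof -
  obtain k where k: "h $ k \<noteq> 0" using h_nz by (auto simp: vec_eq_iff)
  have "det (\<chi> i. if i = k then \<alpha> else P x0 (axis i 1)) \<noteq> 0"
    using derivative_Lam_null[of k "\<lambda>i. axis i 1"] trans k by (metis det_replace_row_axis mult_eq_0_iff)
  with k show ?thesis by (rule that)
qed

text \<open>
  The rows \<open>P x0 (axis i 1)\<close> for \<open>i \<noteq> k\<close> are independent by \<open>null_adapted_rows\<close>, where \<open>k\<close> is an index with
  \<open>h $ k \<noteq> 0\<close>.  Subtracting a multiple of \<open>h\<close> from \<open>v\<close> removes the component with index \<open>k\<close>.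
\<close>

lemma kernel_null_line:
  assumes "P x0 v = 0"
  obtains c where "v = c *\<^sub>R h"
proof -
  obtain k where k: "h $ k \<noteq> 0" "det (\<chi> i. if i = k then \<alpha> else P x0 (axis i 1)) \<noteq> 0"
    by (rule null_adapted_rows)
  define c where "c = v $ k / h $ k"
  define w where "w = v - c *\<^sub>R h"
  have "w $ k = 0" using k by (simp add: w_def c_def)
  have "P x0 w = 0" unfolding w_def using assms P_h linear_P[OF x0] by (simp add: linear_diff linear_scale)
  have "(\<Sum>i\<in>UNIV. (w $ i) *\<^sub>R (if i = k then \<alpha> else P x0 (axis i 1))) = (\<Sum>i\<in>UNIV. (w $ i) *\<^sub>R P x0 (axis i 1))"
    using \<open>w $ k = 0\<close> by (intro sum.cong) auto
  also have "\<dots> = 0" using linear_expansion[OF linear_P[OF x0], of w] \<open>P x0 w = 0\<close> by simp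
  finally have "w = 0" by (rule rows_independent[OF k(2)])
  then show ?thesis using that[of c] by (simp add: w_def)
qed

lemma image_orthogonal: "g x0 (P x0 v) (Q x0 h) = 0"
  using compatible[OF x0, of v h] P_h bilinear_lzero[OF bilinear_g[OF x0]] by simp

text \<open>
  Together with \<open>\<alpha>\<close>, the image of \<open>P x0\<close> spans the whole space.  If \<open>\<alpha>\<close> were orthogonal to \<open>Q x0 h\<close>, then
  \<open>Q x0 h\<close> would be orthogonal to everything, contrary to the front condition.
\<close>

lemma alpha_transversal: "g x0 \<alpha> (Q x0 h) \<noteq> 0"
proof
  assume z: "g x0 \<alpha> (Q x0 h) = 0"
  obtain k where k: "h $ k \<noteq> 0" "det (\<chi> i. if i = k then \<alpha> else P x0 (axis i 1)) \<noteq> 0"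
    by (rule null_adapted_rows)
  obtain c where c: "Q x0 h = (\<Sum>i\<in>UNIV. (c $ i) *\<^sub>R (if i = k then \<alpha> else P x0 (axis i 1)))"
    by (rule rows_span[OF k(2)])
  have lin: "linear (\<lambda>a. g x0 a (Q x0 h))" using bilinear_g[OF x0] by (simp add: bilinear_def)
  have "g x0 (Q x0 h) (Q x0 h) = (\<Sum>i\<in>UNIV. c $ i * g x0 (if i = k then \<alpha> else P x0 (axis i 1)) (Q x0 h))"
    by (subst (1) c) (simp add: linear_sum[OF lin] linear_scale[OF lin])
  also have "\<dots> = 0" using z image_orthogonal by (intro sum.neutral) auto
  finally have "Q x0 h = 0" using g_pos[OF x0, of "Q x0 h"] by (cases "Q x0 h = 0") auto
  then show False using front[OF x0 P_h] h_nz by blast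
qed

text \<open>
  The limit of the denominator of the curvature of \<open>v \<and> H\<close> divided by \<open>t\<^sup>2\<close>, see \<open>den_line\<close>.
\<close>

definition D0 where "D0 v = gram_det (g x0) (P x0 v) \<alpha>"

lemma D0_pos:
  assumes "lin_indep2 v h"
  shows "0 < D0 v"
proof -
  have "P x0 v \<noteq> 0"
    using kernel_null_line[of v] assms lin_indep2_iff_not_multiple[OF h_nz] by metis
  then have pos: "0 < g x0 (P x0 v) (P x0 v)" using g_pos[OF x0] by blast
  have "\<alpha> - c *\<^sub>R P x0 v \<noteq> 0" for c
  proof
    assume "\<alpha> - c *\<^sub>R P x0 v = 0"
    then have "g x0 \<alpha> (Q x0 h) = g x0 (P x0 (c *\<^sub>R v)) (Q x0 h)"
      by (simp add: linear_scale[OF linear_P[OF x0]])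
    then show False using alpha_transversal image_orthogonal by simp
  qed
  then show ?thesis unfolding D0_def
    using gram_det_complete_square[OF bilinear_g[OF x0], of "P x0 v" \<alpha>] g_sym[OF x0] pos g_pos[OF x0]
    by (metis less_numeral_extra(3) mult_pos_pos)
qed

lemma II_HH_line:
  "((\<lambda>t. II (line t) (H (line t)) (H (line t)) / t) \<longlongrightarrow> - g x0 \<alpha> (Q x0 h)) (at 0)"
  and II_vH_line: "((\<lambda>t. II (line t) v (H (line t)) / t) \<longlongrightarrow> - g x0 \<alpha> (Q x0 v)) (at 0)"
  and I_HH_line: "((\<lambda>t. I (line t) (H (line t)) (H (line t)) / t\<^sup>2) \<longlongrightarrow> g x0 \<alpha> \<alpha>) (at 0)"
  and I_vH_line: "((\<lambda>t. I (line t) v (H (line t)) / t) \<longlongrightarrow> g x0 (P x0 v) \<alpha>) (at 0)"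
proof -
  have QH: "((\<lambda>t. Q (line t) (H (line t))) \<longlongrightarrow> Q x0 h) (at 0)"
    by (rule smooth_line_tendsto[OF smooth_linear_family[OF linear_Q smooth_Q smooth_H]])
  show "((\<lambda>t. II (line t) (H (line t)) (H (line t)) / t) \<longlongrightarrow> - g x0 \<alpha> (Q x0 h)) (at 0)"
    by (rule Lim_transform_eventually[OF tendsto_minus[OF inner_line[OF PH_line QH]]])
      (use eventually_line in eventually_elim, simp add: II_def bilinear_lmul[OF bilinear_g] divide_inverse_commute)
  show "((\<lambda>t. II (line t) v (H (line t)) / t) \<longlongrightarrow> - g x0 \<alpha> (Q x0 v)) (at 0)"
    by (rule Lim_transform_eventually[OF tendsto_minus[OF inner_line[OF PH_line smooth_line_tendsto[OF smooth_Q]]]])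
      (use eventually_line in eventually_elim, subst II_sym, assumption, simp add: II_def bilinear_lmul[OF bilinear_g] divide_inverse_commute)
  show "((\<lambda>t. I (line t) (H (line t)) (H (line t)) / t\<^sup>2) \<longlongrightarrow> g x0 \<alpha> \<alpha>) (at 0)"
    by (rule Lim_transform_eventually[OF inner_line[OF PH_line PH_line]])
      (use eventually_line in eventually_elim, simp add: I_def bilinear_lmul[OF bilinear_g]
        bilinear_rmul[OF bilinear_g] divide_inverse_commute power2_eq_square)
  show "((\<lambda>t. I (line t) v (H (line t)) / t) \<longlongrightarrow> g x0 (P x0 v) \<alpha>) (at 0)"
    by (rule Lim_transform_eventually[OF inner_line[OF smooth_line_tendsto[OF smooth_P] PH_line]])
      (use eventually_line in eventually_elim, simp add: I_def bilinear_rmul[OF bilinear_g] divide_inverse_commute)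
qed

lemma den_line:
  "((\<lambda>t. den v t / t\<^sup>2) \<longlongrightarrow> D0 v) (at 0)"
proof -
  have "((\<lambda>t. I (line t) v v * (I (line t) (H (line t)) (H (line t)) / t\<^sup>2) - (I (line t) v (H (line t)) / t)\<^sup>2)
      \<longlongrightarrow> D0 v) (at 0)"
    unfolding D0_def gram_det_def
    by (intro tendsto_diff tendsto_mult tendsto_power I_HH_line I_vH_line)
      (use smooth_line_tendsto[OF smooth_I[of v v]] in \<open>simp add: I_def\<close>)
  then show ?thesis by (simp add: gram_det_def power_divide diff_divide_distrib)
qed

text \<open>
  Divided by \<open>t\<close>, the numerator tends to \<open>II x0 v v\<close> times a nonzero number and the denominator to \<open>0\<close>.
  Since \<open>t\<close> takes both signs, the inequality bounds the limit from above and from below by \<open>0\<close>.  The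
  factor \<open>s\<close> serves to treat lower and upper bounds of the curvature alike.
\<close>

lemma II_vanishes_diagonal:
  assumes "s \<noteq> 0" and le: "\<forall>\<^sub>F t in at 0. M * den v t \<le> s * num v t"
  shows "II x0 v v = 0"
proof -
  let ?L = "II x0 v v * - g x0 \<alpha> (Q x0 h)"
  let ?N = "num v" and ?D = "den v"
  have t0: "((\<lambda>t. t :: real) \<longlongrightarrow> 0) (at 0)" by (rule tendsto_ident_at)
  have "((\<lambda>t. II (line t) v v * (II (line t) (H (line t)) (H (line t)) / t)
        - t * (II (line t) v (H (line t)) / t)\<^sup>2) \<longlongrightarrow> ?L - 0 * (- g x0 \<alpha> (Q x0 v))\<^sup>2) (at 0)"
    by (intro tendsto_diff tendsto_mult tendsto_power II_HH_line II_vH_line smooth_line_tendsto[OF smooth_II] t0)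
  from this[unfolded mult_zero_left diff_0_right] have "((\<lambda>t. ?N t / t) \<longlongrightarrow> ?L) (at 0)"
    by (rule Lim_transform_eventually)
      (simp_all add: eventually_at_filter gram_det_def power_divide diff_divide_distrib power2_eq_square)
  then have N: "((\<lambda>t. s * (?N t / t)) \<longlongrightarrow> s * ?L) (at 0)" by (intro tendsto_mult tendsto_const)
  have "((\<lambda>t. M * (t * (?D t / t\<^sup>2))) \<longlongrightarrow> M * (0 * D0 v)) (at 0)"
    by (intro tendsto_mult tendsto_const den_line t0)
  then have D: "((\<lambda>t. M * (t * (?D t / t\<^sup>2))) \<longlongrightarrow> 0) (at 0)" by simp
  have "0 \<le> s * ?L"
  proof (rule tendsto_le[OF _ tendsto_within_subset[OF N] tendsto_within_subset[OF D]])
    have "\<forall>\<^sub>F t in at_right 0. M * ?D t \<le> s * ?N t" using le by (simp add: eventually_at_split)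
    moreover have "\<forall>\<^sub>F t in at_right (0::real). 0 < t" by (simp add: eventually_at_right_less)
    ultimately show "\<forall>\<^sub>F t in at_right 0. M * (t * (?D t / t\<^sup>2)) \<le> s * (?N t / t)"
      by eventually_elim (simp add: field_simps power2_eq_square)
  qed simp_all
  moreover have "s * ?L \<le> 0"
  proof (rule tendsto_le[OF _ tendsto_within_subset[OF D] tendsto_within_subset[OF N]])
    have "\<forall>\<^sub>F t in at_left 0. M * ?D t \<le> s * ?N t" using le by (simp add: eventually_at_split)
    moreover have "\<forall>\<^sub>F t in at_left (0::real). t < 0" by (simp add: eventually_at_filter)
    ultimately show "\<forall>\<^sub>F t in at_left 0. s * (?N t / t) \<le> M * (t * (?D t / t\<^sup>2))"
      by eventually_elim (simp add: field_simps power2_eq_square)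
  qed simp_all
  ultimately show ?thesis using alpha_transversal assms(1) by auto
qed

lemma II_vanishes:
  assumes "s \<noteq> 0"
    and "\<And>v. lin_indep2 v h \<Longrightarrow>
      \<forall>\<^sub>F t in at 0. M * den v t \<le> s * num v t"
  shows "II x0 v w = 0"
proof -
  note b = bilinear_II[OF x0]
  have h0: "II x0 h u = 0" for u
    by (simp add: II_def P_h bilinear_lzero[OF bilinear_g[OF x0]])
  have diag: "II x0 u u = 0" for u
  proof (cases "lin_indep2 u h")
    case True
    then show ?thesis using II_vanishes_diagonal[OF assms(1) assms(2)] by blast
  next
    case False
    then obtain c where "u = c *\<^sub>R h" using lin_indep2_iff_not_multiple[OF h_nz] by blast
    then show ?thesis by (simp add: bilinear_lmul[OF b] bilinear_rmul[OF b] h0)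
  qed
  have "II x0 (v + w) (v + w) = II x0 v v + 2 * II x0 v w + II x0 w w"
    by (simp only: bilinear_ladd[OF b] bilinear_radd[OF b] II_sym[OF x0, of w v])
  then show ?thesis by (simp add: diag)
qed

text \<open>
  When \<open>II x0 v v\<close> vanishes, numerator and denominator are both of order \<open>t\<^sup>2\<close>, and the coefficients can be
  compared.
\<close>

lemma second_order_bound:
  assumes "II x0 v v = 0"
    and "\<forall>\<^sub>F t in at 0. \<delta> * den v t \<le> num v t"
  shows "\<delta> * D0 v + (g x0 \<alpha> (Q x0 v))\<^sup>2 \<le> - frechet_derivative (\<lambda>x. II x v v) (at x0) h * g x0 \<alpha> (Q x0 h)"
proof -
  let ?b = "frechet_derivative (\<lambda>x. II x v v) (at x0) h"
  have "((\<lambda>t. II (line t) v v / t) \<longlongrightarrow> ?b) (at 0)"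
    using smooth_line_derivative[OF smooth_II assms(1)] by (simp add: divide_inverse_commute)
  then have "((\<lambda>t. (II (line t) v v / t) * (II (line t) (H (line t)) (H (line t)) / t)
        - (II (line t) v (H (line t)) / t)\<^sup>2) \<longlongrightarrow> ?b * - g x0 \<alpha> (Q x0 h) - (- g x0 \<alpha> (Q x0 v))\<^sup>2) (at 0)"
    by (intro tendsto_diff tendsto_mult tendsto_power II_HH_line II_vH_line)
  then have N: "((\<lambda>t. num v t / t\<^sup>2) \<longlongrightarrow> ?b * - g x0 \<alpha> (Q x0 h) - (g x0 \<alpha> (Q x0 v))\<^sup>2) (at 0)"
    by (simp add: gram_det_def power_divide diff_divide_distrib power2_eq_square)
  have "\<delta> * D0 v \<le> ?b * - g x0 \<alpha> (Q x0 h) - (g x0 \<alpha> (Q x0 v))\<^sup>2"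
  proof (rule tendsto_le[OF _ N tendsto_mult[OF tendsto_const den_line]])
    have "\<forall>\<^sub>F t in at (0::real). t \<noteq> 0" by (simp add: eventually_at_filter)
    with assms(2) show "\<forall>\<^sub>F t in at 0. \<delta> * (den v t / t\<^sup>2)
        \<le> num v t / t\<^sup>2"
      by eventually_elim (simp add: divide_right_mono)
  qed simp
  then show ?thesis by simp
qed

lemma eventually_lin_indep:
  assumes "lin_indep2 v h"
  shows "\<forall>\<^sub>F t in at 0. lin_indep2 v (H (line t))"
proof -
  have "((\<lambda>t. gram_det inner v (H (line t))) \<longlongrightarrow> gram_det inner v h) (at 0)"
    unfolding gram_det_def by (intro tendsto_intros smooth_line_tendsto[OF smooth_H])
  then show ?thesis
    using tendsto_imp_eventually_ne assms unfolding gram_det_inner_eq_0_iff[symmetric] by blast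
qed

end

context A2_coords
begin

lemma smooth_nhds: "smooth_on \<Omega> f \<Longrightarrow> (f \<longlongrightarrow> f x0) (nhds x0)"
  using smooth_on_imp_isCont[of \<Omega> f x0] x0 by (simp add: isCont_def tendsto_at_iff_tendsto_nhds)

lemma eventually_\<Omega>: "\<forall>\<^sub>F x in nhds x0. x \<in> \<Omega>"
  using open_\<Omega> x0 by (rule eventually_nhds_in_open)

text \<open>
  By Cramer's rule, \<open>Lam x\<close> times a component of \<open>v\<close> is a determinant with \<open>P x v\<close> as one of its rows.  It is
  linear in this row, with coefficients (the cofactors) that remain bounded near \<open>x0\<close>.
\<close>

lemma norm_P_lower_bound: "\<exists>C>0. \<forall>\<^sub>F x in nhds x0. \<forall>v. \<bar>Lam x\<bar> * norm v \<le> C * norm (P x v)"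
proof -
  define cof where "cof x k j = det (\<chi> i. if i = k then axis j 1 else P x (axis i 1))" for x k j
  have ev: "\<forall>\<^sub>F x in nhds x0. \<forall>k j. \<bar>cof x k j\<bar> < \<bar>cof x0 k j\<bar> + 1"
  proof (intro eventually_all_finite)
    fix k j
    have "((\<lambda>x. cof x k j) \<longlongrightarrow> cof x0 k j) (nhds x0)"
      unfolding cof_def by (rule tendsto_det) (auto intro: smooth_nhds[OF smooth_P])
    then show "\<forall>\<^sub>F x in nhds x0. \<bar>cof x k j\<bar> < \<bar>cof x0 k j\<bar> + 1"
      by (intro order_tendstoD(2)[OF tendsto_rabs]) auto
  qed
  define C where "C = (\<Sum>k\<in>UNIV. \<Sum>j\<in>UNIV. \<bar>cof x0 k j\<bar> + 1)"
  have "\<forall>\<^sub>F x in nhds x0. \<forall>v. \<bar>Lam x\<bar> * norm v \<le> C * norm (P x v)"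
    using ev eventually_\<Omega>
  proof eventually_elim
    fix x assume cof: "\<forall>k j. \<bar>cof x k j\<bar> < \<bar>cof x0 k j\<bar> + 1" and x: "x \<in> \<Omega>"
    show "\<forall>v. \<bar>Lam x\<bar> * norm v \<le> C * norm (P x v)"
    proof
      fix v :: "real ^ 'm"
      have "\<bar>Lam x\<bar> * norm v \<le> (\<Sum>k\<in>UNIV. \<bar>Lam x\<bar> * \<bar>v $ k\<bar>)"
        unfolding sum_distrib_left[symmetric] by (intro mult_left_mono norm_le_l1_cart) auto
      also have "\<dots> \<le> (\<Sum>k\<in>UNIV. \<Sum>j\<in>UNIV. (\<bar>cof x0 k j\<bar> + 1) * norm (P x v))"
      proof (intro sum_mono)
        fix k
        have "v $ k * Lam x = det (\<chi> i. P x (if i = k then v else axis i 1))"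
          unfolding Lam_def det_rows_linear_image[OF linear_P[OF x], of "\<lambda>i. if i = k then v else axis i 1"]
          by (simp add: det_replace_row_axis)
        also have "\<dots> = det (\<chi> i. if i = k then (\<Sum>j\<in>UNIV. (P x v $ j) *s axis j 1) else P x (axis i 1))"
          by (simp add: basis_expansion if_distrib cong: if_cong)
        also have "\<dots> = (\<Sum>j\<in>UNIV. P x v $ j * cof x k j)"
          unfolding cof_def by (subst det_linear_row_sum) (simp_all add: det_row_mul)
        finally have "\<bar>Lam x\<bar> * \<bar>v $ k\<bar> \<le> (\<Sum>j\<in>UNIV. \<bar>P x v $ j\<bar> * \<bar>cof x k j\<bar>)"
          by (metis (no_types, lifting) abs_mult mult.commute sum_abs sum.cong)
        also have "\<dots> \<le> (\<Sum>j\<in>UNIV. (\<bar>cof x0 k j\<bar> + 1) * norm (P x v))"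
          using cof by (intro sum_mono, subst mult.commute, intro mult_mono component_le_norm_cart)
            (auto simp: less_imp_le add_nonneg_nonneg)
        finally show "\<bar>Lam x\<bar> * \<bar>v $ k\<bar> \<le> \<dots>" .
      qed
      finally show "\<bar>Lam x\<bar> * norm v \<le> C * norm (P x v)" by (simp add: C_def sum_distrib_right)
    qed
  qed
  moreover have "C > 0" unfolding C_def by (intro sum_pos) (auto simp: add_nonneg_pos)
  ultimately show ?thesis by blast
qed

text \<open>
  Every plane contains a nonzero vector \<open>u\<close> orthogonal to \<open>h\<close> in the coordinates, and on such vectors \<open>I\<close> is
  uniformly positive definite because \<open>h\<close> spans the kernel of \<open>P x0\<close>.  On a vector complementary to \<open>u\<close> in
  the plane, \<open>I\<close> is still at least a multiple of \<open>Lam\<^sup>2\<close>.  So the denominator is at least a multiple of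
  \<open>Lam\<^sup>2\<close>, while the numerator is quadratic in the coefficients of \<open>II\<close>, which are \<open>O(Lam)\<close>.
\<close>

lemma curvature_bounded:
  assumes V: "open V" "x0 \<in> V" "V \<subseteq> \<Omega>"
    and II0: "\<And>x v w. x \<in> V \<Longrightarrow> Lam x = 0 \<Longrightarrow> II x v w = 0"
  shows "\<exists>M. \<forall>\<^sub>F x in nhds x0. Lam x \<noteq> 0 \<longrightarrow>
    (\<forall>v w. lin_indep2 v w \<longrightarrow> \<bar>gram_det (II x) v w\<bar> \<le> M * gram_det (I x) v w)"
proof -
  have "\<exists>C. \<forall>\<^sub>F x in nhds x0. \<bar>II x (axis i 1) (axis j 1)\<bar> \<le> C * \<bar>Lam x\<bar>" for i j
    by (rule transversal_zero_set_bound[OF smooth_Lam smooth_II V(2) sing trans V(1,3)]) (use II0 in auto)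
  then obtain C where "\<And>i j. \<forall>\<^sub>F x in nhds x0. \<bar>II x (axis i 1) (axis j 1)\<bar> \<le> C i j * \<bar>Lam x\<bar>"
    by metis
  then have C: "\<forall>\<^sub>F x in nhds x0. \<forall>i j. \<bar>II x (axis i 1) (axis j 1)\<bar> \<le> C i j * \<bar>Lam x\<bar>"
    by (intro eventually_all_finite) auto
  define C1 where "C1 = (\<Sum>i\<in>UNIV. \<Sum>j\<in>UNIV. C i j)"
  have "\<exists>c>0. \<forall>\<^sub>F x in nhds x0. \<forall>v\<in>UNIV. c * (norm v)\<^sup>2 \<le> g x v v"
  proof (rule positive_definite_nearby[where q = g])
    show "\<forall>\<^sub>F x in nhds x0. bilinear (g x)"
      using bilinear_g by (auto intro: eventually_mono[OF eventually_\<Omega>])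
  qed (use g_pos[OF x0] smooth_nhds[OF smooth_g] in auto)
  then obtain c1 where c1: "c1 > 0" "\<forall>\<^sub>F x in nhds x0. \<forall>v. c1 * (norm v)\<^sup>2 \<le> g x v v" by auto
  have "\<exists>c>0. \<forall>\<^sub>F x in nhds x0. \<forall>v\<in>{v. v \<bullet> h = 0}. c * (norm v)\<^sup>2 \<le> I x v v"
  proof (rule positive_definite_nearby[where q = I])
    show "\<forall>\<^sub>F x in nhds x0. bilinear (I x)" using bilinear_I by (auto intro: eventually_mono[OF eventually_\<Omega>])
    show "((\<lambda>x. I x v w) \<longlongrightarrow> I x0 v w) (nhds x0)" for v w by (rule smooth_nhds[OF smooth_I])
    show "subspace {v. v \<bullet> h = 0}" by (auto simp: subspace_def inner_add_left)
    show "0 < I x0 v v" if v: "v \<in> {v. v \<bullet> h = 0}" "v \<noteq> 0" for v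
    proof -
      have "P x0 v \<noteq> 0"
      proof
        assume "P x0 v = 0"
        then obtain c where "v = c *\<^sub>R h" by (rule kernel_null_line)
        then show False using v by auto
      qed
      then show ?thesis unfolding I_def by (rule g_pos[OF x0])
    qed
  qed
  then obtain c2 where c2: "c2 > 0" "\<forall>\<^sub>F x in nhds x0. \<forall>v. v \<bullet> h = 0 \<longrightarrow> c2 * (norm v)\<^sup>2 \<le> I x v v" by auto
  obtain C3 where C3: "C3 > 0" "\<forall>\<^sub>F x in nhds x0. \<forall>v. \<bar>Lam x\<bar> * norm v \<le> C3 * norm (P x v)"
    using norm_P_lower_bound by blast
  define c3 where "c3 = c1 / C3\<^sup>2"
  have "c3 > 0" using c1 C3 by (simp add: c3_def)
  define M where "M = 2 * C1\<^sup>2 / (c2 * c3)"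
  have "\<forall>\<^sub>F x in nhds x0. Lam x \<noteq> 0 \<longrightarrow>
    (\<forall>v w. lin_indep2 v w \<longrightarrow> \<bar>gram_det (II x) v w\<bar> \<le> M * gram_det (I x) v w)"
    using C c1(2) c2(2) C3(2) eventually_\<Omega>
  proof eventually_elim
    fix x assume C: "\<forall>i j. \<bar>II x (axis i 1) (axis j 1)\<bar> \<le> C i j * \<bar>Lam x\<bar>"
      and g1: "\<forall>v. c1 * (norm v)\<^sup>2 \<le> g x v v"
      and I2: "\<forall>v. v \<bullet> h = 0 \<longrightarrow> c2 * (norm v)\<^sup>2 \<le> I x v v"
      and P3: "\<forall>v. \<bar>Lam x\<bar> * norm v \<le> C3 * norm (P x v)" and x: "x \<in> \<Omega>"
    note bI = bilinear_I[OF x] and bII = bilinear_II[OF x]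
    have IIb: "\<bar>II x v w\<bar> \<le> C1 * \<bar>Lam x\<bar> * (norm v * norm w)" for v w
    proof -
      have "(\<Sum>i\<in>UNIV. \<Sum>j\<in>UNIV. \<bar>II x (axis i 1) (axis j 1)\<bar>) \<le> C1 * \<bar>Lam x\<bar>"
        unfolding C1_def sum_distrib_right using C by (intro sum_mono) auto
      then show ?thesis
        by (intro order_trans[OF abs_bilinear_le[OF bII]] mult_right_mono) auto
    qed
    have Ib: "c3 * (Lam x)\<^sup>2 * (norm v)\<^sup>2 \<le> I x v v" for v
    proof -
      have "(\<bar>Lam x\<bar> * norm v)\<^sup>2 \<le> (C3 * norm (P x v))\<^sup>2" using P3 by (intro power_mono) auto
      then have "c3 * (Lam x)\<^sup>2 * (norm v)\<^sup>2 \<le> c1 * (norm (P x v))\<^sup>2"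
        using c1(1) C3(1) by (simp add: c3_def power_mult_distrib field_simps)
      also have "\<dots> \<le> I x v v" using g1 by (simp add: I_def)
      finally show ?thesis .
    qed
    have adapted: "\<bar>gram_det (II x) u w\<bar> \<le> M * gram_det (I x) u w"
      if u: "u \<bullet> h = 0" "u \<noteq> 0" for u w
    proof -
      \<comment> \<open>The projection of \<open>w\<close> orthogonal to \<open>u\<close> changes neither determinant.\<close>
      define o' where "o' = w - ((w \<bullet> u) / (u \<bullet> u)) *\<^sub>R u"
      have perp: "o' \<bullet> u = 0" using u by (simp add: o'_def inner_diff_left)
      have tr: "gram_det q u w = gram_det q u o'" if "bilinear q" "\<And>x y. q x y = q y x" for q
        using gram_det_change_basis[OF that, of 1 u 0 w "- ((w \<bullet> u) / (u \<bullet> u))" 1] by (simp add: o'_def)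
      let ?N = "(Lam x)\<^sup>2 * ((norm u)\<^sup>2 * (norm o')\<^sup>2)"
      have "\<bar>gram_det (II x) u o'\<bar> \<le> \<bar>II x u u\<bar> * \<bar>II x o' o'\<bar> + \<bar>II x u o'\<bar>\<^sup>2"
        unfolding gram_det_def by (metis abs_mult abs_triangle_ineq4 power2_abs abs_power2)
      also have "\<dots> \<le> (C1 * \<bar>Lam x\<bar> * (norm u * norm u)) * (C1 * \<bar>Lam x\<bar> * (norm o' * norm o'))
          + (C1 * \<bar>Lam x\<bar> * (norm u * norm o'))\<^sup>2"
        by (intro add_mono mult_mono power_mono IIb) (auto intro: order_trans[OF abs_ge_zero IIb])
      also have "\<dots> = 2 * C1\<^sup>2 * ?N" by (simp add: power2_eq_square algebra_simps abs_mult_self)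
      finally have up: "\<bar>gram_det (II x) u o'\<bar> \<le> 2 * C1\<^sup>2 * ?N" .
      have Iu: "c2 * (norm u)\<^sup>2 \<le> I x u u" using I2 u by blast
      moreover have "0 < c2 * (norm u)\<^sup>2" using c2(1) u by simp
      ultimately have Iu_pos: "0 < I x u u" by simp
      define r where "r = I x u o' / I x u u"
      have "(norm (o' - r *\<^sub>R u))\<^sup>2 = (norm o')\<^sup>2 + (norm (r *\<^sub>R u))\<^sup>2"
        unfolding power2_norm_eq_inner using perp
        by (simp add: inner_diff_left inner_diff_right inner_commute[of u o'])
      then have "(norm o')\<^sup>2 \<le> (norm (o' - r *\<^sub>R u))\<^sup>2" by simp
      then have "c3 * (Lam x)\<^sup>2 * (norm o')\<^sup>2 \<le> c3 * (Lam x)\<^sup>2 * (norm (o' - r *\<^sub>R u))\<^sup>2"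
        using \<open>c3 > 0\<close> by (intro mult_left_mono) auto
      also have "\<dots> \<le> I x (o' - r *\<^sub>R u) (o' - r *\<^sub>R u)" by (rule Ib)
      finally have "(c2 * (norm u)\<^sup>2) * (c3 * (Lam x)\<^sup>2 * (norm o')\<^sup>2) \<le> I x u u * I x (o' - r *\<^sub>R u) (o' - r *\<^sub>R u)"
        using Iu Iu_pos \<open>c3 > 0\<close> by (intro mult_mono) auto
      also have "\<dots> = gram_det (I x) u o'"
        using gram_det_complete_square[OF bI I_sym[OF x], of u o'] Iu_pos by (simp add: r_def)
      finally have "c2 * c3 * ?N \<le> gram_det (I x) u o'" by (simp add: algebra_simps)
      then have "M * (c2 * c3 * ?N) \<le> M * gram_det (I x) u o'"
        using c2(1) \<open>c3 > 0\<close> by (intro mult_left_mono) (auto simp: M_def)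
      moreover have "M * (c2 * c3 * ?N) = 2 * C1\<^sup>2 * ?N" using c2(1) \<open>c3 > 0\<close> by (simp add: M_def)
      ultimately show ?thesis using up tr[OF bI I_sym[OF x]] tr[OF bII II_sym[OF x]] by simp
    qed
    show "Lam x \<noteq> 0 \<longrightarrow> (\<forall>v w. lin_indep2 v w \<longrightarrow> \<bar>gram_det (II x) v w\<bar> \<le> M * gram_det (I x) v w)"
    proof (intro impI allI)
      fix v w :: "real ^ 'm" assume ind: "lin_indep2 v w"
      show "\<bar>gram_det (II x) v w\<bar> \<le> M * gram_det (I x) v w"
      proof (cases "v \<bullet> h = 0")
        case True
        moreover have "v \<noteq> 0" using ind unfolding lin_indep2_iff
          by (metis add.right_neutral one_neq_zero scaleR_zero_left scaleR_zero_right)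
        ultimately show ?thesis by (rule adapted)
      next
        case False
        \<comment> \<open>The vector of the plane orthogonal to \<open>h\<close>; with \<open>v\<close> it still spans the plane as \<open>v \<bullet> h \<noteq> 0\<close>.\<close>
        define u where "u = (w \<bullet> h) *\<^sub>R v + (- (v \<bullet> h)) *\<^sub>R w"
        have "u \<bullet> h = 0" by (simp add: u_def inner_add_left inner_diff_left)
        moreover have "u \<noteq> 0" using ind False unfolding lin_indep2_iff u_def by (metis neg_equal_0_iff_equal)
        ultimately have "\<bar>gram_det (II x) u v\<bar> \<le> M * gram_det (I x) u v" by (rule adapted)
        moreover have "gram_det q u v = (v \<bullet> h)\<^sup>2 * gram_det q v w" if "bilinear q" "\<And>x y. q x y = q y x" for q
          using gram_det_change_basis[OF that, of "w \<bullet> h" v "- (v \<bullet> h)" w 1 0] by (simp add: u_def)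
        ultimately have "(v \<bullet> h)\<^sup>2 * \<bar>gram_det (II x) v w\<bar> \<le> (v \<bullet> h)\<^sup>2 * (M * gram_det (I x) v w)"
          using bI I_sym[OF x] bII II_sym[OF x] by (simp add: abs_mult algebra_simps)
        then show ?thesis using False by (simp add: mult_le_cancel_left_pos)
      qed
    qed
  qed
  then show ?thesis by blast
qed

end

context front_coords
begin

lemma II_vanishes_at:
  assumes V: "open V" "V \<subseteq> \<Omega>" and s: "s \<noteq> 0"
    and le: "\<And>x v w. x \<in> V \<Longrightarrow> Lam x \<noteq> 0 \<Longrightarrow> lin_indep2 v w \<Longrightarrow>
      M * gram_det (I x) v w \<le> s * gram_det (II x) v w"
    and x: "x \<in> V" "Lam x = 0" "frechet_derivative Lam (at x) (H x) \<noteq> 0"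
  shows "II x v w = 0"
proof -
  interpret A2_coords \<Omega> P Q g H x
    using x V by unfold_locales auto
  show ?thesis
  proof (rule II_vanishes[OF s])
    fix u assume "lin_indep2 u (H x)"
    from eventually_lin_indep[OF this] eventually_regular topological_tendstoD[OF line_tendsto V(1) x(1)]
    show "\<forall>\<^sub>F t in at 0. M * den u t \<le> s * num u t"
      by eventually_elim (rule le)
  qed
qed

lemma open_transversal: "open {x \<in> \<Omega>. frechet_derivative Lam (at x) (H x) \<noteq> 0}"
proof -
  have "smooth_on \<Omega> (\<lambda>x. \<Sum>i\<in>UNIV. H x $ i * frechet_derivative Lam (at x) (axis i 1))"
    by (intro smooth_on_sum smooth_on_mult smooth_on_vec_nth smooth_H smooth_on_frechet_derivative smooth_Lam open_\<Omega>)
  moreover have "(\<Sum>i\<in>UNIV. H x $ i * frechet_derivative Lam (at x) (axis i 1)) = frechet_derivative Lam (at x) (H x)"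
    if "x \<in> \<Omega>" for x
    using linear_expansion[OF linear_dLam[OF that], of "H x"] by simp
  ultimately have "smooth_on \<Omega> (\<lambda>x. frechet_derivative Lam (at x) (H x))"
    by (rule smooth_on_cong[OF open_\<Omega>, rotated])
  then have "open (\<Omega> \<inter> (\<lambda>x. frechet_derivative Lam (at x) (H x)) -` (- {0}))"
    by (intro continuous_open_preimage smooth_on_imp_continuous_on open_\<Omega>) auto
  moreover have "\<Omega> \<inter> (\<lambda>x. frechet_derivative Lam (at x) (H x)) -` (- {0}) = {x \<in> \<Omega>. frechet_derivative Lam (at x) (H x) \<noteq> 0}"
    by auto
  ultimately show ?thesis by simp
qed

end

section \<open>Charts and tangent vectors\<close>

text \<open>
  The differential at \<open>q\<close> of the change from the coordinates \<open>c\<close> to the coordinates \<open>d\<close>.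
\<close>

definition dtrans :: "('a, 'm::finite) chart \<Rightarrow> ('a, 'm) chart \<Rightarrow> 'a \<Rightarrow> real ^ 'm \<Rightarrow> real ^ 'm" where
  "dtrans c d q = frechet_derivative (snd d \<circ> chart_inv c) (at (snd c q))"

text \<open>
  The tangent vector at \<open>q\<close> whose components in the chart \<open>c\<close> are given; the inverse of \<open>tangent_comp\<close>.
\<close>

definition tvec :: "('a, 'm::finite) chart set \<Rightarrow> ('a, 'm) chart \<Rightarrow> 'a \<Rightarrow> real ^ 'm \<Rightarrow> real ^ 'm" where
  "tvec A c q = dtrans c (chart_at A q) q"

lemma tangent_comp_dtrans: "tangent_comp A c q = dtrans (chart_at A q) c q"
  by (auto simp: tangent_comp_def dtrans_def)

lemma coord_vec_tvec: "coord_vec A c i q = tvec A c q (axis i 1)"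
  by (simp add: coord_vec_def tvec_def dtrans_def)

locale oriented_manifold =
  fixes A :: "('a::{t2_space,second_countable_topology}, 'm::finite) chart set"
  assumes atlas: "oriented_atlas A"
begin

lemma chart_facts:
  assumes "c \<in> A"
  shows open_chart: "open (fst c)"
    and chart_inv_left [simp]: "q \<in> fst c \<Longrightarrow> chart_inv c (snd c q) = q"
    and chart_cont: "continuous_on (fst c) (snd c)"
    and chart_inv_cont: "continuous_on (snd c ` fst c) (chart_inv c)"
proof -
  have h: "open (fst c)" "homeomorphism (fst c) (snd c ` fst c) (snd c) (chart_inv c)"
    using atlas assms by (auto simp: oriented_atlas_def)
  then show "open (fst c)" "q \<in> fst c \<Longrightarrow> chart_inv c (snd c q) = q"
    "continuous_on (fst c) (snd c)" "continuous_on (snd c ` fst c) (chart_inv c)"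
    unfolding homeomorphism_def by blast+
qed

lemma open_chart_image:
  assumes "c \<in> A" "open W" "W \<subseteq> fst c"
  shows "open (snd c ` W)"
proof -
  have h: "open (snd c ` fst c)" "homeomorphism (fst c) (snd c ` fst c) (snd c) (chart_inv c)"
    using atlas assms by (auto simp: oriented_atlas_def)
  show ?thesis
    using homeomorphism_imp_open_map[OF h(2), of W] assms h(1)
    by (metis inf.absorb2 open_openin_trans openin_open_Int openin_open_trans)
qed

lemma chart_at: "chart_at A q \<in> A" "q \<in> fst (chart_at A q)"
proof -
  have "\<exists>c. c \<in> A \<and> q \<in> fst c" using atlas unfolding oriented_atlas_def by blast
  from someI_ex[OF this] show "chart_at A q \<in> A" "q \<in> fst (chart_at A q)"
    by (auto simp: chart_at_def)
qed

lemma smooth_transition: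
  "c \<in> A \<Longrightarrow> d \<in> A \<Longrightarrow> smooth_on (snd c ` (fst c \<inter> fst d)) (snd d \<circ> chart_inv c)"
  using atlas by (auto simp: oriented_atlas_def)

lemma dtrans_derivative:
  assumes "c \<in> A" "d \<in> A" "q \<in> fst c" "q \<in> fst d"
  shows "((snd d \<circ> chart_inv c) has_derivative dtrans c d q) (at (snd c q))"
  unfolding dtrans_def
  by (rule smooth_on_has_derivative[OF smooth_transition]) (use assms in auto)

lemma linear_dtrans:
  assumes "c \<in> A" "d \<in> A" "q \<in> fst c" "q \<in> fst d"
  shows "linear (dtrans c d q)"
  using dtrans_derivative[OF assms] has_derivative_linear by blast

lemma dtrans_compose:
  assumes "c \<in> A" "d \<in> A" "e \<in> A" "q \<in> fst c" "q \<in> fst d" "q \<in> fst e"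
  shows "dtrans d e q (dtrans c d q v) = dtrans c e q v"
proof -
  let ?W = "fst c \<inter> fst d \<inter> fst e"
  have "(snd e \<circ> chart_inv d has_derivative dtrans d e q) (at ((snd d \<circ> chart_inv c) (snd c q)))"
    using dtrans_derivative[OF assms(2,3,5,6)] assms by simp
  then have "(snd e \<circ> chart_inv d \<circ> (snd d \<circ> chart_inv c) has_derivative dtrans d e q \<circ> dtrans c d q) (at (snd c q))"
    by (rule diff_chain_at[OF dtrans_derivative[OF assms(1,2,4,5)]])
  then have "(snd e \<circ> chart_inv c has_derivative dtrans d e q \<circ> dtrans c d q) (at (snd c q))"
  proof (rule has_derivative_transform_within_open[where s = "snd c ` ?W"])
    show "open (snd c ` ?W)"
      by (rule open_chart_image[OF assms(1)])
        (use open_chart[OF assms(1)] open_chart[OF assms(2)] open_chart[OF assms(3)] in auto)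
  qed (use assms in auto)
  then have "dtrans c e q = dtrans d e q \<circ> dtrans c d q"
    using frechet_derivative_at dtrans_def by metis
  then show ?thesis by simp
qed

lemma dtrans_self:
  assumes "c \<in> A" "q \<in> fst c"
  shows "dtrans c c q v = v"
proof -
  have "((\<lambda>x. x) has_derivative (\<lambda>x. x)) (at (snd c q))" by (rule has_derivative_ident)
  then have "(snd c \<circ> chart_inv c has_derivative (\<lambda>x. x)) (at (snd c q))"
    by (rule has_derivative_transform_within_open[where s = "snd c ` fst c"])
      (use assms open_chart_image[OF assms(1) open_chart[OF assms(1)]] in auto)
  then show ?thesis using frechet_derivative_at dtrans_def by metis
qed

lemma tangent_comp_tvec:
  "c \<in> A \<Longrightarrow> d \<in> A \<Longrightarrow> q \<in> fst c \<Longrightarrow> q \<in> fst d \<Longrightarrow> tangent_comp A d q (tvec A c q v) = dtrans c d q v"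
  unfolding tangent_comp_dtrans tvec_def by (rule dtrans_compose) (auto simp: chart_at)

lemma tvec_tangent_comp:
  assumes "c \<in> A" "q \<in> fst c"
  shows "tvec A c q (tangent_comp A c q v) = v"
  unfolding tangent_comp_dtrans tvec_def
  using dtrans_compose[of "chart_at A q" c "chart_at A q" q] dtrans_self[of "chart_at A q" q] assms chart_at
  by auto

lemma linear_tvec: "c \<in> A \<Longrightarrow> q \<in> fst c \<Longrightarrow> linear (tvec A c q)"
  unfolding tvec_def by (rule linear_dtrans) (auto simp: chart_at)

lemma tvec_inj:
  assumes "c \<in> A" "q \<in> fst c" "tvec A c q v = 0"
  shows "v = 0"
proof -
  have "v = tangent_comp A c q (tvec A c q v)" using assms(1,2) by (simp add: tangent_comp_tvec dtrans_self)
  also have "\<dots> = 0" unfolding assms(3) tangent_comp_dtrans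
    by (rule linear_0[OF linear_dtrans]) (use assms chart_at in auto)
  finally show ?thesis .
qed

lemma tvec_chart_at: "tvec A (chart_at A q) q v = v"
  unfolding tvec_def by (rule dtrans_self[OF chart_at])

lemma lin_indep2_tvec:
  assumes "c \<in> A" "q \<in> fst c"
  shows "lin_indep2 (tvec A c q v) (tvec A c q w) \<longleftrightarrow> lin_indep2 v w"
proof -
  have "a *\<^sub>R tvec A c q v + b *\<^sub>R tvec A c q w = tvec A c q (a *\<^sub>R v + b *\<^sub>R w)" for a b
    using linear_tvec[OF assms] by (simp add: linear_add linear_scale)
  moreover have "tvec A c q 0 = 0" using linear_tvec[OF assms] linear_0 by blast
  ultimately show ?thesis unfolding lin_indep2_iff using tvec_inj[OF assms] by metis
qed

lemma smooth_dtrans: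
  assumes "c \<in> A" "d \<in> A"
  shows "smooth_on (snd d ` (fst c \<inter> fst d)) (\<lambda>x. dtrans c d (chart_inv d x) v)"
proof -
  let ?S = "snd d ` (fst c \<inter> fst d)" and ?T = "snd c ` (fst c \<inter> fst d)"
  have o: "open ?S" "open ?T" using open_chart[OF assms(1)] open_chart[OF assms(2)]
    by (auto intro!: open_chart_image[OF assms(1)] open_chart_image[OF assms(2)])
  have "smooth_on ?S (\<lambda>x. (\<lambda>y. frechet_derivative (snd d \<circ> chart_inv c) (at y) v) ((snd c \<circ> chart_inv d) x))"
  proof (rule smooth_on_compose[where g = "snd c \<circ> chart_inv d", OF o])
    show "smooth_on ?S (snd c \<circ> chart_inv d)"
      using smooth_transition[OF assms(2,1)] by (simp add: Int_commute)
    show "smooth_on ?T (\<lambda>y. frechet_derivative (snd d \<circ> chart_inv c) (at y) v)"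
      by (rule smooth_on_frechet_derivative[OF smooth_transition[OF assms]])
  qed (use assms in auto)
  then show ?thesis by (simp add: dtrans_def)
qed

lemma smooth_vf_tvec:
  assumes "c \<in> A" "open U" "U \<subseteq> fst c"
  shows "smooth_vf A U (\<lambda>q. tvec A c q v)"
  unfolding smooth_vf_def
proof
  fix d assume d: "d \<in> A"
  show "smooth_on (snd d ` (U \<inter> fst d)) (\<lambda>x. tangent_comp A d (chart_inv d x) (tvec A c (chart_inv d x) v))"
  proof (rule smooth_on_cong)
    show "open (snd d ` (U \<inter> fst d))" by (rule open_chart_image[OF d]) (use assms open_chart[OF d] in auto)
    show "smooth_on (snd d ` (U \<inter> fst d)) (\<lambda>x. dtrans c d (chart_inv d x) v)"
      by (rule smooth_on_subset[OF smooth_dtrans[OF assms(1) d]]) (use assms(3) in auto)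
    show "dtrans c d (chart_inv d x) v = tangent_comp A d (chart_inv d x) (tvec A c (chart_inv d x) v)"
      if "x \<in> snd d ` (U \<inter> fst d)" for x
      using that assms d by (auto simp: tangent_comp_tvec subset_iff)
  qed
qed

text \<open>
  Near a point of the chart domain the field is a product of smooth maps.  Any other point has a
  neighbourhood on which the field is zero, as the image of the closed ball in the manifold is compact
  and hence closed.
\<close>

lemma smooth_vf_bump:
  assumes c: "c \<in> A" and \<beta>: "smooth_on UNIV \<beta>" "\<And>x. x \<notin> ball x0 r \<Longrightarrow> \<beta> x = 0"
    and r: "cball x0 r \<subseteq> snd c ` fst c" and U: "open U"
  shows "smooth_vf A U (\<lambda>q. if q \<in> fst c then \<beta> (snd c q) *\<^sub>R tvec A c q v else 0)"
  unfolding smooth_vf_def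
proof
  fix d assume d: "d \<in> A"
  let ?X = "\<lambda>q. if q \<in> fst c then \<beta> (snd c q) *\<^sub>R tvec A c q v else 0"
  let ?f = "\<lambda>x. tangent_comp A d (chart_inv d x) (?X (chart_inv d x))"
  let ?K = "chart_inv c ` cball x0 r"
  have "compact ?K"
    by (rule compact_continuous_image[OF continuous_on_subset[OF chart_inv_cont[OF c] r] compact_cball])
  then have "closed ?K" by (rule compact_imp_closed)
  have zero: "tangent_comp A d q 0 = 0" if "q \<in> fst d" for q
    unfolding tangent_comp_dtrans by (rule linear_0[OF linear_dtrans]) (use that chart_at d in auto)
  show "smooth_on (snd d ` (U \<inter> fst d)) ?f"
  proof (rule smooth_on_local)
    fix x assume "x \<in> snd d ` (U \<inter> fst d)"
    then obtain q where q: "q \<in> U" "q \<in> fst d" "x = snd d q" by blast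
    show "\<exists>N. open N \<and> x \<in> N \<and> smooth_on N ?f"
    proof (cases "q \<in> fst c")
      case True
      let ?N = "snd d ` (fst c \<inter> fst d)"
      have N: "open ?N" by (rule open_chart_image[OF d]) (use open_chart[OF c] open_chart[OF d] in auto)
      have "smooth_on ?N (\<lambda>x. \<beta> ((snd c \<circ> chart_inv d) x) *\<^sub>R dtrans c d (chart_inv d x) v)"
      proof (rule smooth_on_scaleR[OF N _ smooth_dtrans[OF c d]])
        show "smooth_on ?N (\<lambda>x. \<beta> ((snd c \<circ> chart_inv d) x))"
          by (rule smooth_on_compose[where g = "snd c \<circ> chart_inv d", OF N open_UNIV subset_UNIV _ \<beta>(1)])
            (use smooth_transition[OF d c] in \<open>simp add: Int_commute\<close>)
      qed
      then have "smooth_on ?N ?f"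
      proof (rule smooth_on_cong[OF N, rotated])
        fix y assume "y \<in> ?N"
        then obtain r where r: "r \<in> fst c" "r \<in> fst d" "y = snd d r" by blast
        have "linear (tangent_comp A d r)"
          unfolding tangent_comp_dtrans by (rule linear_dtrans) (use r chart_at d in auto)
        then show "\<beta> ((snd c \<circ> chart_inv d) y) *\<^sub>R dtrans c d (chart_inv d y) v = ?f y"
          using r c d by (simp add: linear_scale tangent_comp_tvec)
      qed
      then show ?thesis using N True q by blast
    next
      case False
      let ?N = "snd d ` (fst d - ?K)"
      have N: "open ?N"
        by (rule open_chart_image[OF d]) (use open_chart[OF d] \<open>closed ?K\<close> in auto)
      have "smooth_on ?N ?f"
      proof (rule smooth_on_cong[OF N _ smooth_on_const[of _ 0]])
        fix y assume "y \<in> ?N"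
        then obtain r' where r': "r' \<notin> ?K" "r' \<in> fst d" "y = snd d r'" by blast
        have "?X r' = 0"
        proof (cases "r' \<in> fst c")
          case True
          then have "snd c r' \<notin> cball x0 r" using r'(1) c by (metis chart_inv_left image_eqI)
          then show ?thesis using \<beta>(2)[of "snd c r'"] ball_subset_cball by auto
        qed simp
        moreover have "chart_inv d y = r'" using r' d by simp
        ultimately show "0 = ?f y" by (simp only: zero[OF r'(2)])
      qed
      moreover have "q \<notin> ?K"
      proof
        assume "q \<in> ?K"
        then obtain y where "y \<in> cball x0 r" "q = chart_inv c y" by blast
        then show False using False r inv_into_into[of y "snd c" "fst c"] by auto
      qed
      ultimately show ?thesis using N q by blast
    qed
  qed
qed

lemma smooth_fun_chart:
  assumes "smooth_fun A U f" "c \<in> A" "U \<subseteq> fst c"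
  shows "smooth_on (snd c ` U) (\<lambda>x. f (chart_inv c x))"
proof -
  have "smooth_on (snd c ` (U \<inter> fst c)) (f \<circ> chart_inv c)"
    using assms(1,2) by (simp add: smooth_fun_def del: split_paired_All)
  then show ?thesis using assms(3) by (simp add: o_def inf.absorb1)
qed

end

section \<open>Frames and fibres\<close>

definition frame_vec :: "('a, 'e::real_vector, 'm::finite) local_frame \<Rightarrow> 'a \<Rightarrow> real ^ 'm \<Rightarrow> 'e" where
  "frame_vec F q a = (\<Sum>i\<in>UNIV. (a $ i) *\<^sub>R snd F i q)"

lemma linear_frame_vec: "linear (frame_vec F q)"
  by (rule linearI) (auto simp: frame_vec_def sum.distrib scaleR_add_left scaleR_sum_right)

lemma frame_vec_axis: "frame_vec F q (axis i 1) = snd F i q"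
proof -
  have "frame_vec F q (axis i 1) = (\<Sum>j\<in>UNIV. if j = i then snd F j q else 0)"
    unfolding frame_vec_def by (rule sum.cong) (auto simp: axis_def)
  then show ?thesis by simp
qed

locale oriented_vector_bundle =
  fixes B :: "('a::{t2_space,second_countable_topology}, 'e::real_vector, 'm::finite) bundle_data"
  assumes is_bundle: "oriented_bundle B" and metric: "bundle_metric B"
begin

sublocale oriented_manifold "Atlas B"
  using is_bundle by unfold_locales (simp add: oriented_bundle_def)

lemma frame_facts:
  assumes "F \<in> Frames B"
  shows open_frame: "open (fst F)"
    and frame_basis: "q \<in> fst F \<Longrightarrow> inj (\<lambda>i. snd F i q)" "q \<in> fst F \<Longrightarrow> independent (range (\<lambda>i. snd F i q))"
      "q \<in> fst F \<Longrightarrow> span (range (\<lambda>i. snd F i q)) = Fibre B q"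
  using is_bundle assms by (auto simp: oriented_bundle_def)

lemma frame_vec_in_fibre: "F \<in> Frames B \<Longrightarrow> q \<in> fst F \<Longrightarrow> frame_vec F q a \<in> Fibre B q"
  unfolding frame_vec_def frame_basis(3)[symmetric]
  by (intro span_sum span_scale span_base) auto

lemma frame_vec_inj:
  assumes "F \<in> Frames B" "q \<in> fst F" "frame_vec F q a = 0"
  shows "a = 0"
proof -
  let ?f = "\<lambda>i. snd F i q"
  note inj = frame_basis(1)[OF assms(1,2)]
  have "(\<Sum>v\<in>range ?f. (a $ inv ?f v) *\<^sub>R v) = frame_vec F q a"
    unfolding frame_vec_def by (subst sum.reindex[OF inj]) (simp add: inv_f_f[OF inj])
  then have "a $ inv ?f v = 0" if "v \<in> range ?f" for v
    using independentD[OF frame_basis(2)[OF assms(1,2)], of "range ?f" "\<lambda>v. a $ inv ?f v" v] that assms(3)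
    by simp
  then have "a $ i = 0" for i by (metis inv_f_f[OF inj] rangeI)
  then show ?thesis by (simp add: vec_eq_iff)
qed

lemma frame_comp_frame_vec:
  assumes "F \<in> Frames B" "q \<in> fst F"
  shows "frame_comp F q (frame_vec F q a) = a"
  unfolding frame_comp_def
proof (rule the_equality)
  show "(\<Sum>i\<in>UNIV. (a $ i) *\<^sub>R snd F i q) = frame_vec F q a" by (simp add: frame_vec_def)
  fix b assume "(\<Sum>i\<in>UNIV. (b $ i) *\<^sub>R snd F i q) = frame_vec F q a"
  then have "frame_vec F q (b - a) = 0"
    using linear_diff[OF linear_frame_vec] by (metis eq_iff_diff_eq_0 frame_vec_def)
  then show "b = a" using frame_vec_inj[OF assms] by (metis eq_iff_diff_eq_0)
qed

lemma frame_vec_frame_comp: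
  assumes "F \<in> Frames B" "q \<in> fst F" "u \<in> Fibre B q"
  shows "frame_vec F q (frame_comp F q u) = u"
proof -
  let ?f = "\<lambda>i. snd F i q"
  have "u \<in> span (range ?f)" using frame_basis(3) assms by metis
  then obtain r where r: "u = (\<Sum>v\<in>range ?f. r v *\<^sub>R v)"
    using span_finite[of "range ?f"] by auto
  also have "\<dots> = frame_vec F q (\<chi> i. r (?f i))"
    unfolding frame_vec_def by (subst sum.reindex[OF frame_basis(1)[OF assms(1,2)]]) simp
  finally show ?thesis using frame_comp_frame_vec[OF assms(1,2)] by metis
qed

lemma metric_facts:
  assumes "u \<in> Fibre B q" "v \<in> Fibre B q"
  shows inner_sym: "Inner B q u v = Inner B q v u"
    and inner_pos: "u \<noteq> 0 \<Longrightarrow> 0 < Inner B q u u"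
    and inner_lin: "w \<in> Fibre B q \<Longrightarrow> Inner B q (a *\<^sub>R u + b *\<^sub>R v) w = a * Inner B q u w + b * Inner B q v w"
proof -
  note m = metric[unfolded bundle_metric_def]
  show "Inner B q u v = Inner B q v u"
    using m[THEN conjunct2, THEN conjunct1] assms by blast
  show "0 < Inner B q u u" if "u \<noteq> 0"
    using m[THEN conjunct2, THEN conjunct2, THEN conjunct1] assms that by blast
  show "Inner B q (a *\<^sub>R u + b *\<^sub>R v) w = a * Inner B q u w + b * Inner B q v w"
    if "w \<in> Fibre B q"
    using m[THEN conjunct1] assms that by blast
qed

lemma fibre_subspace: "subspace (Fibre B q)"
  using is_bundle by (auto simp: oriented_bundle_def)

lemma inner_lin_right:
  assumes "u \<in> Fibre B q" "v \<in> Fibre B q" "w \<in> Fibre B q"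
  shows "Inner B q w (a *\<^sub>R u + b *\<^sub>R v) = a * Inner B q w u + b * Inner B q w v"
  using assms inner_sym inner_lin by (metis fibre_subspace subspace_add subspace_scale)

lemma inner_zero: "u \<in> Fibre B q \<Longrightarrow> Inner B q 0 u = 0" "u \<in> Fibre B q \<Longrightarrow> Inner B q u 0 = 0"
  using inner_lin[of 0 q 0 u 0 0] inner_lin_right[of 0 q 0 u 0 0] fibre_subspace[of q] subspace_0 by auto

lemma inner_diff_left:
  "u \<in> Fibre B q \<Longrightarrow> v \<in> Fibre B q \<Longrightarrow> w \<in> Fibre B q \<Longrightarrow> Inner B q (u - v) w = Inner B q u w - Inner B q v w"
  using inner_lin[of u q v w 1 "-1"] by simp

lemma inner_diff_right:
  "u \<in> Fibre B q \<Longrightarrow> v \<in> Fibre B q \<Longrightarrow> w \<in> Fibre B q \<Longrightarrow> Inner B q w (u - v) = Inner B q w u - Inner B q w v"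
  using inner_lin_right[of u q v w 1 "-1"] by simp

lemma inner_scale_left: "u \<in> Fibre B q \<Longrightarrow> w \<in> Fibre B q \<Longrightarrow> Inner B q (a *\<^sub>R u) w = a * Inner B q u w"
  using inner_lin[of u q u w a 0] by simp

lemma inner_scale_right: "u \<in> Fibre B q \<Longrightarrow> w \<in> Fibre B q \<Longrightarrow> Inner B q w (a *\<^sub>R u) = a * Inner B q w u"
  using inner_lin_right[of u q u w a 0] by simp

lemma inner_sum_left:
  assumes "finite J" "\<And>i. i \<in> J \<Longrightarrow> u i \<in> Fibre B q" "w \<in> Fibre B q"
  shows "Inner B q (\<Sum>i\<in>J. a i *\<^sub>R u i) w = (\<Sum>i\<in>J. a i * Inner B q (u i) w)"
  using assms(1,2)
proof induction
  case empty then show ?case using inner_zero assms(3) by simp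
next
  case (insert x J)
  have "(\<Sum>i\<in>J. a i *\<^sub>R u i) \<in> Fibre B q"
    using insert by (intro subspace_sum[OF fibre_subspace] subspace_scale[OF fibre_subspace]) auto
  then show ?case using insert inner_lin[of "u x" q "\<Sum>i\<in>J. a i *\<^sub>R u i" w "a x" 1] assms(3) by simp
qed

lemma smooth_sec_frame:
  assumes "F \<in> Frames B" "U \<subseteq> fst F"
  shows "smooth_sec B U (snd F i)"
  unfolding smooth_sec_def
proof (intro conjI ballI)
  fix q assume "q \<in> U"
  then show "snd F i q \<in> Fibre B q"
    using frame_vec_in_fibre[OF assms(1), of q "axis i 1"] assms(2) by (auto simp: frame_vec_axis)
next
  fix G assume G: "G \<in> Frames B"
  have "smooth_fun (Atlas B) (fst F \<inter> fst G) (\<lambda>q. frame_comp G q (snd F i q))"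
    using is_bundle assms(1) G unfolding oriented_bundle_def by blast
  then show "smooth_fun (Atlas B) (U \<inter> fst G) (\<lambda>q. frame_comp G q (snd F i q))"
    unfolding smooth_fun_def by (meson assms(2) Int_mono image_mono order_refl smooth_on_subset)
qed

lemma smooth_sec_subset: "smooth_sec B U s \<Longrightarrow> V \<subseteq> U \<Longrightarrow> smooth_sec B V s"
  unfolding smooth_sec_def smooth_fun_def by (meson Int_mono image_mono order_refl smooth_on_subset subsetD)

lemma transition_det_pos:
  "F \<in> Frames B \<Longrightarrow> G \<in> Frames B \<Longrightarrow> q \<in> fst F \<Longrightarrow> q \<in> fst G \<Longrightarrow> 0 < det (\<chi> i. frame_comp G q (snd F i q))"
  using is_bundle unfolding oriented_bundle_def by blast

lemma det_frame_change:
  assumes F: "F \<in> Frames B" "q \<in> fst F" and G: "G \<in> Frames B" "q \<in> fst G"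
    and b: "\<And>i. b i \<in> Fibre B q"
  shows "0 < det (\<chi> i. frame_comp F q (b i)) \<longleftrightarrow> 0 < det (\<chi> i. frame_comp G q (b i))"
proof -
  define T where "T a = frame_comp G q (frame_vec F q a)" for a
  have vT: "frame_vec G q (T a) = frame_vec F q a" for a
    unfolding T_def by (rule frame_vec_frame_comp[OF G frame_vec_in_fibre[OF F]])
  have "linear T"
  proof (rule linearI)
    show "T (a + b) = T a + T b" for a b
      using vT frame_comp_frame_vec[OF G] linear_add[OF linear_frame_vec] by metis
    show "T (r *\<^sub>R a) = r *\<^sub>R T a" for r a
      using vT frame_comp_frame_vec[OF G] linear_scale[OF linear_frame_vec] by metis
  qed
  have "frame_comp G q (b i) = T (frame_comp F q (b i))" for i
    unfolding T_def using frame_vec_frame_comp[OF F b] by simp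
  then have "det (\<chi> i. frame_comp G q (b i)) = det (\<chi> i. frame_comp F q (b i)) * det (\<chi> i. T (axis i 1))"
    using det_rows_linear_image[OF \<open>linear T\<close>, of "\<lambda>i. frame_comp F q (b i)"] by simp
  moreover have "0 < det (\<chi> i. T (axis i 1))"
    unfolding T_def frame_vec_axis using transition_det_pos F G by blast
  ultimately show ?thesis by (simp add: zero_less_mult_iff)
qed

definition gram :: "('a, 'e, 'm) local_frame \<Rightarrow> 'a \<Rightarrow> real ^ 'm ^ 'm" where
  "gram F q = (\<chi> i j. Inner B q (snd F i q) (snd F j q))"

lemma bilinear_frame_inner:
  assumes F: "F \<in> Frames B" "q \<in> fst F"
  shows "bilinear (\<lambda>a b. Inner B q (frame_vec F q a) (frame_vec F q b))"
proof -
  note fv = frame_vec_in_fibre[OF F]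
  have 1: "linear (\<lambda>a. Inner B q (frame_vec F q a) (frame_vec F q b))" for b
    using inner_lin[OF fv fv fv, of 1 _ 1] inner_lin[OF fv fv fv, of _ _ 0]
    by (intro linearI) (auto simp: linear_add[OF linear_frame_vec] linear_scale[OF linear_frame_vec])
  have "(\<lambda>b. Inner B q (frame_vec F q a) (frame_vec F q b)) = (\<lambda>b. Inner B q (frame_vec F q b) (frame_vec F q a))" for a
    using inner_sym[OF fv fv] by auto
  with 1 show ?thesis by (simp add: bilinear_def)
qed

lemma inner_frame_vec:
  assumes F: "F \<in> Frames B" "q \<in> fst F"
  shows "Inner B q (frame_vec F q a) (frame_vec F q b) = (\<Sum>i\<in>UNIV. \<Sum>j\<in>UNIV. a $ i * b $ j * Inner B q (snd F i q) (snd F j q))"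
  using bilinear_expansion[OF bilinear_frame_inner[OF F], of a b] by (simp add: frame_vec_axis)

lemma det_inner_matrix:
  assumes F: "F \<in> Frames B" "q \<in> fst F" and "\<And>i. b i \<in> Fibre B q" "\<And>i. u i \<in> Fibre B q"
  shows "det (\<chi> i j. Inner B q (b i) (u j))
    = det (\<chi> i. frame_comp F q (b i)) * det (gram F q) * det (\<chi> i. frame_comp F q (u i))"
proof -
  have "(\<chi> i j. Inner B q (b i) (u j)) = (\<chi> i. frame_comp F q (b i)) ** gram F q ** transpose (\<chi> i. frame_comp F q (u i))"
  proof -
    have "Inner B q (b i) (u j) = (\<Sum>l\<in>UNIV. (\<Sum>k\<in>UNIV. frame_comp F q (b i) $ k * Inner B q (snd F k q) (snd F l q)) * frame_comp F q (u j) $ l)" for i j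
      using inner_frame_vec[OF F, of "frame_comp F q (b i)" "frame_comp F q (u j)"] assms(3,4)
      by (simp add: frame_vec_frame_comp[OF F] sum_distrib_right) (subst sum.swap, simp add: mult_ac)
    then show ?thesis by (simp add: vec_eq_iff matrix_matrix_mult_def gram_def transpose_def)
  qed
  then show ?thesis by (simp add: det_mul)
qed

text \<open>
  Orthonormal families are enlarged one vector at a time: the conditions of orthogonality to fewer than
  \<open>CARD('m)\<close> vectors define a linear map that is not surjective, hence has a kernel.  The orientation is
  corrected by changing the sign of one vector.
\<close>

lemma exists_positive_orthonormal: "\<exists>u. positive_orthonormal B q u"
proof -
  obtain F where F: "F \<in> Frames B" "q \<in> fst F"
    using is_bundle unfolding oriented_bundle_def by blast
  let ?g = "\<lambda>a b. Inner B q (frame_vec F q a) (frame_vec F q b)"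
  note bil = bilinear_frame_inner[OF F]
  have pos: "0 < ?g a a" if "a \<noteq> 0" for a
    using inner_pos[OF frame_vec_in_fibre[OF F] frame_vec_in_fibre[OF F]] frame_vec_inj[OF F] that by blast
  have sym: "?g a b = ?g b a" for a b by (rule inner_sym[OF frame_vec_in_fibre[OF F] frame_vec_in_fibre[OF F]])
  have "\<exists>u. \<forall>i\<in>J. \<forall>j\<in>J. ?g (u i) (u j) = (if i = j then 1 else 0)" if "finite J" for J :: "'m set"
    using that
  proof induction
    case (insert k J)
    then obtain u where u: "\<forall>i\<in>J. \<forall>j\<in>J. ?g (u i) (u j) = (if i = j then 1 else 0)" by blast
    define L where "L v = (\<chi> i. if i \<in> J then ?g (u i) v else 0)" for v
    have "linear L"
      unfolding L_def by (rule linearI) (auto simp: vec_eq_iff bilinear_radd[OF bil] bilinear_rmul[OF bil])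
    moreover have "\<not> surj L"
    proof
      assume "surj L"
      then obtain v where "axis k 1 = L v" by (metis surjD)
      then have "(axis k 1 :: real ^ 'm) $ k = L v $ k" by simp
      then show False using insert.hyps by (simp add: L_def axis_def)
    qed
    ultimately have "\<not> inj L" using linear_injective_imp_surjective by blast
    then obtain v where v: "v \<noteq> 0" "L v = 0" using \<open>linear L\<close> linear_injective_0 by blast
    have vJ: "?g (u i) v = 0" if "i \<in> J" for i
      using v(2) that unfolding L_def by (auto simp: vec_eq_iff split: if_splits)
    define w where "w = (1 / sqrt (?g v v)) *\<^sub>R v"
    have "?g w w = 1" using pos[OF v(1)]
      by (simp add: w_def bilinear_lmul[OF bil] bilinear_rmul[OF bil] field_simps)
    moreover have "?g (u i) w = 0" if "i \<in> J" for i using vJ[OF that] by (simp add: w_def bilinear_rmul[OF bil])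
    ultimately have "\<forall>i\<in>insert k J. \<forall>j\<in>insert k J. ?g ((u(k := w)) i) ((u(k := w)) j) = (if i = j then 1 else 0)"
      using u insert.hyps sym by auto
    then show ?case by blast
  qed auto
  from this[OF finite_class.finite_UNIV] obtain u :: "'m \<Rightarrow> real ^ 'm"
    where "\<forall>i\<in>UNIV. \<forall>j\<in>UNIV. ?g (u i) (u j) = (if i = j then 1 else 0)" by (elim exE)
  then have u: "?g (u i) (u j) = (if i = j then 1 else 0)" for i j by simp
  let ?b = "\<lambda>i. frame_vec F q (u i)"
  have "det (\<chi> i j. Inner B q (?b i) (?b j)) = 1"
  proof -
    have "(\<chi> i j. Inner B q (?b i) (?b j)) = mat 1" using u by (simp add: mat_def vec_eq_iff)
    then show ?thesis by simp
  qed
  then have nz: "det (\<chi> i. u i) \<noteq> 0"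
    using det_inner_matrix[OF F, of ?b ?b] frame_vec_in_fibre[OF F] by (auto simp: frame_comp_frame_vec[OF F])
  \<comment> \<open>An arbitrary index, for the vector whose sign may be changed.\<close>
  obtain k :: 'm where True by blast
  define s where "s = (if det (\<chi> i. u i) > 0 then 1 else - 1 :: real)"
  define w where "w i = (if i = k then s *s u i else u i)" for i
  have e: "(if i = k then u k else u i) = u i" for i by simp
  have "det (\<chi> i. w i) = s * det (\<chi> i. u i)"
    using det_row_mul[of k s u u] by (simp add: w_def e cong: if_cong)
  then have "det (\<chi> i. w i) > 0" using nz by (auto simp: s_def)
  moreover have "?g (w i) (w j) = (if i = j then 1 else 0)" for i j
    using u by (auto simp: w_def s_def scalar_mult_eq_scaleR bilinear_lmul[OF bil] bilinear_rmul[OF bil])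
  ultimately have "positive_orthonormal B q (\<lambda>i. frame_vec F q (w i))"
    unfolding positive_orthonormal_def using F frame_vec_in_fibre[OF F] frame_comp_frame_vec[OF F] by auto
  then show ?thesis by blast
qed

text \<open>
  Expressed through components, \<open>vol B q b\<close> is the determinant of the components of \<open>b\<close> times
  \<open>det (gram F q) det U\<close>, where \<open>U\<close> is the component matrix of a positive orthonormal basis.  Since
  \<open>det U > 0\<close> and \<open>(det U)\<^sup>2 det (gram F q) = 1\<close>, the factor is the square root.
\<close>

lemma vol_eq:
  assumes F: "F \<in> Frames B" "q \<in> fst F" and b: "\<And>i. b i \<in> Fibre B q"
  shows "0 < det (gram F q)" "vol B q b = sqrt (det (gram F q)) * det (\<chi> i. frame_comp F q (b i))"
proof -
  define u where "u = (SOME u. positive_orthonormal B q u)"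
  have po: "positive_orthonormal B q u"
    unfolding u_def using exists_positive_orthonormal by (rule someI_ex)
  then have uf: "u i \<in> Fibre B q" for i by (simp add: positive_orthonormal_def)
  let ?U = "det (\<chi> i. frame_comp F q (u i))"
  obtain G where G: "G \<in> Frames B" "q \<in> fst G" "0 < det (\<chi> i. frame_comp G q (u i))"
    using po unfolding positive_orthonormal_def by blast
  then have "?U > 0" using det_frame_change[OF F G(1,2), of u] uf by simp
  have "(\<chi> i j. Inner B q (u i) (u j)) = mat 1" using po by (simp add: positive_orthonormal_def mat_def vec_eq_iff)
  then have "det (\<chi> i j. Inner B q (u i) (u j)) = 1" by simp
  then have 1: "?U * det (gram F q) * ?U = 1" using det_inner_matrix[OF F uf uf] by simp
  then have 2: "?U\<^sup>2 * det (gram F q) = 1" by (simp add: power2_eq_square mult_ac)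
  then show g: "0 < det (gram F q)"
    using zero_less_mult_pos[of "?U\<^sup>2" "det (gram F q)"] \<open>?U > 0\<close> by simp
  have "(sqrt (det (gram F q)) * ?U)\<^sup>2 = 1" using 2 g by (simp add: power_mult_distrib mult.commute)
  moreover have "0 < sqrt (det (gram F q)) * ?U" using g \<open>?U > 0\<close> by simp
  ultimately have "sqrt (det (gram F q)) * ?U = 1" by (auto simp: power2_eq_1_iff)
  moreover have "det (gram F q) * ?U = sqrt (det (gram F q)) * (sqrt (det (gram F q)) * ?U)"
    using g by (simp add: mult.assoc[symmetric])
  ultimately have "det (gram F q) * ?U = sqrt (det (gram F q))" by simp
  moreover have "vol B q b = det (\<chi> i. frame_comp F q (b i)) * (det (gram F q) * ?U)"
    using det_inner_matrix[OF F b uf] unfolding vol_def Let_def u_def[symmetric] by (simp add: mult.assoc)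
  ultimately show "vol B q b = sqrt (det (gram F q)) * det (\<chi> i. frame_comp F q (b i))"
    by (simp add: mult.commute)
qed

end

section \<open>Coordinates and a frame around a point\<close>

text \<open>
  The data of a null vector field near \<open>p\<close>, read in the preferred chart at \<open>p\<close> and a local frame \<open>F\<close>.  In
  this chart tangent vectors at \<open>p\<close> coincide with their components.
\<close>

locale front_chart =
  fixes B :: "('a::{t2_space,second_countable_topology}, 'e::real_vector, 'm::finite) bundle_data"
    and \<phi> \<psi> :: "'a \<Rightarrow> real ^ 'm \<Rightarrow> 'e" and p :: 'a
    and U :: "'a set" and \<eta> :: "'a \<Rightarrow> real ^ 'm" and F :: "('a, 'e, 'm) local_frame"
  assumes front_bundle: "front_bundle B \<phi> \<psi>"
    and open_U: "open U" and p_U: "p \<in> U" and null_\<eta>: "null_vf B \<phi> U \<eta>"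
    and F: "F \<in> Frames B" and p_F: "p \<in> fst F"
begin

lemma coherent: "coherent_tangent_bundle B \<phi>" "coherent_tangent_bundle B \<psi>"
  using front_bundle by (auto simp: front_bundle_def frontal_bundle_def)

sublocale oriented_vector_bundle B
  using coherent(1) by unfold_locales (auto simp: coherent_tangent_bundle_def)

abbreviation A where "A \<equiv> Atlas B"
abbreviation c where "c \<equiv> chart_at A p"
abbreviation \<Sigma> where "\<Sigma> \<equiv> singular_set B \<phi>"
abbreviation \<xi> where "\<xi> \<equiv> chart_inv c"

definition W where "W = U \<inter> fst c \<inter> fst F"
definition \<Omega> where "\<Omega> = snd c ` W"
definition x0 where "x0 = snd c p"

definition P where "P x v = frame_comp F (\<xi> x) (\<phi> (\<xi> x) (tvec A c (\<xi> x) v))"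
definition Q where "Q x v = frame_comp F (\<xi> x) (\<psi> (\<xi> x) (tvec A c (\<xi> x) v))"
definition g where "g x a b = Inner B (\<xi> x) (frame_vec F (\<xi> x) a) (frame_vec F (\<xi> x) b)"
definition H where "H x = tangent_comp A c (\<xi> x) (\<eta> (\<xi> x))"

lemma c_in: "c \<in> A" and p_c: "p \<in> fst c"
  by (rule chart_at)+

lemma W: "open W" "p \<in> W" "W \<subseteq> U" "W \<subseteq> fst c" "W \<subseteq> fst F"
  unfolding W_def using open_U open_chart[OF c_in] open_frame[OF F] p_U p_c p_F by auto

lemma open_image: "open V \<Longrightarrow> V \<subseteq> W \<Longrightarrow> open (snd c ` V)"
  by (rule open_chart_image[OF c_in]) (use W in auto)

lemma \<xi>_chart [simp]: "q \<in> W \<Longrightarrow> \<xi> (snd c q) = q"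
  by (rule chart_inv_left[OF c_in]) (use W in auto)

lemma \<xi>_W: "x \<in> \<Omega> \<Longrightarrow> \<xi> x \<in> W" and chart_\<xi>: "x \<in> \<Omega> \<Longrightarrow> snd c (\<xi> x) = x"
  by (auto simp: \<Omega>_def)

lemma \<xi>_x0 [simp]: "\<xi> x0 = p" unfolding x0_def using W(2) by simp

lemma x0_\<Omega>: "x0 \<in> \<Omega>" using W(2) by (auto simp: \<Omega>_def x0_def)

lemma isCont_\<xi>: "isCont \<xi> x0"
proof -
  have "continuous_on \<Omega> \<xi>" unfolding \<Omega>_def
    by (rule continuous_on_subset[OF chart_inv_cont[OF c_in] image_mono[OF W(4)]])
  moreover have "open \<Omega>" unfolding \<Omega>_def by (rule open_image[OF W(1) order_refl])
  ultimately show ?thesis using x0_\<Omega> by (simp add: continuous_on_eq_continuous_at)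
qed

lemma bundle_homs: "bundle_hom B \<phi>" "bundle_hom B \<psi>"
  using coherent by (auto simp: coherent_tangent_bundle_def)

lemma linear_\<phi>: "linear (\<phi> q)" "linear (\<psi> q)"
  using bundle_homs by (auto simp: bundle_hom_def)

lemma in_fibre: "\<phi> q v \<in> Fibre B q" "\<psi> q v \<in> Fibre B q"
  using bundle_homs unfolding bundle_hom_def by (meson rangeI subsetD)+

lemma hom_smooth:
  assumes "open V" "smooth_vf A V X"
  shows "smooth_sec B V (\<lambda>q. \<phi> q (X q))" "smooth_sec B V (\<lambda>q. \<psi> q (X q))"
  using bundle_homs assms by (auto simp: bundle_hom_def)

lemma symmetric: "Inner B q (\<phi> q X) (\<psi> q Y) = Inner B q (\<phi> q Y) (\<psi> q X)"
  using front_bundle unfolding front_bundle_def frontal_bundle_def by blast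

lemma frame_comp_linear:
  assumes "q \<in> fst F" "linear f" "range f \<subseteq> Fibre B q"
  shows "linear (\<lambda>v. frame_comp F q (f v))"
proof -
  have fv: "frame_vec F q (frame_comp F q (f v)) = f v" for v
    using frame_vec_frame_comp[OF F assms(1)] assms(3) by blast
  show ?thesis
  proof (rule linearI)
    show "frame_comp F q (f (a + b)) = frame_comp F q (f a) + frame_comp F q (f b)" for a b
      using fv frame_comp_frame_vec[OF F assms(1)] linear_add[OF linear_frame_vec] linear_add[OF assms(2)] by metis
    show "frame_comp F q (f (r *\<^sub>R a)) = r *\<^sub>R frame_comp F q (f a)" for r a
      using fv frame_comp_frame_vec[OF F assms(1)] linear_scale[OF linear_frame_vec] linear_scale[OF assms(2)] by metis
  qed
qed

lemma smooth_coords: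
  assumes "smooth_sec B W s"
  shows "smooth_on \<Omega> (\<lambda>x. frame_comp F (\<xi> x) (s (\<xi> x)))"
proof -
  have "smooth_fun A (W \<inter> fst F) (\<lambda>q. frame_comp F q (s q))"
    using assms F by (auto simp: smooth_sec_def)
  then have "smooth_fun A W (\<lambda>q. frame_comp F q (s q))" using W by (simp add: inf.absorb1)
  then show ?thesis unfolding \<Omega>_def by (rule smooth_fun_chart[OF _ c_in]) (use W in auto)
qed

lemma smooth_tvec: "smooth_vf A W (\<lambda>q. tvec A c q v)"
  by (rule smooth_vf_tvec[OF c_in W(1,4)])

lemma smooth_\<eta>: "smooth_vf A W \<eta>"
  using null_\<eta> W unfolding null_vf_def smooth_vf_def by (meson Int_mono image_mono order_refl smooth_on_subset)

lemma smooth_inner_sec: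
  assumes "open V" "smooth_sec B V s" "smooth_sec B V t"
  shows "smooth_fun A V (\<lambda>q. Inner B q (s q) (t q))"
  using metric[unfolded bundle_metric_def, THEN conjunct2, THEN conjunct2, THEN conjunct2] assms by blast

lemma \<phi>_tvec:
  assumes "x \<in> \<Omega>"
  shows "\<phi> (\<xi> x) (tvec A c (\<xi> x) v) = frame_vec F (\<xi> x) (P x v)"
    and "\<psi> (\<xi> x) (tvec A c (\<xi> x) v) = frame_vec F (\<xi> x) (Q x v)"
proof -
  have q: "\<xi> x \<in> fst F" using \<xi>_W[OF assms] W by auto
  show "\<phi> (\<xi> x) (tvec A c (\<xi> x) v) = frame_vec F (\<xi> x) (P x v)"
    unfolding P_def by (rule frame_vec_frame_comp[OF F q in_fibre(1), symmetric])
  show "\<psi> (\<xi> x) (tvec A c (\<xi> x) v) = frame_vec F (\<xi> x) (Q x v)"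
    unfolding Q_def by (rule frame_vec_frame_comp[OF F q in_fibre(2), symmetric])
qed

lemma linear_PQ: assumes "x \<in> \<Omega>" shows "linear (P x)" "linear (Q x)"
proof -
  have q: "\<xi> x \<in> fst F" "\<xi> x \<in> fst c" using \<xi>_W[OF assms] W by auto
  note lt = linear_tvec[OF c_in q(2)]
  show "linear (P x)" unfolding P_def
    by (rule frame_comp_linear[OF q(1)])
      (use in_fibre in \<open>auto intro: linear_compose[OF lt linear_\<phi>(1), unfolded o_def]\<close>)
  show "linear (Q x)" unfolding Q_def
    by (rule frame_comp_linear[OF q(1)])
      (use in_fibre in \<open>auto intro: linear_compose[OF lt linear_\<phi>(2), unfolded o_def]\<close>)
qed

lemma singular_iff:
  assumes x: "x \<in> \<Omega>"
  shows "\<xi> x \<in> \<Sigma> \<longleftrightarrow> det (\<chi> i. P x (axis i 1)) = 0"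
proof -
  have q: "\<xi> x \<in> fst F" "\<xi> x \<in> fst c" using \<xi>_W[OF x] W by auto
  note \<phi>P = \<phi>_tvec(1)[OF x]
  have ker: "P x v = 0 \<longleftrightarrow> \<phi> (\<xi> x) (tvec A c (\<xi> x) v) = 0" for v
    unfolding \<phi>P using frame_vec_inj[OF F q(1)] linear_0[OF linear_frame_vec] by metis
  have t0: "tvec A c (\<xi> x) v = 0 \<longleftrightarrow> v = 0" for v
    using tvec_inj[OF c_in q(2)] linear_0[OF linear_tvec[OF c_in q(2)]] by metis
  show ?thesis
  proof
    assume "\<xi> x \<in> \<Sigma>"
    show "det (\<chi> i. P x (axis i 1)) = 0"
    proof (rule ccontr)
      assume nz: "det (\<chi> i. P x (axis i 1)) \<noteq> 0"
      have "inj (\<phi> (\<xi> x))"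
      proof (subst linear_injective_0[OF linear_\<phi>(1)], intro allI impI)
        fix w assume w: "\<phi> (\<xi> x) w = 0"
        let ?v = "tangent_comp A c (\<xi> x) w"
        have tw: "tvec A c (\<xi> x) ?v = w" by (rule tvec_tangent_comp[OF c_in q(2)])
        then have "P x ?v = 0" using w ker by simp
        then have "(\<Sum>i\<in>UNIV. (?v $ i) *\<^sub>R P x (axis i 1)) = 0" using linear_expansion[OF linear_PQ(1)[OF x]] by metis
        then have "?v = 0" by (rule rows_independent[OF nz])
        then show "w = 0" using tw t0 by metis
      qed
      moreover have "Fibre B (\<xi> x) \<subseteq> range (\<phi> (\<xi> x))"
      proof
        fix u assume u: "u \<in> Fibre B (\<xi> x)"
        obtain a where "frame_comp F (\<xi> x) u = (\<Sum>i\<in>UNIV. (a $ i) *\<^sub>R P x (axis i 1))"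
          by (rule rows_span[OF nz])
        then have "frame_comp F (\<xi> x) u = P x a" using linear_expansion[OF linear_PQ(1)[OF x]] by metis
        then have "u = \<phi> (\<xi> x) (tvec A c (\<xi> x) a)" unfolding \<phi>P using frame_vec_frame_comp[OF F q(1) u] by simp
        then show "u \<in> range (\<phi> (\<xi> x))" by blast
      qed
      ultimately have "bij_betw (\<phi> (\<xi> x)) UNIV (Fibre B (\<xi> x))" using in_fibre by (auto simp: bij_betw_def)
      then show False using \<open>\<xi> x \<in> \<Sigma>\<close> by (simp add: singular_set_def)
    qed
  next
    assume "det (\<chi> i. P x (axis i 1)) = 0"
    then obtain a where a: "a \<noteq> 0" "(\<Sum>i\<in>UNIV. (a $ i) *\<^sub>R P x (axis i 1)) = 0" by (rule rows_dependent)
    then have "P x a = 0" using linear_expansion[OF linear_PQ(1)[OF x]] by metis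
    then have "\<not> inj (\<phi> (\<xi> x))" using a(1) ker t0 linear_injective_0[OF linear_\<phi>(1)] by metis
    then show "\<xi> x \<in> \<Sigma>" by (auto simp: singular_set_def bij_betw_def)
  qed
qed

lemma \<eta>_tvec: "x \<in> \<Omega> \<Longrightarrow> \<eta> (\<xi> x) = tvec A c (\<xi> x) (H x)"
  unfolding H_def by (rule tvec_tangent_comp[OF c_in, symmetric]) (use \<xi>_W W in auto)

sublocale front_coords \<Omega> P Q g H
proof (rule front_coords.intro)
  show "open \<Omega>" unfolding \<Omega>_def by (rule open_image[OF W(1)]) simp
  fix x v w a b
  show "smooth_on \<Omega> (\<lambda>x. P x v)" "smooth_on \<Omega> (\<lambda>x. Q x v)"
    unfolding P_def Q_def by (intro smooth_coords hom_smooth W(1) smooth_tvec)+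
  have "smooth_on (snd c ` (W \<inter> fst c)) (\<lambda>x. tangent_comp A c (\<xi> x) (\<eta> (\<xi> x)))"
    using smooth_\<eta> c_in unfolding smooth_vf_def by (rule bspec)
  then show "smooth_on \<Omega> H" using W(4) unfolding H_def[abs_def] \<Omega>_def by (simp add: inf.absorb1)
  show "smooth_on \<Omega> (\<lambda>x. g x a b)"
  proof (rule smooth_on_cong)
    show op: "open \<Omega>" unfolding \<Omega>_def by (rule open_image[OF W(1)]) simp
    have "smooth_on \<Omega> (\<lambda>x. Inner B (\<xi> x) (snd F i (\<xi> x)) (snd F j (\<xi> x)))" for i j
      unfolding \<Omega>_def
      by (rule smooth_fun_chart[OF smooth_inner_sec[OF W(1) smooth_sec_frame[OF F] smooth_sec_frame[OF F]] c_in])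
        (use W in auto)
    then show "smooth_on \<Omega> (\<lambda>x. \<Sum>i\<in>UNIV. \<Sum>j\<in>UNIV. a $ i * b $ j * Inner B (\<xi> x) (snd F i (\<xi> x)) (snd F j (\<xi> x)))"
      by (intro smooth_on_sum smooth_on_mult smooth_on_const op)
    show "(\<Sum>i\<in>UNIV. \<Sum>j\<in>UNIV. a $ i * b $ j * Inner B (\<xi> x) (snd F i (\<xi> x)) (snd F j (\<xi> x))) = g x a b"
      if "x \<in> \<Omega>" for x
      unfolding g_def by (rule inner_frame_vec[OF F, symmetric]) (use \<xi>_W[OF that] W in auto)
  qed
  assume x: "x \<in> \<Omega>"
  have q: "\<xi> x \<in> fst F" "\<xi> x \<in> fst c" using \<xi>_W[OF x] W by auto
  note fv = frame_vec_in_fibre[OF F q(1)]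
  show "linear (P x)" "linear (Q x)" by (rule linear_PQ[OF x])+
  show "bilinear (g x)" unfolding g_def by (rule bilinear_frame_inner[OF F q(1)])
  show "g x a b = g x b a" unfolding g_def by (rule inner_sym[OF fv fv])
  show "0 < g x a a" if "a \<noteq> 0"
    unfolding g_def using inner_pos[OF fv fv] frame_vec_inj[OF F q(1)] that by blast
  show "g x (P x v) (Q x w) = g x (P x w) (Q x v)"
    unfolding g_def \<phi>_tvec[OF x, symmetric] by (rule symmetric)
  show "v = 0" if "P x v = 0" "Q x v = 0"
  proof -
    have "\<phi> (\<xi> x) (tvec A c (\<xi> x) v) = 0" "\<psi> (\<xi> x) (tvec A c (\<xi> x) v) = 0"
      unfolding \<phi>_tvec[OF x] that by (rule linear_0[OF linear_frame_vec])+
    then have "tvec A c (\<xi> x) v = 0" using front_bundle unfolding front_bundle_def by blast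
    then show ?thesis by (rule tvec_inj[OF c_in q(2)])
  qed
  show "H x \<noteq> 0 \<and> P x (H x) = 0" if "det (\<chi> i. P x (axis i 1)) = 0"
  proof -
    have "\<xi> x \<in> U \<inter> \<Sigma>" using singular_iff[OF x] that \<xi>_W[OF x] W by auto
    then have "\<eta> (\<xi> x) \<noteq> 0 \<and> \<phi> (\<xi> x) (\<eta> (\<xi> x)) = 0" using null_\<eta> unfolding null_vf_def by blast
    moreover have "tvec A c (\<xi> x) 0 = 0" by (rule linear_0[OF linear_tvec[OF c_in q(2)]])
    moreover have "P x (H x) = frame_comp F (\<xi> x) (frame_vec F (\<xi> x) 0)" if "\<phi> (\<xi> x) (\<eta> (\<xi> x)) = 0"
      unfolding P_def \<eta>_tvec[OF x, symmetric] that by (simp add: linear_0[OF linear_frame_vec])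
    ultimately show ?thesis using \<eta>_tvec[OF x] frame_comp_frame_vec[OF F q(1)] by metis
  qed
qed

lemma singular_Lam: "x \<in> \<Omega> \<Longrightarrow> \<xi> x \<in> \<Sigma> \<longleftrightarrow> Lam x = 0"
  by (simp add: singular_iff Lam_def)

lemma forms_tvec:
  assumes "x \<in> \<Omega>"
  shows "first_form B \<phi> (\<xi> x) (tvec A c (\<xi> x) v) (tvec A c (\<xi> x) w) = I x v w"
    and "second_form B \<phi> \<psi> (\<xi> x) (tvec A c (\<xi> x) v) (tvec A c (\<xi> x) w) = II x v w"
  unfolding first_form_def second_form_def I_def II_def g_def \<phi>_tvec[OF assms] by simp_all

lemma K_ext_tvec:
  assumes "x \<in> \<Omega>"
  shows "K_ext B \<phi> \<psi> (\<xi> x) (tvec A c (\<xi> x) v) (tvec A c (\<xi> x) w) = gram_det (II x) v w / gram_det (I x) v w"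
  unfolding K_ext_def gram_det_def forms_tvec[OF assms] ..

lemma K_values_iff:
  assumes "V \<subseteq> W"
  shows "k \<in> K_values B \<phi> \<psi> V \<longleftrightarrow> (\<exists>x v w. x \<in> snd c ` V \<and> Lam x \<noteq> 0 \<and> lin_indep2 v w \<and>
    k = gram_det (II x) v w / gram_det (I x) v w)"
proof
  assume "k \<in> K_values B \<phi> \<psi> V"
  then obtain q X Y where q: "q \<in> V" "q \<notin> \<Sigma>" "lin_indep2 X Y" "k = K_ext B \<phi> \<psi> q X Y"
    unfolding K_values_def by blast
  let ?x = "snd c q"
  have x: "?x \<in> \<Omega>" "\<xi> ?x = q" "q \<in> fst c" using q(1) assms W by (auto simp: \<Omega>_def)
  have XY: "tvec A c q (tangent_comp A c q X) = X" "tvec A c q (tangent_comp A c q Y) = Y"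
    by (rule tvec_tangent_comp[OF c_in x(3)])+
  have "k = gram_det (II ?x) (tangent_comp A c q X) (tangent_comp A c q Y) / gram_det (I ?x) (tangent_comp A c q X) (tangent_comp A c q Y)"
    using K_ext_tvec[OF x(1)] q(4) XY x(2) by metis
  moreover have "lin_indep2 (tangent_comp A c q X) (tangent_comp A c q Y)"
    using lin_indep2_tvec[OF c_in x(3)] q(3) XY by metis
  moreover have "Lam ?x \<noteq> 0" using singular_Lam[OF x(1)] q(2) x(2) by simp
  ultimately show "\<exists>x v w. x \<in> snd c ` V \<and> Lam x \<noteq> 0 \<and> lin_indep2 v w \<and>
    k = gram_det (II x) v w / gram_det (I x) v w" using q(1) by blast
next
  assume "\<exists>x v w. x \<in> snd c ` V \<and> Lam x \<noteq> 0 \<and> lin_indep2 v w \<and>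
    k = gram_det (II x) v w / gram_det (I x) v w"
  then obtain q v w where q: "q \<in> V" "Lam (snd c q) \<noteq> 0" "lin_indep2 v w"
    "k = gram_det (II (snd c q)) v w / gram_det (I (snd c q)) v w" by blast
  have x: "snd c q \<in> \<Omega>" "\<xi> (snd c q) = q" "q \<in> fst c" using q(1) assms W by (auto simp: \<Omega>_def)
  have "k = K_ext B \<phi> \<psi> q (tvec A c q v) (tvec A c q w)" using K_ext_tvec[OF x(1)] q(4) x(2) by metis
  moreover have "q \<notin> \<Sigma>" using singular_Lam[OF x(1)] q(2) x(2) by simp
  moreover have "lin_indep2 (tvec A c q v) (tvec A c q w)" using lin_indep2_tvec[OF c_in x(3)] q(3) by blast
  ultimately show "k \<in> K_values B \<phi> \<psi> V" unfolding K_values_def using q(1) by blast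
qed

lemma lam_eq: "x \<in> \<Omega> \<Longrightarrow> lam B \<phi> c (\<xi> x) = sqrt (det (gram F (\<xi> x))) * Lam x"
  and gram_pos: "x \<in> \<Omega> \<Longrightarrow> 0 < det (gram F (\<xi> x))"
proof -
  assume x: "x \<in> \<Omega>"
  have q: "\<xi> x \<in> fst F" using \<xi>_W[OF x] W by auto
  show "lam B \<phi> c (\<xi> x) = sqrt (det (gram F (\<xi> x))) * Lam x"
    unfolding lam_def coord_vec_tvec vol_eq(2)[OF F q, of "\<lambda>i. \<phi> (\<xi> x) (tvec A c (\<xi> x) (axis i 1))", OF in_fibre(1)]
    by (simp add: Lam_def P_def)
  show "0 < det (gram F (\<xi> x))" by (rule vol_eq(1)[OF F q, of "\<lambda>_. 0"]) (simp add: subspace_0[OF fibre_subspace])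
qed

lemma dlam_eq:
  assumes "Lam x0 = 0"
  shows "dlam B \<phi> p v = sqrt (det (gram F p)) * frechet_derivative Lam (at x0) v"
proof -
  let ?G = "\<lambda>x. det (gram F (\<xi> x))"
  have "smooth_on \<Omega> (\<lambda>x. det (\<chi> i j. g x (axis i 1) (axis j 1)))"
    unfolding det_def
    by (intro smooth_on_sum smooth_on_mult smooth_on_const smooth_on_prod open_\<Omega>) (simp add: smooth_g)
  then have "smooth_on \<Omega> ?G" by (simp add: gram_def g_def frame_vec_axis)
  then have dG: "(?G has_derivative frechet_derivative ?G (at x0)) (at x0)"
    by (rule smooth_on_has_derivative[OF _ x0_\<Omega>])
  have pos: "0 < ?G x0" by (rule gram_pos[OF x0_\<Omega>])
  have "((\<lambda>x. sqrt (?G x) * Lam x) has_derivative (\<lambda>v. sqrt (det (gram F p)) * frechet_derivative Lam (at x0) v)) (at x0)"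
    using has_derivative_mult[OF has_derivative_real_sqrt[OF pos dG] smooth_on_has_derivative[OF smooth_Lam x0_\<Omega>]]
    by (simp add: assms)
  then have "((lam B \<phi> c \<circ> \<xi>) has_derivative (\<lambda>v. sqrt (det (gram F p)) * frechet_derivative Lam (at x0) v)) (at x0)"
    by (rule has_derivative_transform_within_open[OF _ open_\<Omega> x0_\<Omega>]) (simp add: lam_eq)
  from fun_cong[OF frechet_derivative_at[OF this], of v] show ?thesis
    by (simp add: dlam_def dfun_def x0_def)
qed

lemma dfun_p: "dfun A f p v = frechet_derivative (\<lambda>x. f (\<xi> x)) (at x0) v"
  by (simp add: dfun_def o_def x0_def)

lemma H_x0: "H x0 = \<eta> p"
  unfolding H_def \<xi>_x0 tangent_comp_dtrans by (rule dtrans_self[OF c_in p_c])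

text \<open>
  Tangent vectors of the singular set are velocities of curves in this set, along which \<open>f\<close> is constant.
\<close>

lemma constant_along_singular:
  assumes v: "v \<in> sing_tangent B \<phi> p" and N: "open N" "p \<in> N"
    and const: "\<And>q. q \<in> N \<Longrightarrow> q \<in> \<Sigma> \<Longrightarrow> f q = k"
    and der: "((\<lambda>x. f (\<xi> x)) has_derivative f') (at x0)"
  shows "f' v = 0"
proof -
  obtain \<gamma> where \<gamma>: "\<gamma> 0 = p" "isCont \<gamma> 0" "\<forall>\<^sub>F t in nhds 0. \<gamma> t \<in> \<Sigma>"
    "((\<lambda>t. snd c (\<gamma> t)) has_vector_derivative v) (at 0)"
    using v unfolding tangent_to_def by blast
  have "\<forall>\<^sub>F t in nhds 0. \<gamma> t \<in> N \<inter> W"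
    using \<gamma>(1,2) N W(1,2) by (intro topological_tendstoD[of \<gamma> p])
      (auto simp: isCont_def tendsto_at_iff_tendsto_nhds)
  with \<gamma>(3) have ev: "\<forall>\<^sub>F t in nhds 0. f (\<xi> (snd c (\<gamma> t))) = k"
    by eventually_elim (use const in auto)
  have "((\<lambda>t. f (\<xi> (snd c (\<gamma> t)))) has_derivative (\<lambda>t. f' (t *\<^sub>R v))) (at 0)"
    by (rule has_derivative_compose[OF \<gamma>(4)[unfolded has_vector_derivative_def]])
      (use der \<gamma>(1) in \<open>simp add: x0_def\<close>)
  moreover have "((\<lambda>t. f (\<xi> (snd c (\<gamma> t)))) has_derivative (\<lambda>t. 0)) (at 0)"
    using ev eventually_nhds_x_imp_x[OF ev]
    by (intro has_derivative_transform_eventually[OF has_derivative_const[of k]])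
      (auto simp: eventually_nhds_conv_at eq_commute)
  ultimately have "(\<lambda>t::real. f' (t *\<^sub>R v)) = (\<lambda>t. 0)" by (rule has_derivative_unique)
  from fun_cong[OF this, of 1] show ?thesis by simp
qed

lemma dLam_sing_tangent:
  assumes "v \<in> sing_tangent B \<phi> p"
  shows "frechet_derivative Lam (at x0) v = 0"
proof (rule constant_along_singular[OF assms W(1,2), of "\<lambda>q. Lam (snd c q)" 0])
  show "Lam (snd c q) = 0" if "q \<in> W" "q \<in> \<Sigma>" for q
    using singular_Lam[of "snd c q"] that by (simp add: \<Omega>_def)
  show "((\<lambda>x. Lam (snd c (\<xi> x))) has_derivative frechet_derivative Lam (at x0)) (at x0)"
    by (rule has_derivative_transform_within_open[OF smooth_on_has_derivative[OF smooth_Lam x0_\<Omega>] open_\<Omega> x0_\<Omega>])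
      (simp add: chart_\<xi>)
qed

lemma sing_tangent_if_dLam:
  assumes "Lam x0 = 0" "frechet_derivative Lam (at x0) k \<noteq> 0" "frechet_derivative Lam (at x0) v = 0"
  shows "v \<in> sing_tangent B \<phi> p"
proof -
  obtain s where s: "s 0 = 0" "((\<lambda>t. s t / t) \<longlongrightarrow> 0) (at 0)"
    "\<forall>\<^sub>F t in nhds 0. Lam (x0 + t *\<^sub>R v + s t *\<^sub>R k) = 0"
    by (rule zero_set_curve[OF open_\<Omega> x0_\<Omega> smooth_on_imp_continuous_on[OF smooth_Lam]
          smooth_on_has_derivative[OF smooth_Lam x0_\<Omega>] assms])
  let ?y = "\<lambda>t. x0 + t *\<^sub>R v + s t *\<^sub>R k" and ?\<gamma> = "\<lambda>t. \<xi> (x0 + t *\<^sub>R v + s t *\<^sub>R k)"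
  have ds: "(s has_real_derivative 0) (at 0)" using s(1,2) by (simp add: DERIV_def)
  have dy: "(?y has_vector_derivative v) (at 0)"
  proof -
    have "(?y has_vector_derivative (0 + (0 *\<^sub>R 0 + 1 *\<^sub>R v)) + (s 0 *\<^sub>R 0 + 0 *\<^sub>R k)) (at 0)"
      by (intro has_vector_derivative_add has_vector_derivative_scaleR has_vector_derivative_const DERIV_ident ds)
    then show ?thesis by simp
  qed
  then have cont: "isCont ?y 0" by (rule has_vector_derivative_continuous)
  have y0: "?y 0 = x0" using s(1) by simp
  have "(?y \<longlongrightarrow> ?y 0) (nhds 0)" using cont unfolding isCont_def by (rule tendsto_at_iff_tendsto_nhds[of ?y 0, THEN iffD1])
  then have ev: "\<forall>\<^sub>F t in nhds 0. ?y t \<in> \<Omega>"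
    by (rule topological_tendstoD[OF _ open_\<Omega>]) (simp only: y0 x0_\<Omega>)
  have "?\<gamma> 0 = p" by (simp only: y0 \<xi>_x0)
  moreover have "isCont ?\<gamma> 0" by (rule isCont_o2[OF cont]) (simp only: y0 isCont_\<xi>)
  moreover have "\<forall>\<^sub>F t in nhds 0. ?\<gamma> t \<in> \<Sigma>"
    using ev s(3) by eventually_elim (simp add: singular_Lam)
  moreover have "((\<lambda>t. snd c (?\<gamma> t)) has_vector_derivative v) (at 0)"
  proof -
    have "\<forall>\<^sub>F t in nhds 0. snd c (?\<gamma> t) = ?y t" using ev by eventually_elim (simp add: chart_\<xi>)
    note e = this
    have "((\<lambda>t. snd c (?\<gamma> t)) has_vector_derivative v) (at 0) \<longleftrightarrow> (?y has_vector_derivative v) (at 0)"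
      by (rule has_vector_derivative_cong_ev) (use e eventually_nhds_x_imp_x[OF e] in simp_all)
    with dy show ?thesis by blast
  qed
  ultimately show ?thesis unfolding tangent_to_def by (intro CollectI exI[of _ ?\<gamma>] conjI)
qed

end

text \<open>
  Transversality is given as not being a velocity of a curve in the singular set; by
  \<open>sing_tangent_if_dLam\<close> the differential of \<open>\<lambda>\<close> detects this.
\<close>

lemma (in front_chart) dlam_null_nonzero:
  assumes "nondegenerate B \<phi> p" "\<eta> p \<notin> sing_tangent B \<phi> p"
  shows "dlam B \<phi> p (\<eta> p) \<noteq> 0"
proof
  assume z: "dlam B \<phi> p (\<eta> p) = 0"
  obtain k where k: "p \<in> \<Sigma>" "dlam B \<phi> p k \<noteq> 0" using assms(1) unfolding nondegenerate_def by blast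
  have L0: "Lam x0 = 0" using k(1) singular_Lam[OF x0_\<Omega>] by simp
  have "0 < sqrt (det (gram F p))" using gram_pos[OF x0_\<Omega>] by simp
  then have "\<eta> p \<in> sing_tangent B \<phi> p"
    using k(2) z unfolding dlam_eq[OF L0] by (intro sing_tangent_if_dLam[OF L0, of k]) auto
  with assms(2) show False ..
qed

section \<open>Curvature near the singular point\<close>

locale front_A2 = front_chart B \<phi> \<psi> p U \<eta> F
  for B :: "('a::{t2_space,second_countable_topology}, 'e::real_vector, 'm::finite) bundle_data"
    and \<phi> \<psi> p U \<eta> F +
  assumes singular: "p \<in> singular_set B \<phi>" and transversal: "dlam B \<phi> p (\<eta> p) \<noteq> 0"
begin

lemma Lam_x0: "Lam x0 = 0"
  using singular singular_Lam[OF x0_\<Omega>] by simp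

sublocale A2_coords \<Omega> P Q g H x0
  using x0_\<Omega> Lam_x0 transversal dlam_eq[OF Lam_x0] by unfold_locales (auto simp: H_x0)

lemma forms_p:
  "first_form B \<phi> p X Y = I x0 X Y" "second_form B \<phi> \<psi> p X Y = II x0 X Y"
  using forms_tvec[OF x0_\<Omega>, of X Y] tvec_chart_at[of p] by simp_all

lemma II_vanishes_on_singular_set:
  assumes V: "open V" "p \<in> V" "V \<subseteq> W" and s: "s \<noteq> 0"
    and le: "\<And>\<kappa>. \<kappa> \<in> K_values B \<phi> \<psi> V \<Longrightarrow> M \<le> s * \<kappa>"
  obtains V' where "open V'" "x0 \<in> V'" "V' \<subseteq> \<Omega>" "V' \<subseteq> snd c ` V"
    "\<And>x v w. x \<in> V' \<Longrightarrow> Lam x = 0 \<Longrightarrow> II x v w = 0"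
proof
  \<comment> \<open>Transversality is an open condition, so the expansion applies at every singular point of \<open>?V'\<close>.\<close>
  let ?V' = "snd c ` V \<inter> {x \<in> \<Omega>. frechet_derivative Lam (at x) (H x) \<noteq> 0}"
  show op: "open ?V'" by (intro open_Int open_transversal open_image V)
  show "x0 \<in> ?V'" using V(2) x0_\<Omega> trans by (auto simp: x0_def)
  show "?V' \<subseteq> \<Omega>" "?V' \<subseteq> snd c ` V" by auto
  fix x v w assume x: "x \<in> ?V'" "Lam x = 0"
  show "II x v w = 0"
  proof (rule II_vanishes_at[OF op \<open>?V' \<subseteq> \<Omega>\<close> s _ x])
    fix x v w :: "real ^ 'm" assume x: "x \<in> ?V'" "Lam x \<noteq> 0" and ind: "lin_indep2 v w"
    then have "gram_det (II x) v w / gram_det (I x) v w \<in> K_values B \<phi> \<psi> V"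
      unfolding K_values_iff[OF V(3)] by blast
    from le[OF this] show "M * gram_det (I x) v w \<le> s * gram_det (II x) v w"
      using gram_det_I_pos[of x v w] x ind by (simp add: field_simps)
  qed (use x in auto)
qed

lemma second_form_vanishes:
  assumes "open V" "p \<in> V" "s \<noteq> 0" "\<And>\<kappa>. \<kappa> \<in> K_values B \<phi> \<psi> V \<Longrightarrow> M \<le> s * \<kappa>"
  shows "second_form B \<phi> \<psi> p X Y = 0"
proof -
  have le': "M \<le> s * \<kappa>" if "\<kappa> \<in> K_values B \<phi> \<psi> (V \<inter> W)" for \<kappa>
  proof (rule assms(4))
    show "\<kappa> \<in> K_values B \<phi> \<psi> V" using that unfolding K_values_def by blast
  qed
  obtain V' where "x0 \<in> V'" "\<And>x v w. x \<in> V' \<Longrightarrow> Lam x = 0 \<Longrightarrow> II x v w = 0"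
    by (rule II_vanishes_on_singular_set[of "V \<inter> W" s M]) (use assms W le' in auto)
  then show ?thesis unfolding forms_p using Lam_x0 by blast
qed

lemma K_bounded_nearby:
  assumes V: "open V" "p \<in> V" and s: "s \<noteq> 0" and le: "\<And>\<kappa>. \<kappa> \<in> K_values B \<phi> \<psi> V \<Longrightarrow> M \<le> s * \<kappa>"
  shows "\<exists>W'. open W' \<and> p \<in> W' \<and> W' \<subseteq> V \<and> bounded (K_values B \<phi> \<psi> W')"
proof -
  have le': "M \<le> s * \<kappa>" if "\<kappa> \<in> K_values B \<phi> \<psi> (V \<inter> W)" for \<kappa>
  proof (rule le)
    show "\<kappa> \<in> K_values B \<phi> \<psi> V" using that unfolding K_values_def by blast
  qed
  obtain V' where V': "open V'" "x0 \<in> V'" "V' \<subseteq> \<Omega>" "V' \<subseteq> snd c ` (V \<inter> W)"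
    "\<And>x v w. x \<in> V' \<Longrightarrow> Lam x = 0 \<Longrightarrow> II x v w = 0"
    by (rule II_vanishes_on_singular_set[of "V \<inter> W" s M]) (use assms W le' in auto)
  obtain M' where M': "\<forall>\<^sub>F x in nhds x0. Lam x \<noteq> 0 \<longrightarrow>
    (\<forall>v w. lin_indep2 v w \<longrightarrow> \<bar>gram_det (II x) v w\<bar> \<le> M' * gram_det (I x) v w)"
    using curvature_bounded[OF V'(1-3,5)] by blast
  then obtain N where N: "open N" "x0 \<in> N" "\<And>x v w. x \<in> N \<Longrightarrow> Lam x \<noteq> 0 \<Longrightarrow> lin_indep2 v w \<Longrightarrow>
      \<bar>gram_det (II x) v w\<bar> \<le> M' * gram_det (I x) v w"
    unfolding eventually_nhds by blast
  let ?W' = "W \<inter> snd c -` (N \<inter> V')"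
  have "open ?W'"
    by (rule continuous_open_preimage[OF continuous_on_subset[OF chart_cont[OF c_in]]])
      (use W N V' in auto)
  moreover have "p \<in> ?W'" using W(2) N(2) V'(2) by (simp add: x0_def)
  moreover have "?W' \<subseteq> V"
  proof
    fix q assume q: "q \<in> ?W'"
    then obtain r where "r \<in> V \<inter> W" "snd c q = snd c r" using V'(4) by blast
    then show "q \<in> V" using \<xi>_chart[of q] \<xi>_chart[of r] q by auto
  qed
  moreover have "\<bar>\<kappa>\<bar> \<le> M'" if "\<kappa> \<in> K_values B \<phi> \<psi> ?W'" for \<kappa>
  proof -
    from that[unfolded K_values_iff[OF Int_lower1]]
    obtain x v w where x: "x \<in> snd c ` ?W'" "Lam x \<noteq> 0" "lin_indep2 v w" "\<kappa> = gram_det (II x) v w / gram_det (I x) v w"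
      by (elim exE conjE)
    then have "0 < gram_det (I x) v w" using V'(3) by (intro gram_det_I_pos) auto
    then show ?thesis using N(3)[of x v w] x by (auto simp: abs_divide divide_le_eq)
  qed
  ultimately show ?thesis unfolding bounded_iff by (intro exI[of _ ?W']) auto
qed

lemma smooth_sec_W:
  "smooth_sec B W (\<lambda>q. \<phi> q (\<eta> q))" "smooth_sec B W (\<lambda>q. \<psi> q (\<eta> q))"
  "smooth_sec B W (\<lambda>q. \<phi> q (tvec A c q v))" "smooth_sec B W (\<lambda>q. \<psi> q (tvec A c q v))"
  by (intro hom_smooth W(1) smooth_\<eta> smooth_tvec)+

lemma connections: "connection B" "metric_connection B"
  using coherent(1) unfolding coherent_tangent_bundle_def metric_connection_def by auto

lemma connection_in_fibre:
  assumes "open V" "p \<in> V" "smooth_sec B V s"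
  shows "Conn B p v s \<in> Fibre B p"
proof -
  let ?V = "V \<inter> fst c"
  have o: "open ?V" using assms(1) open_chart[OF c_in] by auto
  have "smooth_sec B ?V (\<lambda>q. Conn B q (tvec A c q v) s)"
    by (rule connections(1)[unfolded connection_def, THEN conjunct1, rule_format, OF o
          smooth_sec_subset[OF assms(3)] smooth_vf_tvec[OF c_in o]]) auto
  then have "Conn B p (tvec A c p v) s \<in> Fibre B p" using assms(2) p_c by (auto simp: smooth_sec_def)
  then show ?thesis by (simp add: tvec_chart_at)
qed

lemma metric_derivative:
  assumes "open V" "p \<in> V" "smooth_sec B V s" "smooth_sec B V t"
  shows "frechet_derivative (\<lambda>x. Inner B (\<xi> x) (s (\<xi> x)) (t (\<xi> x))) (at x0) v
    = Inner B p (Conn B p v s) (t p) + Inner B p (s p) (Conn B p v t)"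
  using connections(2)[unfolded metric_connection_def, THEN conjunct2, rule_format, OF assms(1,3,4,2)]
  by (simp only: dfun_p)

text \<open>
  For fields \<open>s\<close>, \<open>t\<close> given near \<open>p\<close>, relations between them that hold along the singular set may be
  differentiated in tangential directions.
\<close>

lemma inner_constant_along_singular:
  assumes V: "open V" "p \<in> V" and st: "smooth_sec B V s" "smooth_sec B V t"
    and v: "v \<in> sing_tangent B \<phi> p" and const: "\<And>q. q \<in> V \<Longrightarrow> q \<in> \<Sigma> \<Longrightarrow> Inner B q (s q) (t q) = k"
  shows "Inner B p (Conn B p v s) (t p) + Inner B p (s p) (Conn B p v t) = 0"
proof -
  let ?V = "V \<inter> fst c"
  have o: "open ?V" using V(1) open_chart[OF c_in] by auto
  have "smooth_on (snd c ` ?V) (\<lambda>x. Inner B (\<xi> x) (s (\<xi> x)) (t (\<xi> x)))"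
    by (rule smooth_fun_chart[OF smooth_inner_sec[OF o] c_in]) (use st smooth_sec_subset in auto)
  then have "((\<lambda>x. Inner B (\<xi> x) (s (\<xi> x)) (t (\<xi> x))) has_derivative
      frechet_derivative (\<lambda>x. Inner B (\<xi> x) (s (\<xi> x)) (t (\<xi> x))) (at x0)) (at x0)"
    by (rule smooth_on_has_derivative) (use V(2) p_c in \<open>auto simp: x0_def\<close>)
  from constant_along_singular[OF v V const this] show ?thesis
    unfolding metric_derivative[OF V st] by blast
qed

lemma torsion_free:
  assumes "coherent_tangent_bundle B \<theta>"
  shows "Conn B p v (\<lambda>q. \<theta> q (\<eta> q)) - Conn B p (\<eta> p) (\<lambda>q. \<theta> q (tvec A c q v))
    = \<theta> p (lie_bracket A (\<lambda>q. tvec A c q v) \<eta> p)"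
proof -
  have "\<forall>U X Y. open U \<longrightarrow> smooth_vf A U X \<longrightarrow> smooth_vf A U Y \<longrightarrow>
        (\<forall>q\<in>U. Conn B q (X q) (\<lambda>r. \<theta> r (Y r)) - Conn B q (Y q) (\<lambda>r. \<theta> r (X r))
                - \<theta> q (lie_bracket A X Y q) = 0)"
    using assms by (auto simp: coherent_tangent_bundle_def simp del: split_paired_All)
  from this[rule_format, OF W(1) smooth_tvec smooth_\<eta> W(2)] show ?thesis
    by (simp add: tvec_chart_at)
qed

lemma null_on_singular: "q \<in> W \<Longrightarrow> q \<in> \<Sigma> \<Longrightarrow> \<phi> q (\<eta> q) = 0"
  using null_\<eta> W(3) unfolding null_vf_def by blast

text \<open>
  Let \<open>Z = [v, \<eta>]\<close>.  As \<open>\<phi>(\<eta>)\<close> vanishes along the singular set, \<open>D\<^sub>v \<phi>(\<eta>) = 0\<close>, so the torsion-free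
  conditions read \<open>D\<^sub>h \<phi>(v) = - \<phi>(Z)\<close> and \<open>D\<^sub>h \<psi>(v) = D\<^sub>v \<psi>(\<eta>) - \<psi>(Z)\<close>.  The terms with \<open>Z\<close> are values of \<open>II\<close>
  at \<open>p\<close> and drop out; there remains \<open>- \<langle>\<phi>(v), D\<^sub>v \<psi>(\<eta>)\<rangle>\<close>, which equals \<open>\<langle>D\<^sub>v \<phi>(v), \<psi>(\<eta>)\<rangle>\<close> since
  \<open>\<langle>\<phi>(v), \<psi>(\<eta>)\<rangle> = \<langle>\<phi>(\<eta>), \<psi>(v)\<rangle>\<close> vanishes along the singular set.
\<close>

lemma derivative_II_along_null:
  assumes v: "v \<in> sing_tangent B \<phi> p" and II0: "\<And>X Y. II x0 X Y = 0"
  shows "frechet_derivative (\<lambda>x. II x v v) (at x0) h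
    = Inner B p (Conn B p v (\<lambda>q. \<phi> q (tvec A c q v))) (\<psi> p (\<eta> p))"
proof -
  let ?s1 = "\<lambda>q. \<phi> q (\<eta> q)" and ?t1 = "\<lambda>q. \<psi> q (\<eta> q)"
    and ?s2 = "\<lambda>q. \<phi> q (tvec A c q v)" and ?t2 = "\<lambda>q. \<psi> q (tvec A c q v)"
  let ?Z = "lie_bracket A (\<lambda>q. tvec A c q v) \<eta> p"
  note fib = connection_in_fibre[OF W(1,2)] in_fibre
  have tv: "tvec A c p v = v" by (rule tvec_chart_at)
  have second: "Inner B p (\<phi> p X) (\<psi> p Y) = 0" for X Y
    using forms_p(2)[of X Y] II0 by (simp add: second_form_def)
  \<comment> \<open>A section that vanishes along the singular set has no derivative in tangential directions; this is
    tested against the frame.\<close>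
  have D1: "Conn B p v ?s1 = 0"
  proof -
    let ?a = "frame_comp F p (Conn B p v ?s1)"
    have y: "frame_vec F p ?a = Conn B p v ?s1"
      by (rule frame_vec_frame_comp[OF F p_F fib(1)[OF smooth_sec_W(1)]])
    have Fi: "snd F i q \<in> Fibre B q" if "q \<in> W" for i q
      using smooth_sec_frame[OF F W(5), of i] that by (simp add: smooth_sec_def)
    have "Inner B p (Conn B p v ?s1) (snd F i p) = 0" for i
    proof -
      have "Inner B p (Conn B p v ?s1) (snd F i p) + Inner B p (?s1 p) (Conn B p v (snd F i)) = 0"
      proof (rule inner_constant_along_singular[OF W(1,2) smooth_sec_W(1) smooth_sec_frame[OF F W(5)] v])
        show "Inner B q (?s1 q) (snd F i q) = 0" if "q \<in> W" "q \<in> \<Sigma>" for q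
          using null_on_singular[OF that] Fi[OF that(1)] inner_zero by simp
      qed
      moreover have "Inner B p (?s1 p) (Conn B p v (snd F i)) = 0"
        using null_on_singular[OF W(2) singular] inner_zero(1)[OF fib(1)[OF smooth_sec_frame[OF F W(5)]]] by simp
      ultimately show ?thesis by simp
    qed
    then have "Inner B p (\<Sum>i\<in>UNIV. (?a $ i) *\<^sub>R snd F i p) (Conn B p v ?s1) = 0"
      using Fi[OF W(2)] fib(1)[OF smooth_sec_W(1)] inner_sym by (subst inner_sum_left) auto
    then have "Inner B p (Conn B p v ?s1) (Conn B p v ?s1) = 0"
      using y by (simp add: frame_vec_def)
    then show ?thesis
      using inner_pos[OF fib(1)[OF smooth_sec_W(1)] fib(1)[OF smooth_sec_W(1)]] by (metis less_irrefl)
  qed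
  have Dh: "Conn B p (\<eta> p) ?s2 = - \<phi> p ?Z" "Conn B p (\<eta> p) ?t2 = Conn B p v ?t1 - \<psi> p ?Z"
    using coherent[THEN torsion_free, of v, symmetric] D1 by simp_all
  have "0 = Inner B p (Conn B p v ?s2) (?t1 p) + Inner B p (?s2 p) (Conn B p v ?t1)"
  proof (rule inner_constant_along_singular[OF W(1,2) smooth_sec_W(3,2) v, symmetric])
    show "Inner B q (?s2 q) (?t1 q) = 0" if "q \<in> W" "q \<in> \<Sigma>" for q
      using symmetric[of q "tvec A c q v" "\<eta> q"] null_on_singular[OF that] inner_zero in_fibre by simp
  qed
  then have leib: "Inner B p (\<phi> p v) (Conn B p v ?t1) = - Inner B p (Conn B p v ?s2) (?t1 p)" by (simp add: tv)
  have "frechet_derivative (\<lambda>x. II x v v) (at x0) h = - frechet_derivative (\<lambda>x. Inner B (\<xi> x) (?s2 (\<xi> x)) (?t2 (\<xi> x))) (at x0) (\<eta> p)"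
  proof -
    have "((\<lambda>x. II x v v) has_derivative frechet_derivative (\<lambda>x. II x v v) (at x0)) (at x0)"
      by (rule smooth_on_has_derivative[OF smooth_II x0_\<Omega>])
    from has_derivative_minus[OF this]
    have "((\<lambda>x. Inner B (\<xi> x) (?s2 (\<xi> x)) (?t2 (\<xi> x))) has_derivative (\<lambda>u. - frechet_derivative (\<lambda>x. II x v v) (at x0) u)) (at x0)"
      by (rule has_derivative_transform_within_open[OF _ open_\<Omega> x0_\<Omega>])
        (simp add: forms_tvec(2)[symmetric] second_form_def)
    from fun_cong[OF frechet_derivative_at[OF this], of h] show ?thesis by (simp add: H_x0)
  qed
  also have "\<dots> = - (Inner B p (- \<phi> p ?Z) (\<psi> p v) + Inner B p (\<phi> p v) (Conn B p v ?t1 - \<psi> p ?Z))"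
    unfolding metric_derivative[OF W(1,2) smooth_sec_W(3,4)] Dh tv ..
  also have "\<dots> = - Inner B p (\<phi> p v) (Conn B p v ?t1)"
    using inner_scale_left[of "\<phi> p ?Z" p "\<psi> p v" "-1"] second fib(2,3)
      inner_diff_right[OF fib(1)[OF smooth_sec_W(2)] fib(3) fib(2)] by simp
  finally show ?thesis using leib by simp
qed

text \<open>
  Differentiating \<open>\<langle>n, \<phi>(v)\<rangle> = 0\<close> along the singular set gives \<open>\<kappa> I(v, v) = sgn (d\<lambda>(\<eta>')) \<langle>n, D\<^sub>v \<phi>(v)\<rangle>\<close>, and
  the sign is that of \<open>\<langle>\<alpha>, n\<rangle>\<close> by \<open>derivative_Lam_null\<close> for the adapted frame.  With \<open>\<psi>(h) = \<tau> n\<close> the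
  inequality of \<open>second_order_bound\<close> becomes \<open>\<tau>\<^sup>2 \<langle>\<alpha>, n\<rangle> \<langle>n, D\<^sub>v \<phi>(v)\<rangle> \<le> - \<delta> D0\<close>.
\<close>

lemma principal_curvature_sign:
  assumes \<delta>: "0 \<le> \<delta>" and hyp: "\<And>v. lin_indep2 v h \<Longrightarrow>
      \<forall>\<^sub>F t in at 0. \<delta> * den v t \<le> num v t"
    and \<kappa>: "singular_principal_curvature B \<phi> p \<kappa>"
  shows "\<kappa> \<le> 0" "0 < \<delta> \<Longrightarrow> \<kappa> < 0"
proof -
  obtain U' k e n \<eta>' v where p_U': "p \<in> U'" and adapted: "adapted_frame B \<phi> U' k e n \<eta>'"
    and v: "v \<in> sing_tangent B \<phi> p" "v \<noteq> 0" and eigen: "singular_shape B \<phi> p n \<eta>' v = \<kappa> *\<^sub>R v"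
    using \<kappa> unfolding singular_principal_curvature_def by blast
  have U': "open U'" "smooth_sec B U' n" "null_vf B \<phi> U' \<eta>'"
    and at: "\<And>q. q \<in> U' \<Longrightarrow> q \<in> \<Sigma> \<Longrightarrow> (\<forall>i. i \<noteq> k \<longrightarrow> e i q \<in> sing_tangent B \<phi> q) \<and>
      positive_orthonormal B q (\<lambda>i. if i = k then n q else \<phi> q (e i q)) \<and>
      0 < det (\<chi> i. if i = k then \<eta>' q else e i q)"
    using adapted unfolding adapted_frame_def by blast+
  have ortho: "Inner B q (n q) (n q) = 1" "i \<noteq> k \<Longrightarrow> Inner B q (\<phi> q (e i q)) (n q) = 0" "n q \<in> Fibre B q"
    if "q \<in> U'" "q \<in> \<Sigma>" for q i
  proof -
    have o: "\<forall>i. (if i = k then n q else \<phi> q (e i q)) \<in> Fibre B q"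
      "\<forall>i j. Inner B q (if i = k then n q else \<phi> q (e i q)) (if j = k then n q else \<phi> q (e j q)) = (if i = j then 1 else 0)"
      using at[OF that] unfolding positive_orthonormal_def by blast+
    show "Inner B q (n q) (n q) = 1" using o(2)[rule_format, of k k] by simp
    show "Inner B q (\<phi> q (e i q)) (n q) = 0" if "i \<noteq> k" using o(2)[rule_format, of i k] that by simp
    show "n q \<in> Fibre B q" using o(1)[rule_format, of k] by simp
  qed
  have normal: "Inner B q (n q) (\<phi> q X) = 0" if q: "q \<in> U'" "q \<in> \<Sigma>" for q X
  proof -
    have "det (\<chi> i. if i = k then \<eta>' q else e i q) \<noteq> 0" using at[OF q] by simp
    then obtain a where a: "X = (\<Sum>i\<in>UNIV. (a $ i) *\<^sub>R (if i = k then \<eta>' q else e i q))" by (rule rows_span)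
    have "\<phi> q (\<eta>' q) = 0" using U'(3) q unfolding null_vf_def by blast
    have "\<phi> q X = (\<Sum>i\<in>UNIV. (a $ i) *\<^sub>R \<phi> q (if i = k then \<eta>' q else e i q))"
      unfolding a by (simp add: linear_sum[OF linear_\<phi>(1)] linear_scale[OF linear_\<phi>(1)])
    then have "Inner B q (\<phi> q X) (n q) = (\<Sum>i\<in>UNIV. a $ i * Inner B q (\<phi> q (if i = k then \<eta>' q else e i q)) (n q))"
      using inner_sum_left[of UNIV "\<lambda>i. \<phi> q (if i = k then \<eta>' q else e i q)" q "n q" "\<lambda>i. a $ i"] in_fibre ortho[OF q] by simp
    also have "\<dots> = 0"
      using \<open>\<phi> q (\<eta>' q) = 0\<close> inner_zero(1)[OF ortho(3)[OF q]] ortho(2)[OF q] by (intro sum.neutral) auto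
    finally show ?thesis using inner_sym[OF ortho(3)[OF q] in_fibre(1)] by simp
  qed
  note p\<Sigma> = p_U' singular
  define T where "T = sing_tangent B \<phi> p"
  define \<nu> where "\<nu> = frame_comp F p (n p)"
  have n_fib: "n p \<in> Fibre B p" by (rule ortho(3)[OF p\<Sigma>])
  have n_\<nu>: "frame_vec F p \<nu> = n p" unfolding \<nu>_def by (rule frame_vec_frame_comp[OF F p_F n_fib])
  have g_p: "g x0 a b = Inner B p (frame_vec F p a) (frame_vec F p b)" for a b by (simp add: g_def)
  have P_p: "frame_vec F p (P x0 X) = \<phi> p X" "frame_vec F p (Q x0 X) = \<psi> p X"
    "P x0 X = frame_comp F p (\<phi> p X)" for X
    using \<phi>_tvec[OF x0_\<Omega>, of X] by (simp_all add: tvec_chart_at P_def)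
  have b_fib: "(if i = k then n p else \<phi> p (e i p)) \<in> Fibre B p" for i using n_fib in_fibre by auto
  \<comment> \<open>Components of the adapted orthonormal frame.  They are rows of a matrix, so that positivity of the
    frame and \<open>derivative_Lam_null\<close> concern the same determinants.\<close>
  define R where "R i = (if i = k then \<nu> else P x0 (e i p))" for i
  have det_R: "0 < det (\<chi> i. R i)"
  proof -
    obtain G where G: "G \<in> Frames B" "p \<in> fst G" "0 < det (\<chi> i. frame_comp G p (if i = k then n p else \<phi> p (e i p)))"
      using at[OF p\<Sigma>] unfolding positive_orthonormal_def by blast
    then have "0 < det (\<chi> i. frame_comp F p (if i = k then n p else \<phi> p (e i p)))"
      using det_frame_change[OF F p_F G(1,2), of "\<lambda>i. if i = k then n p else \<phi> p (e i p)"] b_fib by simp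
    moreover have "frame_comp F p (if i = k then n p else \<phi> p (e i p)) = R i" for i
      by (simp add: R_def \<nu>_def P_p(3))
    ultimately show ?thesis by simp
  qed
  have \<nu>\<nu>: "g x0 \<nu> \<nu> = 1" unfolding g_p n_\<nu> by (rule ortho(1)[OF p\<Sigma>])
  have P\<nu>: "g x0 (P x0 X) \<nu> = 0" for X
    unfolding g_p n_\<nu> P_p(1) using normal[OF p\<Sigma>] inner_sym[OF n_fib in_fibre(1)] by simp
  have bil: "bilinear (g x0)" by (rule bilinear_g[OF x0_\<Omega>])
  have coef: "a $ k = g x0 (\<Sum>i\<in>UNIV. (a $ i) *\<^sub>R R i) \<nu>" for a
  proof -
    have lin: "linear (\<lambda>b. g x0 b \<nu>)" using bil by (simp add: bilinear_def)
    have "g x0 (\<Sum>i\<in>UNIV. (a $ i) *\<^sub>R R i) \<nu> = (\<Sum>i\<in>UNIV. a $ i * g x0 (R i) \<nu>)"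
      by (simp add: linear_sum[OF lin] linear_scale[OF lin])
    also have "\<dots> = (\<Sum>i\<in>UNIV. if i = k then a $ i else 0)"
      by (intro sum.cong) (auto simp: R_def \<nu>\<nu> P\<nu>)
    finally show ?thesis by simp
  qed
  \<comment> \<open>This ensures that \<open>inv_into\<close> in the singular shape operator is applied to a vector of the image.\<close>
  have tangent_image: "y \<in> \<phi> p ` T" if y: "y \<in> Fibre B p" "Inner B p y (n p) = 0" for y
  proof -
    obtain a where a: "frame_comp F p y = (\<Sum>i\<in>UNIV. (a $ i) *\<^sub>R R i)"
      by (rule rows_span[of R]) (use det_R in auto)
    have y': "frame_vec F p (frame_comp F p y) = y" by (rule frame_vec_frame_comp[OF F p_F y(1)])
    have "a $ k = 0" using coef[of a] y y' unfolding a[symmetric] g_p n_\<nu> by simp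
    define X where "X = (\<Sum>i\<in>UNIV. (a $ i) *\<^sub>R (if i = k then 0 else e i p))"
    have "P x0 X = (\<Sum>i\<in>UNIV. (a $ i) *\<^sub>R P x0 (if i = k then 0 else e i p))"
      unfolding X_def by (simp add: linear_sum[OF linear_P[OF x0_\<Omega>]] linear_scale[OF linear_P[OF x0_\<Omega>]])
    also have "\<dots> = (\<Sum>i\<in>UNIV. (a $ i) *\<^sub>R R i)"
      using \<open>a $ k = 0\<close> by (intro sum.cong) (auto simp: R_def)
    finally have "\<phi> p X = y" using y' a P_p(1)[of X] by simp
    moreover have "X \<in> T" unfolding T_def
    proof (rule sing_tangent_if_dLam[OF Lam_x0 trans])
      note lin = linear_dLam[OF x0_\<Omega>]
      have "frechet_derivative Lam (at x0) (if i = k then 0 else e i p) = 0" for i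
        using at[OF p\<Sigma>] dLam_sing_tangent linear_0[OF lin] by simp
      then show "frechet_derivative Lam (at x0) X = 0"
        unfolding X_def by (simp add: linear_sum[OF lin] linear_scale[OF lin])
    qed
    ultimately show ?thesis by blast
  qed
  let ?Dn = "Conn B p v n" and ?Ds = "Conn B p v (\<lambda>q. \<phi> q (tvec A c q v))"
  have Dn_fib: "?Dn \<in> Fibre B p" by (rule connection_in_fibre[OF U'(1) p_U' U'(2)])
  have Ds_fib: "?Ds \<in> Fibre B p" by (rule connection_in_fibre[OF W(1,2) smooth_sec_W(3)])
  have "Inner B p ?Dn (n p) + Inner B p (n p) ?Dn = 0"
    by (rule inner_constant_along_singular[OF U'(1) p_U' U'(2,2) v(1)]) (rule ortho(1))
  then have "Inner B p ?Dn (n p) = 0" using inner_sym[OF Dn_fib n_fib] by simp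
  then have "?Dn \<in> \<phi> p ` T" by (rule tangent_image[OF Dn_fib])
  then have "\<phi> p (inv_into T (\<phi> p) ?Dn) = ?Dn" by (rule f_inv_into_f)
  moreover have "\<phi> p (\<kappa> *\<^sub>R v) = - (sgn (dlam B \<phi> p (\<eta>' p)) *\<^sub>R \<phi> p (inv_into T (\<phi> p) ?Dn))"
    unfolding eigen[symmetric] singular_shape_def T_def[symmetric]
    by (simp add: linear_neg[OF linear_\<phi>(1)] linear_scale[OF linear_\<phi>(1)])
  ultimately have shape: "\<kappa> *\<^sub>R \<phi> p v = (- sgn (dlam B \<phi> p (\<eta>' p))) *\<^sub>R ?Dn"
    by (simp add: linear_scale[OF linear_\<phi>(1)])
  have "Inner B p ?Dn (\<phi> p (tvec A c p v)) + Inner B p (n p) ?Ds = 0"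
  proof (rule inner_constant_along_singular[of "U' \<inter> W", OF _ _ _ _ v(1)])
    show "smooth_sec B (U' \<inter> W) n" "smooth_sec B (U' \<inter> W) (\<lambda>q. \<phi> q (tvec A c q v))"
      using smooth_sec_subset U'(2) smooth_sec_W(3) by (metis inf_le1, metis inf_le2)
    show "Inner B q (n q) (\<phi> q (tvec A c q v)) = 0" if "q \<in> U' \<inter> W" "q \<in> \<Sigma>" for q
      using normal that by blast
  qed (use U'(1) W p_U' in auto)
  then have weingarten: "Inner B p ?Dn (\<phi> p v) = - Inner B p (n p) ?Ds" by (simp add: tvec_chart_at)
  have "Inner B p (\<kappa> *\<^sub>R \<phi> p v) (\<phi> p v) = - sgn (dlam B \<phi> p (\<eta>' p)) * Inner B p ?Dn (\<phi> p v)"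
    unfolding shape by (rule inner_scale_left[OF Dn_fib in_fibre(1)])
  then have curv: "\<kappa> * I x0 v v = sgn (dlam B \<phi> p (\<eta>' p)) * Inner B p (n p) ?Ds"
    using inner_scale_left[OF in_fibre(1) in_fibre(1), of p \<kappa> v v] weingarten
    by (simp add: forms_p(1)[symmetric] first_form_def)
  \<comment> \<open>The null field of the adapted frame need not be \<open>\<eta>\<close>.  At \<open>p\<close> the two differ by a factor \<open>\<rho>\<close>, which
    enters both the derivative of \<open>\<lambda>\<close> and the orientation of the frame, so its sign cancels.\<close>
  have \<eta>': "\<eta>' p \<noteq> 0" "\<phi> p (\<eta>' p) = 0" using U'(3) p\<Sigma> unfolding null_vf_def by blast+
  then have "P x0 (\<eta>' p) = 0" unfolding P_p(3) using frame_comp_frame_vec[OF F p_F, of 0] linear_0[OF linear_frame_vec] by metis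
  then obtain \<rho> where \<rho>: "\<eta>' p = \<rho> *\<^sub>R h" by (rule kernel_null_line)
  have sgn_eq: "sgn (dlam B \<phi> p (\<eta>' p)) = sgn (g x0 \<alpha> \<nu>)"
  proof -
    let ?L = "frechet_derivative Lam (at x0) h"
    have dl: "dlam B \<phi> p (\<eta>' p) = sqrt (det (gram F p)) * (\<rho> * ?L)"
      unfolding dlam_eq[OF Lam_x0] \<rho> by (simp add: linear_scale[OF linear_dLam[OF x0_\<Omega>]])
    obtain a where a: "\<alpha> = (\<Sum>i\<in>UNIV. (a $ i) *\<^sub>R R i)" by (rule rows_span[of R]) (use det_R in auto)
    have "det (\<chi> i. if i = k then \<alpha> else P x0 (e i p)) = det (\<chi> i. if i = k then (\<Sum>j\<in>UNIV. a $ j *s row j (\<chi> i. R i)) else row i (\<chi> i. R i))"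
      by (simp add: a row_def R_def scalar_mult_eq_scaleR cong: if_cong)
    also have "\<dots> = a $ k * det (\<chi> i. R i)" by (rule cramer_lemma_transpose)
    also have "a $ k = g x0 \<alpha> \<nu>" unfolding a by (rule coef)
    finally have 1: "?L * det (\<chi> i. if i = k then h else e i p) = g x0 \<alpha> \<nu> * det (\<chi> i. R i)"
      using derivative_Lam_null[of k "\<lambda>i. e i p"] by simp
    have 2: "0 < \<rho> * det (\<chi> i. if i = k then h else e i p)"
      using at[OF p\<Sigma>] det_row_mul[of k \<rho> "\<lambda>_. h" "\<lambda>i. e i p"] unfolding \<rho> by (simp add: scalar_mult_eq_scaleR cong: if_cong)
    have 3: "(\<rho> * ?L) * (\<rho> * det (\<chi> i. if i = k then h else e i p)) = (\<rho>\<^sup>2 * det (\<chi> i. R i)) * g x0 \<alpha> \<nu>"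
      using 1 by (simp add: power2_eq_square algebra_simps)
    have 4: "0 < \<rho>\<^sup>2 * det (\<chi> i. R i)"
    proof (rule mult_pos_pos[OF _ det_R])
      show "0 < \<rho>\<^sup>2" using 2 by auto
    qed
    have "sgn (\<rho> * ?L) * sgn (\<rho> * det (\<chi> i. if i = k then h else e i p)) = sgn (\<rho>\<^sup>2 * det (\<chi> i. R i)) * sgn (g x0 \<alpha> \<nu>)"
      by (simp only: sgn_mult[symmetric] 3)
    then have "sgn (\<rho> * ?L) = sgn (g x0 \<alpha> \<nu>)"
      by (simp only: sgn_pos[OF 2] sgn_pos[OF 4] mult_1 mult_1_right)
    moreover have "0 < sqrt (det (gram F p))" using gram_pos[OF x0_\<Omega>] by simp
    ultimately show ?thesis unfolding dl by (simp add: sgn_mult)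
  qed
  \<comment> \<open>\<open>Q x0 h\<close> is orthogonal to the image of \<open>P x0\<close>, hence to all rows of \<open>R\<close> but the normal.\<close>
  define \<tau> where "\<tau> = g x0 (Q x0 h) \<nu>"
  have Qh: "Q x0 h = \<tau> *\<^sub>R \<nu>"
  proof -
    obtain a where a: "Q x0 h - \<tau> *\<^sub>R \<nu> = (\<Sum>i\<in>UNIV. (a $ i) *\<^sub>R R i)" by (rule rows_span[of R]) (use det_R in auto)
    let ?y = "Q x0 h - \<tau> *\<^sub>R \<nu>"
    have lin: "linear (\<lambda>b. g x0 b ?y)" using bil by (simp add: bilinear_def)
    have "g x0 \<nu> ?y = 0"
      by (simp add: bilinear_rsub[OF bil] bilinear_rmul[OF bil] \<nu>\<nu> \<tau>_def g_sym[OF x0_\<Omega>, of \<nu> "Q x0 h"])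
    moreover have "g x0 (P x0 X) ?y = 0" for X
      by (simp add: bilinear_rsub[OF bil] bilinear_rmul[OF bil] image_orthogonal P\<nu>)
    ultimately have "g x0 (R i) ?y = 0" for i by (simp add: R_def)
    then have "g x0 ?y ?y = 0" by (subst (1) a) (simp add: linear_sum[OF lin] linear_scale[OF lin])
    then have "?y = 0" using g_pos[OF x0_\<Omega>, of ?y] by (metis less_irrefl)
    then show ?thesis by simp
  qed
  have "\<tau> \<noteq> 0" using alpha_transversal Qh by (metis bilinear_rzero[OF bil] scaleR_zero_left)
  have II0: "II x0 X Y = 0" for X Y
    by (rule II_vanishes[of 1 \<delta>]) (use hyp in auto)
  have ind: "lin_indep2 v h"
    unfolding lin_indep2_iff_not_multiple[OF h_nz]
  proof (intro allI notI)
    fix r assume r: "v = r *\<^sub>R h"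
    have "r * frechet_derivative Lam (at x0) h = 0"
      using dLam_sing_tangent[OF v(1)] by (simp add: r linear_scale[OF linear_dLam[OF x0_\<Omega>]])
    then show False using trans v(2) r by simp
  qed
  have "P x0 v \<noteq> 0" using kernel_null_line[of v] ind lin_indep2_iff_not_multiple[OF h_nz] by metis
  then have I_pos: "0 < I x0 v v" unfolding I_def by (rule g_pos[OF x0_\<Omega>])
  let ?b = "Inner B p (n p) ?Ds"
  have "frechet_derivative (\<lambda>x. II x v v) (at x0) h = Inner B p ?Ds (frame_vec F p (\<tau> *\<^sub>R \<nu>))"
    unfolding Qh[symmetric] P_p(2) H_x0 using derivative_II_along_null[OF v(1) II0] by (simp add: H_x0)
  also have "\<dots> = \<tau> * ?b"
    using inner_scale_right[OF n_fib Ds_fib] inner_sym[OF n_fib Ds_fib]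
    by (simp add: linear_scale[OF linear_frame_vec] n_\<nu>)
  finally have "\<delta> * D0 v + (g x0 \<alpha> (Q x0 v))\<^sup>2 \<le> - (\<tau> * ?b) * (\<tau> * g x0 \<alpha> \<nu>)"
    using second_order_bound[OF II0 hyp[OF ind]] by (simp add: Qh bilinear_rmul[OF bil])
  then have "\<delta> * D0 v \<le> - (\<tau> * ?b) * (\<tau> * g x0 \<alpha> \<nu>)"
    using zero_le_power2[of "g x0 \<alpha> (Q x0 v)"] by linarith
  then have main: "\<tau>\<^sup>2 * (g x0 \<alpha> \<nu> * ?b) \<le> - (\<delta> * D0 v)"
    by (simp add: power2_eq_square algebra_simps)
  have "g x0 \<alpha> \<nu> \<noteq> 0" using alpha_transversal unfolding Qh by (simp add: bilinear_rmul[OF bil])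
  have "\<kappa> * (\<tau>\<^sup>2 * (I x0 v v * \<bar>g x0 \<alpha> \<nu>\<bar>)) = \<tau>\<^sup>2 * ((\<kappa> * I x0 v v) * \<bar>g x0 \<alpha> \<nu>\<bar>)"
    by (simp only: mult_ac)
  also have "\<dots> = \<tau>\<^sup>2 * ((sgn (g x0 \<alpha> \<nu>) * ?b) * \<bar>g x0 \<alpha> \<nu>\<bar>)"
    by (simp only: curv sgn_eq)
  also have "\<dots> = \<tau>\<^sup>2 * ((sgn (g x0 \<alpha> \<nu>) * \<bar>g x0 \<alpha> \<nu>\<bar>) * ?b)"
    by (simp only: mult_ac)
  also have "\<dots> = \<tau>\<^sup>2 * (g x0 \<alpha> \<nu> * ?b)" by (simp add: sgn_mult_abs)
  finally have fin: "\<kappa> * (\<tau>\<^sup>2 * (I x0 v v * \<bar>g x0 \<alpha> \<nu>\<bar>)) \<le> - (\<delta> * D0 v)" using main by linarith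
  define E where "E = \<tau>\<^sup>2 * (I x0 v v * \<bar>g x0 \<alpha> \<nu>\<bar>)"
  have pos: "0 < E" using \<open>\<tau> \<noteq> 0\<close> I_pos \<open>g x0 \<alpha> \<nu> \<noteq> 0\<close> by (simp add: E_def)
  have fin': "\<kappa> * E \<le> - (\<delta> * D0 v)" using fin by (simp only: E_def)
  have D0: "0 < D0 v" by (rule D0_pos[OF ind])
  then have "0 \<le> \<delta> * D0 v" using \<delta> by simp
  with fin' have "\<kappa> * E \<le> 0" by linarith
  then show "\<kappa> \<le> 0" using pos by (simp add: mult_le_0_iff)
  show "\<kappa> < 0" if "0 < \<delta>"
  proof -
    have "0 < \<delta> * D0 v" using that D0 by simp
    with fin' have "\<kappa> * E < 0" by linarith
    then show ?thesis using pos by (simp add: mult_less_0_iff)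
  qed
qed

lemma second_form_bound_of_K_values:
  assumes V: "open V" "p \<in> V" and le: "\<And>\<kappa>. \<kappa> \<in> K_values B \<phi> \<psi> V \<Longrightarrow> \<delta> \<le> \<kappa>" and ind: "lin_indep2 v h"
  shows "\<forall>\<^sub>F t in at 0. \<delta> * den v t \<le> num v t"
proof -
  have "x0 \<in> snd c ` (V \<inter> W)" using V(2) W(2) by (auto simp: x0_def)
  then have "\<forall>\<^sub>F t in at 0. line t \<in> snd c ` (V \<inter> W)"
    by (intro topological_tendstoD[OF line_tendsto] open_image) (use V(1) W(1) in auto)
  then show ?thesis using eventually_regular eventually_lin_indep[OF ind]
  proof eventually_elim
    fix t assume t: "line t \<in> snd c ` (V \<inter> W)" "Lam (line t) \<noteq> 0" "lin_indep2 v (H (line t))"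
    then have "num v t / den v t \<in> K_values B \<phi> \<psi> (V \<inter> W)"
      unfolding K_values_iff[OF Int_lower2] by blast
    then have "num v t / den v t \<in> K_values B \<phi> \<psi> V"
      unfolding K_values_def by blast
    from le[OF this] show "\<delta> * den v t \<le> num v t"
      using gram_det_I_pos[of "line t" v "H (line t)"] t by (auto simp: \<Omega>_def le_divide_eq)
  qed
qed

text \<open>
  Here the curvature is controlled only for fields on all of \<open>U\<close>, which may extend beyond the chart.  A
  bump function times the constant field \<open>v\<close> spans with \<open>\<eta>\<close> the same planes as \<open>v\<close> near \<open>p\<close>.
\<close>

lemma second_form_bound_of_fields:
  assumes le: "\<And>X q. smooth_vf A U X \<Longrightarrow> q \<in> U - \<Sigma> \<Longrightarrow> lin_indep2 (X q) (\<eta> q) \<Longrightarrow>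
      \<delta> \<le> K_ext B \<phi> \<psi> q (X q) (\<eta> q)"
    and ind: "lin_indep2 v h"
  shows "\<forall>\<^sub>F t in at 0. \<delta> * den v t \<le> num v t"
proof -
  have "open (snd c ` fst c)" by (rule open_chart_image[OF c_in open_chart[OF c_in] order_refl])
  moreover have "x0 \<in> snd c ` fst c" using p_c by (auto simp: x0_def)
  ultimately obtain r where r: "r > 0" "cball x0 r \<subseteq> snd c ` fst c"
    using open_contains_cball by blast
  obtain \<beta> :: "real ^ 'm \<Rightarrow> real" where \<beta>: "smooth_on UNIV \<beta>" "\<And>x. x \<in> ball x0 r \<Longrightarrow> 0 < \<beta> x"
    "\<And>x. x \<notin> ball x0 r \<Longrightarrow> \<beta> x = 0"
    using smooth_bump[OF r(1), of x0] by blast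
  define X where "X = (\<lambda>q. if q \<in> fst c then \<beta> (snd c q) *\<^sub>R tvec A c q v else 0)"
  have X: "smooth_vf A U X"
    unfolding X_def by (rule smooth_vf_bump[OF c_in \<beta>(1,3) r(2) open_U])
  have "\<forall>\<^sub>F t in at 0. line t \<in> ball x0 r"
    by (rule topological_tendstoD[OF line_tendsto]) (use r(1) in auto)
  then show ?thesis using eventually_line eventually_regular eventually_lin_indep[OF ind]
  proof eventually_elim
    fix t assume t: "line t \<in> ball x0 r" "line t \<in> \<Omega>" "Lam (line t) \<noteq> 0" "lin_indep2 v (H (line t))"
    let ?x = "line t"
    let ?q = "\<xi> ?x"
    have q: "?q \<in> U" "?q \<in> fst c" "?q \<notin> \<Sigma>" "snd c ?q = ?x"
      using \<xi>_W[OF t(2)] W singular_Lam[OF t(2)] t(3) chart_\<xi>[OF t(2)] by auto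
    have b: "0 < \<beta> ?x" by (rule \<beta>(2)[OF t(1)])
    have Xq: "X ?q = tvec A c ?q (\<beta> ?x *\<^sub>R v)"
      using q(2,4) by (simp add: X_def linear_scale[OF linear_tvec[OF c_in q(2)]])
    have "lin_indep2 (\<beta> ?x *\<^sub>R v) (H ?x)"
      unfolding lin_indep2_iff
    proof (intro allI impI)
      fix a b' assume "a *\<^sub>R \<beta> ?x *\<^sub>R v + b' *\<^sub>R H ?x = 0"
      then have "a * \<beta> ?x = 0 \<and> b' = 0" using t(4) unfolding lin_indep2_iff by (metis scaleR_scaleR)
      then show "a = 0 \<and> b' = 0" using b by simp
    qed
    then have "lin_indep2 (X ?q) (\<eta> ?q)"
      unfolding Xq \<eta>_tvec[OF t(2)] by (simp add: lin_indep2_tvec[OF c_in q(2)])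
    then have "\<delta> \<le> K_ext B \<phi> \<psi> ?q (X ?q) (\<eta> ?q)" using q by (intro le[OF X]) auto
    also have "\<dots> = gram_det (II ?x) (\<beta> ?x *\<^sub>R v) (H ?x) / gram_det (I ?x) (\<beta> ?x *\<^sub>R v) (H ?x)"
      unfolding Xq \<eta>_tvec[OF t(2)] by (rule K_ext_tvec[OF t(2)])
    also have "\<dots> = gram_det (II ?x) v (H ?x) / gram_det (I ?x) v (H ?x)"
    proof -
      have "gram_det f (\<beta> ?x *\<^sub>R v) (H ?x) = (\<beta> ?x)\<^sup>2 * gram_det f v (H ?x)"
        if "bilinear f" "\<And>x y. f x y = f y x" for f
        using gram_det_change_basis[OF that, of "\<beta> ?x" v 0 "H ?x" 0 1] by simp
      then show ?thesis
        using bilinear_I[OF t(2)] bilinear_II[OF t(2)] I_sym[OF t(2)] II_sym[OF t(2)] b by simp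
    qed
    finally show "\<delta> * gram_det (I ?x) v (H ?x) \<le> gram_det (II ?x) v (H ?x)"
      using gram_det_I_pos[OF t(2-4)] by (simp add: le_divide_eq)
  qed
qed

text \<open>
  The kernel at \<open>p\<close> being a line, null vector fields are proportional there.
\<close>

lemma null_vf_transversal:
  assumes "null_vf B \<phi> U' \<eta>'" "p \<in> U'"
  shows "dlam B \<phi> p (\<eta>' p) \<noteq> 0"
proof -
  have \<eta>': "\<eta>' p \<noteq> 0" "\<phi> p (\<eta>' p) = 0" using assms singular unfolding null_vf_def by blast+
  have "frame_vec F p (P x0 (\<eta>' p)) = 0" using \<phi>_tvec(1)[OF x0_\<Omega>, of "\<eta>' p"] \<eta>'(2) by (simp add: tvec_chart_at)
  then have "P x0 (\<eta>' p) = 0" by (rule frame_vec_inj[OF F p_F])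
  then obtain \<rho> where \<rho>: "\<eta>' p = \<rho> *\<^sub>R h" by (rule kernel_null_line)
  have "dlam B \<phi> p (\<eta>' p) = \<rho> * dlam B \<phi> p (\<eta> p)"
    unfolding dlam_eq[OF Lam_x0] \<rho> by (simp add: linear_scale[OF linear_dLam[OF x0_\<Omega>]] H_x0)
  then show ?thesis using transversal \<rho> \<eta>'(1) by auto
qed

end

lemma front_A2I:
  fixes B :: "('a::{t2_space,second_countable_topology}, 'e::real_vector, 'm::finite) bundle_data"
  assumes front: "front_bundle B \<phi> \<psi>" and A2: "A2_point B \<phi> p"
    and U: "open U" "p \<in> U" "null_vf B \<phi> U \<eta>"
  shows "\<exists>F. front_A2 B \<phi> \<psi> p U \<eta> F"
proof -
  have "oriented_bundle B"
    using front by (auto simp: front_bundle_def frontal_bundle_def coherent_tangent_bundle_def)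
  then have "\<Union> (fst ` Frames B) = UNIV" by (simp add: oriented_bundle_def)
  then obtain F where F: "F \<in> Frames B" "p \<in> fst F" by blast
  obtain U0 \<eta>0 where U0: "open U0" "p \<in> U0" "null_vf B \<phi> U0 \<eta>0" "\<eta>0 p \<notin> sing_tangent B \<phi> p"
    and nd: "nondegenerate B \<phi> p"
    using A2 unfolding A2_point_def by blast
  have chart0: "front_chart B \<phi> \<psi> p U0 \<eta>0 F" using front U0 F by (simp add: front_chart_def)
  have sing: "p \<in> singular_set B \<phi>" using nd by (simp add: nondegenerate_def)
  have "front_A2 B \<phi> \<psi> p U0 \<eta>0 F"
    using chart0 sing front_chart.dlam_null_nonzero[OF chart0 nd U0(4)]
    by (simp add: front_A2_def front_A2_axioms_def)
  from front_A2.null_vf_transversal[OF this U(3,2)] sing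
  have "front_A2 B \<phi> \<psi> p U \<eta> F"
    using front U F by (simp add: front_A2_def front_A2_axioms_def front_chart_def)
  then show ?thesis ..
qed

theorem theorem3p2:
  fixes B :: "('a::{t2_space,second_countable_topology}, 'e::real_vector, 'm::finite) bundle_data"
    and \<phi> \<psi> :: "'a \<Rightarrow> real ^ 'm \<Rightarrow> 'e" and p :: 'a
  assumes "front_bundle B \<phi> \<psi>" and "A2_point B \<phi> p"
  shows "((\<exists>V. open V \<and> p \<in> V \<and> bounded (K_values B \<phi> \<psi> V)) \<longrightarrow>
            (\<forall>X Y. second_form B \<phi> \<psi> p X Y = 0))
       \<and> (\<forall>V. open V \<longrightarrow> p \<in> V \<longrightarrow>
            (\<forall>x \<in> K_values B \<phi> \<psi> V. 0 \<le> x) \<or> (\<forall>x \<in> K_values B \<phi> \<psi> V. x \<le> 0) \<longrightarrow>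
            (\<exists>W. open W \<and> p \<in> W \<and> W \<subseteq> V \<and> bounded (K_values B \<phi> \<psi> W)))
       \<and> ((\<exists>V. open V \<and> p \<in> V \<and> (\<forall>x \<in> K_values B \<phi> \<psi> V. 0 \<le> x)) \<longrightarrow>
            (\<forall>\<kappa>. singular_principal_curvature B \<phi> p \<kappa> \<longrightarrow> \<kappa> \<le> 0))
       \<and> ((\<exists>U \<eta>' \<delta>. open U \<and> p \<in> U \<and> 0 < \<delta> \<and> null_vf B \<phi> U \<eta>' \<and>
              (\<forall>X. smooth_vf (Atlas B) U X \<longrightarrow>
                 (\<forall>q \<in> U - singular_set B \<phi>. lin_indep2 (X q) (\<eta>' q) \<longrightarrow>
                    \<delta> \<le> K_ext B \<phi> \<psi> q (X q) (\<eta>' q)))) \<longrightarrow>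
            (\<forall>\<kappa>. singular_principal_curvature B \<phi> p \<kappa> \<longrightarrow> \<kappa> < 0))"
proof -
  obtain U \<eta> where U: "open U" "p \<in> U" "null_vf B \<phi> U \<eta>"
    using assms(2) unfolding A2_point_def by blast
  from front_A2I[OF assms U] obtain F where F: "front_A2 B \<phi> \<psi> p U \<eta> F" ..
  note vanish = front_A2.second_form_vanishes[OF F]
    and bounded = front_A2.K_bounded_nearby[OF F]
    and sign = front_A2.principal_curvature_sign[OF F]
    and bound = front_A2.second_form_bound_of_K_values[OF F]
  show ?thesis
  proof (intro conjI allI impI)
    fix X Y assume "\<exists>V. open V \<and> p \<in> V \<and> bounded (K_values B \<phi> \<psi> V)"
    then obtain V M where V: "open V" "p \<in> V" "\<And>x. x \<in> K_values B \<phi> \<psi> V \<Longrightarrow> \<bar>x\<bar> \<le> M"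
      unfolding bounded_iff real_norm_def by blast
    show "second_form B \<phi> \<psi> p X Y = 0"
      by (rule vanish[OF V(1,2), of 1 "- M"]) (use V(3) in \<open>auto simp: abs_le_iff minus_le_iff\<close>)
  next
    fix V assume V: "open V" "p \<in> V"
      and "(\<forall>x \<in> K_values B \<phi> \<psi> V. 0 \<le> x) \<or> (\<forall>x \<in> K_values B \<phi> \<psi> V. x \<le> 0)"
    then consider "\<forall>x \<in> K_values B \<phi> \<psi> V. 0 \<le> 1 * x" | "\<forall>x \<in> K_values B \<phi> \<psi> V. 0 \<le> (- 1) * x"
      by fastforce
    then show "\<exists>W. open W \<and> p \<in> W \<and> W \<subseteq> V \<and> bounded (K_values B \<phi> \<psi> W)"
    proof cases
      case 1
      then show ?thesis by (intro bounded[OF V, of 1 0]) auto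
    next
      case 2
      then show ?thesis by (intro bounded[OF V, of "- 1" 0]) auto
    qed
  next
    fix \<kappa> assume "\<exists>V. open V \<and> p \<in> V \<and> (\<forall>x \<in> K_values B \<phi> \<psi> V. 0 \<le> x)"
      and \<kappa>: "singular_principal_curvature B \<phi> p \<kappa>"
    then obtain V where V: "open V" "p \<in> V" "\<And>x. x \<in> K_values B \<phi> \<psi> V \<Longrightarrow> 0 \<le> x" by blast
    show "\<kappa> \<le> 0" by (rule sign(1)[OF order_refl bound[OF V] \<kappa>])
  next
    fix \<kappa> assume "\<exists>U \<eta>' \<delta>. open U \<and> p \<in> U \<and> 0 < \<delta> \<and> null_vf B \<phi> U \<eta>' \<and>
              (\<forall>X. smooth_vf (Atlas B) U X \<longrightarrow>
                 (\<forall>q \<in> U - singular_set B \<phi>. lin_indep2 (X q) (\<eta>' q) \<longrightarrow>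
                    \<delta> \<le> K_ext B \<phi> \<psi> q (X q) (\<eta>' q)))"
      and \<kappa>: "singular_principal_curvature B \<phi> p \<kappa>"
    then obtain U \<eta>' \<delta> where U: "open U" "p \<in> U" "null_vf B \<phi> U \<eta>'" and \<delta>: "0 < \<delta>"
      and le: "\<forall>X. smooth_vf (Atlas B) U X \<longrightarrow>
                 (\<forall>q \<in> U - singular_set B \<phi>. lin_indep2 (X q) (\<eta>' q) \<longrightarrow>
                    \<delta> \<le> K_ext B \<phi> \<psi> q (X q) (\<eta>' q))"
      by (elim exE conjE)
    from front_A2I[OF assms U] obtain F where F: "front_A2 B \<phi> \<psi> p U \<eta>' F" ..
    interpret front_A2 B \<phi> \<psi> p U \<eta>' F by (rule F)
    show "\<kappa> < 0"
    proof (rule principal_curvature_sign(2)[OF less_imp_le[OF \<delta>] _ \<kappa> \<delta>])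
      fix v assume ind: "lin_indep2 v h"
      show "\<forall>\<^sub>F t in at 0. \<delta> * den v t \<le> num v t"
        by (rule second_form_bound_of_fields[OF _ ind]) (rule le[rule_format])
    qed
  qed
qed

end
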